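(* Let $D,L:C([-\tau,0];\mathbb{R}^d)\to\mathbb{R}^d$ be the linear functionals $D(\psi)=\int_{[-\tau,0]}\mu(ds)\psi(s)$ and $L(\psi)=\int_{[-\tau,0]}\nu(ds)\psi(s)$, where $\mu,\nu\in M([-\tau,0];\mathbb{R}^{d\times d})$ and $\mu(\{0\})=0$. Let $\Sigma\in\mathbb{R}^{d\times m}$ and $\phi\in C([-\tau,0];\mathbb{R}^d)$. Let $x$ be the solution of the deterministic equation $$\frac{d}{dt}\big(x(t)-D(x_t)\big)=L(x_t),\quad t\ge 0;\qquad x(t)=\phi(t),\quad t\in[-\tau,0],$$ and let $\rho$ be the continuous solution (the fundamental solution, or resolvent) of $$\frac{d}{dt}\Big(\rho(t)-\int_{[-\tau,0]}\mu(ds)\rho(t+s)\Big)=\int_{[-\tau,0]}\nu(ds)\rho(t+s),\quad t\ge 0;\qquad \rho(0)=I_d,\quad \rho(t)=0 \text{ for } t\in[-\tau,0).$$ Then the unique continuous adapted process $X$ which satisfies $$d[X(t)-D(X_t)]=L(X_t)\,dt+\Sigma\,dB(t),\quad t\ge 0;\qquad X(t)=\phi(t),\quad t\in[-\tau,0],$$ obeys $$X(t)=x(t)+\int_0^t\rho(t-s)\Sigma\,dB(s),\quad t\ge 0,$$ and $X(t)=\phi(t)$ for $t\in[-\tau,0]$.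
   Context: $d,m$ are positive integers and $\tau\ge 0$ is a fixed constant. $C([-\tau,0];\mathbb{R}^d)$ is the space of continuous functions with the supremum norm. $M([-\tau,0];\mathbb{R}^{d\times d})$ is the space of finite $d\times d$-matrix-valued Borel measures on $[-\tau,0]$. For a function $x$ on $[-\tau,\infty)$ and $t\ge 0$, the segment $x_t$ is the function on $[-\tau,0]$ given by $x_t(s)=x(t+s)$. $I_d$ is the $d\times d$ identity matrix. A solution $x$ of the deterministic equation is a continuous function on $[-\tau,\infty)$ satisfying the differential equation for $t\ge0$ and the initial condition on $[-\tau,0]$. The resolvent $\rho:[0,\infty)\to\mathbb{R}^{d\times d}$ is defined in the paper as the unique continuous function on $[0,\infty)$ satisfying the stated equation, extended by $\rho(t)=0$ for $t\in[-\tau,0)$. $(\Omega,\mathcal{F},\mathbb{P})$ is a complete probability space with a filtration $\{\mathcal{F}(t)\}_{t\ge0}$ satisfying the usual conditions, and $B$ is a standard $m$-dimensional Brownian motion on it. The initial function $\phi$ is deterministic. The stochastic equation is understood in integral form: $$X(t)-D(X_t)=\phi(0)-D(\phi)+\int_0^t L(X_s)\,ds+\int_0^t\Sigma\,dB(s),\quad t\ge 0.$$ *)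

theory Defs
  imports "HOL-Probability.Probability"
begin

section \<open>Finite vector-valued Borel measures and integration against them\<close>

text \<open>
  A finite matrix-valued measure is a countably additive set function with values in the
  (finite-dimensional) space of matrices. Only its values on measurable sets are meaningful.
\<close>

definition vector_measure :: "'s measure \<Rightarrow> ('s set \<Rightarrow> 'b::real_normed_vector) \<Rightarrow> bool" where
  "vector_measure N \<kappa> \<longleftrightarrow>
     \<kappa> {} = 0 \<and>
     (\<forall>A. range A \<subseteq> sets N \<longrightarrow> disjoint_family A \<longrightarrow>
        (\<lambda>i::nat. \<kappa> (A i)) sums \<kappa> (\<Union>i. A i))"

text \<open>
  Positive part of the Jordan decomposition of a real-valued measure: the supremum of the values
  on measurable subsets. Negative values are truncated to 0 by \<^const>\<open>ennreal\<close>, which does not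
  affect the supremum because the empty set has measure 0.
\<close>

definition jordan_pos :: "'s measure \<Rightarrow> ('s set \<Rightarrow> real) \<Rightarrow> 's measure" where
  "jordan_pos N \<kappa> =
     measure_of (space N) (sets N) (\<lambda>E. SUP A\<in>{A \<in> sets N. A \<subseteq> E}. ennreal (\<kappa> A))"

definition signed_integral :: "'s measure \<Rightarrow> ('s set \<Rightarrow> real) \<Rightarrow> ('s \<Rightarrow> real) \<Rightarrow> real" where
  "signed_integral N \<kappa> f =
     (\<integral>s. f s \<partial>jordan_pos N \<kappa>) - (\<integral>s. f s \<partial>jordan_pos N (\<lambda>A. - \<kappa> A))"

abbreviation delay_borel :: "real \<Rightarrow> real measure" where
  "delay_borel \<tau> \<equiv> restrict_space borel {-\<tau>..0}"

definition matrix_measure :: "real \<Rightarrow> (real set \<Rightarrow> real^'d^'d) \<Rightarrow> bool" where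
  "matrix_measure \<tau> \<mu> \<longleftrightarrow> vector_measure (delay_borel \<tau>) \<mu>"

text \<open>The measure acts from the left: on column vectors, and on matrices column by column.\<close>

definition delay_functional ::
  "real \<Rightarrow> (real set \<Rightarrow> real^'d^'d) \<Rightarrow> (real \<Rightarrow> real^'d) \<Rightarrow> real^'d" where
  "delay_functional \<tau> \<mu> \<psi> =
     (\<chi> i. \<Sum>j\<in>UNIV. signed_integral (delay_borel \<tau>) (\<lambda>A. \<mu> A $ i $ j) (\<lambda>s. \<psi> s $ j))"

definition delay_functional_mat ::
  "real \<Rightarrow> (real set \<Rightarrow> real^'d^'d) \<Rightarrow> (real \<Rightarrow> real^'k^'d) \<Rightarrow> real^'k^'d" where
  "delay_functional_mat \<tau> \<mu> \<psi> =
     (\<chi> i k. \<Sum>j\<in>UNIV. signed_integral (delay_borel \<tau>) (\<lambda>A. \<mu> A $ i $ j) (\<lambda>s. \<psi> s $ j $ k))"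

definition segment :: "(real \<Rightarrow> 'b) \<Rightarrow> real \<Rightarrow> real \<Rightarrow> 'b" where
  "segment x t = (\<lambda>s. x (t + s))"


section \<open>The deterministic equations\<close>

definition neutral_solution ::
  "real \<Rightarrow> (real set \<Rightarrow> real^'d^'d) \<Rightarrow> (real set \<Rightarrow> real^'d^'d) \<Rightarrow> (real \<Rightarrow> real^'d) \<Rightarrow>
   (real \<Rightarrow> real^'d) \<Rightarrow> bool" where
  "neutral_solution \<tau> \<mu> \<nu> \<phi> x \<longleftrightarrow>
     continuous_on {-\<tau>..} x \<and>
     (\<forall>t\<ge>0. ((\<lambda>t. x t - delay_functional \<tau> \<mu> (segment x t))
        has_vector_derivative delay_functional \<tau> \<nu> (segment x t)) (at t within {0..})) \<and>
     (\<forall>t\<in>{-\<tau>..0}. x t = \<phi> t)"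

text \<open>
  The resolvent jumps at 0, so the right-hand side of its equation is discontinuous in \<open>t\<close>
  wherever \<open>\<nu>\<close> has an atom at \<open>-t\<close>, and a classical derivative need not exist there. The equation
  is therefore read in integrated form.
\<close>

definition resolvent ::
  "real \<Rightarrow> (real set \<Rightarrow> real^'d^'d) \<Rightarrow> (real set \<Rightarrow> real^'d^'d) \<Rightarrow> (real \<Rightarrow> real^'d^'d) \<Rightarrow> bool" where
  "resolvent \<tau> \<mu> \<nu> \<rho> \<longleftrightarrow>
     continuous_on {0..} \<rho> \<and>
     (\<forall>t\<ge>0. \<rho> t - delay_functional_mat \<tau> \<mu> (segment \<rho> t) =
        \<rho> 0 - delay_functional_mat \<tau> \<mu> (segment \<rho> 0) +
        (LINT u:{0..t}|lborel. delay_functional_mat \<tau> \<nu> (segment \<rho> u))) \<and>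
     \<rho> 0 = mat 1 \<and>
     (\<forall>t\<in>{-\<tau>..<0}. \<rho> t = 0)"


section \<open>Filtrations, Brownian motion and the Ito integral\<close>

text \<open>
  Filtrations and processes are indexed by \<^typ>\<open>real\<close>; only indices \<open>t \<ge> 0\<close> are constrained
  (the locale \<^locale>\<open>filtration\<close> would constrain negative indices too).
\<close>

definition usual_conditions :: "'a measure \<Rightarrow> (real \<Rightarrow> 'a measure) \<Rightarrow> bool" where
  "usual_conditions M F \<longleftrightarrow>
     (\<forall>t\<ge>0. subalgebra M (F t)) \<and>
     (\<forall>s t. 0 \<le> s \<longrightarrow> s \<le> t \<longrightarrow> sets (F s) \<subseteq> sets (F t)) \<and>
     (\<forall>t\<ge>0. sets (F t) = (\<Inter>u\<in>{t<..}. sets (F u))) \<and>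
     null_sets M \<subseteq> sets (F 0)"

definition adapted :: "(real \<Rightarrow> 'a measure) \<Rightarrow> (real \<Rightarrow> 'a \<Rightarrow> 'b::topological_space) \<Rightarrow> bool" where
  "adapted F X \<longleftrightarrow> (\<forall>t\<ge>0. X t \<in> borel_measurable (F t))"

definition brownian_motion ::
  "'a measure \<Rightarrow> (real \<Rightarrow> 'a measure) \<Rightarrow> (real \<Rightarrow> 'a \<Rightarrow> real^'m) \<Rightarrow> bool" where
  "brownian_motion M F B \<longleftrightarrow>
     adapted F B \<and>
     (AE \<omega> in M. B 0 \<omega> = 0) \<and>
     (AE \<omega> in M. continuous_on {0..} (\<lambda>t. B t \<omega>)) \<and>
     (\<forall>s t. 0 \<le> s \<longrightarrow> s < t \<longrightarrow>
        prob_space.indep_set M (sets (F s))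
          {(\<lambda>\<omega>. B t \<omega> - B s \<omega>) -` A \<inter> space M | A. A \<in> sets borel} \<and>
        prob_space.indep_vars M (\<lambda>_. borel) (\<lambda>k \<omega>. (B t \<omega> - B s \<omega>) $ k) UNIV \<and>
        (\<forall>k. distributed M lborel (\<lambda>\<omega>. (B t \<omega> - B s \<omega>) $ k)
               (normal_density 0 (sqrt (t - s)))))"

text \<open>
  A simple process on \<open>[0,t]\<close> is given by a partition \<open>p 0 < \<dots> < p n\<close> of \<open>[0,t]\<close> and bounded random
  matrices \<open>\<xi> i\<close> measurable at time \<open>p i\<close>; for \<open>t = 0\<close> the partition has \<open>n = 0\<close>.
\<close>

definition simple_process_data ::
  "'a measure \<Rightarrow> (real \<Rightarrow> 'a measure) \<Rightarrow> real \<Rightarrow> nat \<Rightarrow> (nat \<Rightarrow> real) \<Rightarrow>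
   (nat \<Rightarrow> 'a \<Rightarrow> real^'m^'d) \<Rightarrow> bool" where
  "simple_process_data M F t n p \<xi> \<longleftrightarrow>
     p 0 = 0 \<and> p n = t \<and> (\<forall>i<n. p i < p (Suc i)) \<and>
     (\<forall>i<n. \<xi> i \<in> borel_measurable (F (p i)) \<and> (\<exists>C. \<forall>\<omega>\<in>space M. norm (\<xi> i \<omega>) \<le> C))"

definition simple_process ::
  "nat \<Rightarrow> (nat \<Rightarrow> real) \<Rightarrow> (nat \<Rightarrow> 'a \<Rightarrow> real^'m^'d) \<Rightarrow> real \<Rightarrow> 'a \<Rightarrow> real^'m^'d" where
  "simple_process n p \<xi> s \<omega> = (\<Sum>i<n. indicator {p i<..p (Suc i)} s *\<^sub>R \<xi> i \<omega>)"

definition simple_ito_integral ::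
  "(real \<Rightarrow> 'a \<Rightarrow> real^'m) \<Rightarrow> nat \<Rightarrow> (nat \<Rightarrow> real) \<Rightarrow> (nat \<Rightarrow> 'a \<Rightarrow> real^'m^'d) \<Rightarrow>
   'a \<Rightarrow> real^'d" where
  "simple_ito_integral B n p \<xi> \<omega> = (\<Sum>i<n. \<xi> i \<omega> *v (B (p (Suc i)) \<omega> - B (p i) \<omega>))"

text \<open>
  The random vector \<open>Y\<close> is a version of the Ito integral of the adapted process \<open>G\<close> over \<open>[0,t]\<close>.
  It is defined up to almost sure equality, as a mean-square limit of integrals of simple processes
  approximating \<open>G\<close> in mean square. The norm of \<^typ>\<open>real^'m^'d\<close> is the Frobenius norm.
\<close>

definition has_ito_integral ::
  "'a measure \<Rightarrow> (real \<Rightarrow> 'a measure) \<Rightarrow> (real \<Rightarrow> 'a \<Rightarrow> real^'m) \<Rightarrow> real \<Rightarrow>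
   (real \<Rightarrow> 'a \<Rightarrow> real^'m^'d) \<Rightarrow> ('a \<Rightarrow> real^'d) \<Rightarrow> bool" where
  "has_ito_integral M F B t G Y \<longleftrightarrow>
     (\<lambda>(s, \<omega>). G s \<omega>) \<in> borel_measurable (restrict_space lborel {0..t} \<Otimes>\<^sub>M M) \<and>
     (\<forall>s\<in>{0..t}. G s \<in> borel_measurable (F s)) \<and>
     Y \<in> borel_measurable M \<and>
     (\<exists>n p \<xi>. (\<forall>k::nat. simple_process_data M F t (n k) (p k) (\<xi> k)) \<and>
        (\<lambda>k. \<integral>\<^sup>+\<omega>. (\<integral>\<^sup>+s\<in>{0..t}.
             ennreal ((norm (simple_process (n k) (p k) (\<xi> k) s \<omega> - G s \<omega>))\<^sup>2) \<partial>lborel) \<partial>M)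
          \<longlonglongrightarrow> 0 \<and>
        (\<lambda>k. \<integral>\<^sup>+\<omega>. ennreal ((norm (simple_ito_integral B (n k) (p k) (\<xi> k) \<omega> - Y \<omega>))\<^sup>2) \<partial>M)
          \<longlonglongrightarrow> 0)"


section \<open>The stochastic neutral equation\<close>

text \<open>The process \<open>J\<close> below is a version of the integral process of the constant integrand \<open>\<Sigma>\<close>.\<close>

definition stochastic_neutral_solution ::
  "'a measure \<Rightarrow> (real \<Rightarrow> 'a measure) \<Rightarrow> (real \<Rightarrow> 'a \<Rightarrow> real^'m) \<Rightarrow> real \<Rightarrow>
   (real set \<Rightarrow> real^'d^'d) \<Rightarrow> (real set \<Rightarrow> real^'d^'d) \<Rightarrow> real^'m^'d \<Rightarrow> (real \<Rightarrow> real^'d) \<Rightarrow>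
   (real \<Rightarrow> 'a \<Rightarrow> real^'d) \<Rightarrow> bool" where
  "stochastic_neutral_solution M F B \<tau> \<mu> \<nu> \<Sigma> \<phi> X \<longleftrightarrow>
     adapted F X \<and>
     (AE \<omega> in M. continuous_on {-\<tau>..} (\<lambda>t. X t \<omega>)) \<and>
     (AE \<omega> in M. \<forall>t\<in>{-\<tau>..0}. X t \<omega> = \<phi> t) \<and>
     (\<exists>J. (\<forall>t\<ge>0. has_ito_integral M F B t (\<lambda>s \<omega>. \<Sigma>) (J t)) \<and>
        (AE \<omega> in M. \<forall>t\<ge>0.
           X t \<omega> - delay_functional \<tau> \<mu> (segment (\<lambda>r. X r \<omega>) t) =
           \<phi> 0 - delay_functional \<tau> \<mu> \<phi> +
           (LINT s:{0..t}|lborel. delay_functional \<tau> \<nu> (segment (\<lambda>r. X r \<omega>) s)) +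
           J t \<omega>))"

end

theory Submission
  imports Defs "HOL-Real_Asymp.Real_Asymp"
begin

text \<open>
  The equation is linear, so the difference of a stochastic solution \<open>X\<close> and the deterministic
  solution \<open>x\<close> satisfies, along almost every path, the integrated neutral equation with zero past and
  with the continuous forcing \<open>W t - W 0\<close>, where \<open>W = \<Sigma> B\<close> (lemma \<open>sde_forced\<close>). Most of the
  argument is about this forced equation \<open>y t = D (y\<^sub>t) + \<integral> L (y\<^sub>u) du + f t\<close>, one path at a time.

  Its solutions depend continuously on \<open>f\<close>: since \<open>\<mu>\<close> has no atom at 0, the right-hand side is a
  contraction in a norm weighted by \<open>exp (- l t)\<close> with \<open>l\<close> large, and on \<open>[0, T]\<close> the solution is bounded by
  a constant times the supremum of the forcing (\<open>forced_bound\<close>). Uniqueness is immediate.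

  The resolvent, multiplied by a vector, is the solution for constant forcing. Hence the sum of the
  vectors \<open>\<rho> (t - s\<^sub>i\<^sub>+\<^sub>1) (W s\<^sub>i\<^sub>+\<^sub>1 - W s\<^sub>i)\<close> over a grid solves the equation whose forcing is the step
  interpolation of \<open>W - W 0\<close> (\<open>forced_grid_convolution\<close>). As the grid is refined the forcing converges
  uniformly, so these sums converge uniformly to the solution forced by \<open>W - W 0\<close>
  (\<open>uniform_limit_grid_convolution\<close>). The limit exists for every continuous path, is continuous and
  adapted, and this gives existence (\<open>sde_exists\<close>).

  The same sums, on dyadic grids ending at \<open>t\<close>, are the Ito integrals of step functions approximating
  \<open>s \<mapsto> \<rho> (t - s) \<Sigma>\<close>. They are Cauchy in mean square by the Ito isometry, and their almost sure limit
  \<open>X t - x t\<close> must be their mean-square limit (\<open>has_ito_integral_deterministicI\<close>). That is the asserted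
  variation of constants formula. The isometry also shows that the integral of the constant \<open>\<Sigma>\<close>, which
  the equation mentions, is \<open>\<Sigma> (B t - B 0)\<close> up to null sets (\<open>has_ito_integral_const_unique\<close>).
\<close>

section \<open>Signed measures and their Jordan parts\<close>

lemma vector_measure_disjoint_union:
  fixes \<kappa> :: "'s set \<Rightarrow> 'b::real_normed_vector"
  assumes "vector_measure N \<kappa>" "A \<in> sets N" "B \<in> sets N" "A \<inter> B = {}"
  shows "\<kappa> (A \<union> B) = \<kappa> A + \<kappa> B"
proof -
  have "range (binaryset A B) \<subseteq> sets N"
    using assms(2,3) by (simp add: range_binaryset_eq)
  moreover have "disjoint_family (binaryset A B)"
    using assms(4) by (auto simp: disjoint_family_on_def binaryset_def)
  ultimately have "(\<lambda>i. \<kappa> (binaryset A B i)) sums \<kappa> (\<Union>i. binaryset A B i)"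
    using assms(1) by (auto simp: vector_measure_def)
  moreover have "(\<lambda>i. \<kappa> (binaryset A B i)) sums (\<kappa> A + \<kappa> B)"
    using assms(1) by (intro binaryset_sums) (simp add: vector_measure_def)
  ultimately show ?thesis
    by (simp add: UN_binaryset_eq sums_unique2)
qed

text \<open>
  If the values on the subsets of \<open>E\<close> were unbounded, then \<open>E\<close> could be cut into two pieces, one of
  them again with unbounded values and the other of value larger than 1 in norm. Repeating this
  produces infinitely many disjoint sets of value larger than 1, whose values cannot be summed.
\<close>

lemma vector_measure_bounded:
  fixes \<kappa> :: "'s set \<Rightarrow> 'b::real_normed_vector"
  assumes \<kappa>: "vector_measure N \<kappa>"
  shows "\<exists>K. \<forall>A\<in>sets N. norm (\<kappa> A) \<le> K"
proof (rule ccontr)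
  define unb where "unb E \<longleftrightarrow> E \<in> sets N \<and> (\<forall>K. \<exists>A\<in>sets N. A \<subseteq> E \<and> norm (\<kappa> A) > K)" for E
  assume "\<not> ?thesis"
  then have "unb (space N)"
    unfolding unb_def by (metis not_le sets.sets_into_space sets.top)
  have step: "\<exists>E'. (unb E' \<and> E' \<subseteq> E) \<and> norm (\<kappa> (E - E')) > 1" if E: "unb E" for E
  proof -
    have [measurable]: "E \<in> sets N" using E by (simp add: unb_def)
    obtain A where A[measurable]: "A \<in> sets N" and "A \<subseteq> E" and big: "norm (\<kappa> A) > norm (\<kappa> E) + 1"
      using E unfolding unb_def by blast
    have "\<kappa> E = \<kappa> A + \<kappa> (E - A)"
      using vector_measure_disjoint_union[OF \<kappa>, of A "E - A"] \<open>A \<subseteq> E\<close> by (simp add: Un_absorb1)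
    then have "norm (\<kappa> A) \<le> norm (\<kappa> E) + norm (\<kappa> (E - A))"
      by (metis add_diff_cancel_right' norm_triangle_ineq4)
    with big have compl: "norm (\<kappa> (E - A)) > 1" by linarith
    have "norm (\<kappa> A) > 1" using big by (smt (verit) norm_ge_zero)
    have "unb A \<or> unb (E - A)"
    proof (rule ccontr)
      assume "\<not> (unb A \<or> unb (E - A))"
      then obtain K1 K2 where K: "\<And>C. C \<in> sets N \<Longrightarrow> C \<subseteq> A \<Longrightarrow> norm (\<kappa> C) \<le> K1"
        "\<And>C. C \<in> sets N \<Longrightarrow> C \<subseteq> E - A \<Longrightarrow> norm (\<kappa> C) \<le> K2"
        unfolding unb_def by (metis A \<open>E \<in> sets N\<close> not_le sets.Diff)
      obtain C where C[measurable]: "C \<in> sets N" and "C \<subseteq> E" "norm (\<kappa> C) > K1 + K2"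
        using E unfolding unb_def by blast
      have "C = (C \<inter> A) \<union> (C - A)" by blast
      then have "\<kappa> C = \<kappa> (C \<inter> A) + \<kappa> (C - A)"
        using vector_measure_disjoint_union[OF \<kappa>, of "C \<inter> A" "C - A"] by auto
      then have "norm (\<kappa> C) \<le> norm (\<kappa> (C \<inter> A)) + norm (\<kappa> (C - A))"
        by (simp add: norm_triangle_ineq)
      also have "\<dots> \<le> K1 + K2"
        using \<open>C \<subseteq> E\<close> by (intro add_mono K) auto
      finally show False using \<open>norm (\<kappa> C) > K1 + K2\<close> by simp
    qed
    then show ?thesis
    proof
      assume "unb A" then show ?thesis using \<open>A \<subseteq> E\<close> compl by blast
    next
      assume "unb (E - A)"
      then show ?thesis
        using \<open>norm (\<kappa> A) > 1\<close> \<open>A \<subseteq> E\<close> by (intro exI[of _ "E - A"]) (simp add: double_diff)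
    qed
  qed
  obtain E where E: "\<And>n. unb (E n)" "\<And>n. E (Suc n) \<subseteq> E n" "\<And>n. norm (\<kappa> (E n - E (Suc n))) > 1"
    using dependent_nat_choice[of "\<lambda>_ E. unb E" "\<lambda>_ E E'. E' \<subseteq> E \<and> norm (\<kappa> (E - E')) > 1"]
      step \<open>unb (space N)\<close> by metis
  have anti: "E n \<subseteq> E m" if "m \<le> n" for m n
    using lift_Suc_antimono_le[of E] E(2) that by blast
  have "disjoint_family (\<lambda>n. E n - E (Suc n))"
    unfolding disjoint_family_on_def
  proof (intro ballI impI)
    fix m n :: nat assume "m \<noteq> n"
    then have "Suc m \<le> n \<or> Suc n \<le> m" by auto
    then show "(E m - E (Suc m)) \<inter> (E n - E (Suc n)) = {}"
      using anti by blast
  qed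
  moreover have "range (\<lambda>n. E n - E (Suc n)) \<subseteq> sets N"
    using E(1) by (auto simp: unb_def)
  ultimately have "summable (\<lambda>n. \<kappa> (E n - E (Suc n)))"
    using \<kappa> by (auto simp: vector_measure_def summable_def)
  then have "(\<lambda>n. norm (\<kappa> (E n - E (Suc n)))) \<longlonglongrightarrow> 0"
    using summable_LIMSEQ_zero tendsto_norm_zero by blast
  then have "\<forall>\<^sub>F n in sequentially. norm (\<kappa> (E n - E (Suc n))) < 1"
    by (rule order_tendstoD) simp
  then show False
    using E(3) by (auto simp: eventually_sequentially not_less intro: less_imp_le)
       (meson E(3) less_asym order_refl)
qed

lemma vector_measure_bounded_linear:
  assumes "vector_measure N \<kappa>" "bounded_linear g"
  shows "vector_measure N (\<lambda>A. g (\<kappa> A))"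
  using assms bounded_linear.sums[OF assms(2)]
  by (auto simp: vector_measure_def linear_0 bounded_linear.linear)

lemma sets_jordan_pos [simp, measurable_cong]: "sets (jordan_pos N \<kappa>) = sets N"
  by (simp add: jordan_pos_def)

lemma space_jordan_pos [simp]: "space (jordan_pos N \<kappa>) = space N"
  by (simp add: jordan_pos_def)

text \<open>
  If the supremum defines a countably additive function, this is an equality; otherwise
  \<^const>\<open>measure_of\<close> is the null measure. In both cases the bound gives finiteness and null sets.
\<close>

lemma emeasure_jordan_pos_le:
  assumes "E \<in> sets N"
  shows "emeasure (jordan_pos N \<kappa>) E \<le> (SUP A\<in>{A \<in> sets N. A \<subseteq> E}. ennreal (\<kappa> A))"
  using assms unfolding jordan_pos_def
  by (subst emeasure_measure_of_conv) (auto simp: sets.sigma_sets_eq)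

lemma finite_measure_jordan_pos:
  assumes "vector_measure N \<kappa>"
  shows "finite_measure (jordan_pos N \<kappa>)"
proof
  obtain K where K: "\<And>A. A \<in> sets N \<Longrightarrow> norm (\<kappa> A) \<le> K"
    using vector_measure_bounded[OF assms] by blast
  have "emeasure (jordan_pos N \<kappa>) (space N) \<le> (SUP A\<in>{A \<in> sets N. A \<subseteq> space N}. ennreal (\<kappa> A))"
    by (rule emeasure_jordan_pos_le) simp
  also have "\<dots> \<le> ennreal K"
    using K by (intro SUP_least ennreal_leI) (auto simp: abs_le_iff)
  finally show "emeasure (jordan_pos N \<kappa>) (space (jordan_pos N \<kappa>)) \<noteq> \<infinity>"
    by (auto simp: top_unique)
qed

lemma emeasure_jordan_pos_singleton:
  assumes "vector_measure N \<kappa>" "{a} \<in> sets N" "\<kappa> {a} = 0"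
  shows "emeasure (jordan_pos N \<kappa>) {a} = 0"
proof -
  have "(SUP A\<in>{A \<in> sets N. A \<subseteq> {a}}. ennreal (\<kappa> A)) \<le> 0"
  proof (rule SUP_least)
    fix A assume "A \<in> {A \<in> sets N. A \<subseteq> {a}}"
    then have "A = {} \<or> A = {a}" by auto
    then show "ennreal (\<kappa> A) \<le> 0"
      using assms by (auto simp: vector_measure_def)
  qed
  then show ?thesis
    using emeasure_jordan_pos_le[OF assms(2), of \<kappa>] by simp
qed

section \<open>Delay functionals and their majorants\<close>

text \<open>
  The positive (\<open>pos\<close> true) and negative parts of the entry \<open>(i, j)\<close>, indexed by a Boolean so that a
  statement about both is a single statement.
\<close>

definition delay_variations :: "real \<Rightarrow> (real set \<Rightarrow> real^'d^'d) \<Rightarrow> 'd \<Rightarrow> 'd \<Rightarrow> bool \<Rightarrow> real measure" where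
  "delay_variations \<tau> \<mu> i j pos = jordan_pos (delay_borel \<tau>) (\<lambda>A. if pos then \<mu> A $ i $ j else - (\<mu> A $ i $ j))"

lemma delay_functional_eq:
  "delay_functional \<tau> \<mu> \<psi> = (\<chi> i. \<Sum>j\<in>UNIV. (\<integral>s. \<psi> s $ j \<partial>delay_variations \<tau> \<mu> i j True) - (\<integral>s. \<psi> s $ j \<partial>delay_variations \<tau> \<mu> i j False))"
  by (simp add: delay_functional_def signed_integral_def delay_variations_def)

lemma delay_functional_mat_eq:
  "delay_functional_mat \<tau> \<mu> \<psi> = (\<chi> i k. \<Sum>j\<in>UNIV. (\<integral>s. \<psi> s $ j $ k \<partial>delay_variations \<tau> \<mu> i j True) - (\<integral>s. \<psi> s $ j $ k \<partial>delay_variations \<tau> \<mu> i j False))"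
  by (simp add: delay_functional_mat_def signed_integral_def delay_variations_def)

lemma sets_delay_variations [simp, measurable_cong]:
  "sets (delay_variations \<tau> \<mu> i j p) = sets (delay_borel \<tau>)"
  by (simp add: delay_variations_def)

lemma space_delay_variations [simp]: "space (delay_variations \<tau> \<mu> i j p) = {-\<tau>..0}"
  by (simp add: delay_variations_def space_restrict_space)

lemma vector_measure_entry:
  fixes \<mu> :: "real set \<Rightarrow> real^'d^'d"
  assumes "matrix_measure \<tau> \<mu>"
  shows "vector_measure (delay_borel \<tau>) (\<lambda>A. if p then \<mu> A $ i $ j else - (\<mu> A $ i $ j))"
proof -
  have "bounded_linear (\<lambda>x::real^'d^'d. if p then x $ i $ j else - (x $ i $ j))"
    by (cases p) (auto intro!: bounded_linear_intros bounded_linear_compose[OF bounded_linear_vec_nth] bounded_linear_vec_nth bounded_linear_minus)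
  from vector_measure_bounded_linear[OF assms[unfolded matrix_measure_def] this] show ?thesis .
qed

lemma finite_measure_delay_variations:
  "matrix_measure \<tau> \<mu> \<Longrightarrow> finite_measure (delay_variations \<tau> \<mu> i j p)"
  unfolding delay_variations_def by (intro finite_measure_jordan_pos vector_measure_entry)

text \<open>
  The integral of \<open>g\<close> against the sum of the total variations of the entries; with \<open>g = 1\<close> it bounds
  the operator norm of the delay functional.
\<close>

definition delay_majorant :: "real \<Rightarrow> (real set \<Rightarrow> real^'d^'d) \<Rightarrow> (real \<Rightarrow> real) \<Rightarrow> real" where
  "delay_majorant \<tau> \<mu> g = (\<Sum>i\<in>UNIV. \<Sum>j\<in>UNIV. \<Sum>p\<in>UNIV. \<integral>s. g s \<partial>delay_variations \<tau> \<mu> i j p)"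

text \<open>
  Bounded measurable functions: the integrals of these converge, so the delay functionals are linear on
  them. Continuous functions would not suffice, since the resolvent jumps at 0.
\<close>

definition admissible :: "real \<Rightarrow> (real \<Rightarrow> 'b::real_normed_vector) \<Rightarrow> bool" where
  "admissible \<tau> \<psi> \<longleftrightarrow> \<psi> \<in> borel_measurable (delay_borel \<tau>) \<and> (\<exists>K. \<forall>s\<in>{-\<tau>..0}. norm (\<psi> s) \<le> K)"

lemma integrable_delay_variations:
  fixes \<psi> :: "real \<Rightarrow> 'b::{banach, second_countable_topology}"
  assumes "matrix_measure \<tau> \<mu>" "admissible \<tau> \<psi>"
  shows "integrable (delay_variations \<tau> \<mu> i j p) \<psi>"
proof -
  interpret finite_measure "delay_variations \<tau> \<mu> i j p"
    by (rule finite_measure_delay_variations) fact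
  obtain K where "\<And>s. s \<in> {-\<tau>..0} \<Longrightarrow> norm (\<psi> s) \<le> K"
    using assms(2) unfolding admissible_def by metis
  with assms(2) show ?thesis
    by (intro integrable_const_bound[where B=K] AE_I2) (auto simp: admissible_def)
qed

lemma admissible_linear:
  assumes "admissible \<tau> \<psi>" "bounded_linear (g :: 'b::{real_normed_vector,second_countable_topology} \<Rightarrow> 'c::real_normed_vector)"
  shows "admissible \<tau> (\<lambda>s. g (\<psi> s))"
  unfolding admissible_def
proof
  have [measurable]: "\<psi> \<in> borel_measurable (delay_borel \<tau>)" using assms(1) by (simp add: admissible_def)
  have [measurable]: "g \<in> borel_measurable borel"
    using assms(2) by (intro borel_measurable_continuous_onI) (simp add: linear_continuous_on)
  show "(\<lambda>s. g (\<psi> s)) \<in> borel_measurable (delay_borel \<tau>)" by measurable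
  obtain K where K: "\<And>s. s \<in> {-\<tau>..0} \<Longrightarrow> norm (\<psi> s) \<le> K"
    using assms(1) unfolding admissible_def by metis
  obtain C where C: "C > 0" "\<And>x. norm (g x) \<le> norm x * C"
    using bounded_linear.pos_bounded[OF assms(2)] by blast
  have "norm (g (\<psi> s)) \<le> K * C" if "s \<in> {-\<tau>..0}" for s
    using C(2)[of "\<psi> s"] K[OF that] C(1) by (smt (verit) mult_right_mono)
  then show "\<exists>K. \<forall>s\<in>{-\<tau>..0}. norm (g (\<psi> s)) \<le> K" by blast
qed

lemma integrable_delay_variations_entry:
  fixes \<psi> :: "real \<Rightarrow> real^'d"
  assumes "matrix_measure \<tau> \<mu>" "admissible \<tau> \<psi>"
  shows "integrable (delay_variations \<tau> \<mu> i j p) (\<lambda>s. \<psi> s $ k)"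
  using integrable_delay_variations[OF assms(1) admissible_linear[OF assms(2) bounded_linear_vec_nth]] .

lemma admissible_add:
  fixes \<psi> :: "real \<Rightarrow> 'b::{real_normed_vector, second_countable_topology}"
  assumes "admissible \<tau> \<psi>" "admissible \<tau> \<psi>'"
  shows "admissible \<tau> (\<lambda>s. \<psi> s + \<psi>' s)"
  using assms unfolding admissible_def
  by (auto intro: borel_measurable_add) (meson add_mono atLeastAtMost_iff norm_triangle_le)

lemma admissible_diff:
  fixes \<psi> :: "real \<Rightarrow> 'b::{real_normed_vector, second_countable_topology}"
  assumes "admissible \<tau> \<psi>" "admissible \<tau> \<psi>'"
  shows "admissible \<tau> (\<lambda>s. \<psi> s - \<psi>' s)"
  using admissible_add[OF assms(1) admissible_linear[OF assms(2), of uminus]]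
  by (simp add: bounded_linear_minus)

lemma admissible_continuous_on:
  assumes "continuous_on {-\<tau>..0} \<psi>"
  shows "admissible \<tau> \<psi>"
proof -
  have "compact (\<psi> ` {-\<tau>..0})" using assms by (intro compact_continuous_image) auto
  then have "\<exists>K. \<forall>s\<in>{-\<tau>..0}. norm (\<psi> s) \<le> K"
    using compact_imp_bounded bounded_iff by (metis imageI)
  then show ?thesis
    using borel_measurable_continuous_on_restrict[OF assms] by (simp add: admissible_def)
qed

lemma delay_functional_cong:
  assumes "\<And>s. s \<in> {-\<tau>..0} \<Longrightarrow> \<psi> s = \<psi>' s"
  shows "delay_functional \<tau> \<mu> \<psi> = delay_functional \<tau> \<mu> \<psi>'"
  unfolding delay_functional_eq using assms
  by (intro vec_eq_iff[THEN iffD2]) (auto intro!: sum.cong Bochner_Integration.integral_cong arg_cong2[where f="(-)"])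

lemma delay_functional_mat_cong:
  assumes "\<And>s. s \<in> {-\<tau>..0} \<Longrightarrow> \<psi> s = \<psi>' s"
  shows "delay_functional_mat \<tau> \<mu> \<psi> = delay_functional_mat \<tau> \<mu> \<psi>'"
  unfolding delay_functional_mat_eq using assms
  by (intro vec_eq_iff[THEN iffD2]) (auto simp: vec_eq_iff intro!: sum.cong Bochner_Integration.integral_cong arg_cong2[where f="(-)"])

lemma delay_functional_diff:
  fixes \<psi> :: "real \<Rightarrow> real^'d"
  assumes "matrix_measure \<tau> \<mu>" "admissible \<tau> \<psi>" "admissible \<tau> \<psi>'"
  shows "delay_functional \<tau> \<mu> (\<lambda>s. \<psi> s - \<psi>' s) = delay_functional \<tau> \<mu> \<psi> - delay_functional \<tau> \<mu> \<psi>'"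
proof -
  have "integrable (delay_variations \<tau> \<mu> i j p) (\<lambda>s. \<psi> s $ j)"
    "integrable (delay_variations \<tau> \<mu> i j p) (\<lambda>s. \<psi>' s $ j)" for i j p
    using assms by (auto intro: integrable_delay_variations_entry)
  then have "(\<integral>s. (\<psi> s - \<psi>' s) $ j \<partial>delay_variations \<tau> \<mu> i j p) =
      (\<integral>s. \<psi> s $ j \<partial>delay_variations \<tau> \<mu> i j p) - (\<integral>s. \<psi>' s $ j \<partial>delay_variations \<tau> \<mu> i j p)" for i j p
    by (simp only: vector_minus_component Bochner_Integration.integral_diff)
  then show ?thesis
    by (simp add: delay_functional_eq vec_eq_iff sum_subtractf)
qed

lemma delay_functional_0: "delay_functional \<tau> \<mu> (\<lambda>s. 0) = 0"
  by (simp add: delay_functional_eq vec_eq_iff)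

lemma delay_functional_add:
  fixes \<psi> :: "real \<Rightarrow> real^'d"
  assumes "matrix_measure \<tau> \<mu>" "admissible \<tau> \<psi>" "admissible \<tau> \<psi>'"
  shows "delay_functional \<tau> \<mu> (\<lambda>s. \<psi> s + \<psi>' s) = delay_functional \<tau> \<mu> \<psi> + delay_functional \<tau> \<mu> \<psi>'"
  using delay_functional_diff[OF assms(1) admissible_add[OF assms(2,3)] assms(3)]
  by simp

lemma delay_functional_matrix_vector:
  fixes \<Phi> :: "real \<Rightarrow> real^'k^'d"
  assumes "matrix_measure \<tau> \<mu>" "admissible \<tau> \<Phi>"
  shows "delay_functional \<tau> \<mu> (\<lambda>s. \<Phi> s *v w) = delay_functional_mat \<tau> \<mu> \<Phi> *v w"
proof -
  have I[simp]: "integrable (delay_variations \<tau> \<mu> i j p) (\<lambda>s. \<Phi> s $ j $ k)" for i j k p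
    using integrable_delay_variations_entry[OF assms(1) admissible_linear[OF assms(2) bounded_linear_vec_nth]] .
  show ?thesis
    unfolding delay_functional_eq delay_functional_mat_eq matrix_vector_mult_def
    apply (simp add: vec_eq_iff sum_distrib_right left_diff_distrib sum_subtractf[symmetric] cong: if_cong)
    apply (intro allI)
    apply (subst sum.swap)
    apply simp
    done
qed

lemma norm_delay_functional_le_majorant:
  assumes "matrix_measure \<tau> \<mu>" "admissible \<tau> \<psi>" "admissible \<tau> g"
    and "\<And>s. s \<in> {-\<tau>..0} \<Longrightarrow> norm (\<psi> s) \<le> g s"
  shows "norm (delay_functional \<tau> \<mu> \<psi>) \<le> delay_majorant \<tau> \<mu> g"
proof -
  have *: "\<bar>\<integral>s. \<psi> s $ j \<partial>delay_variations \<tau> \<mu> i j p\<bar> \<le> (\<integral>s. g s \<partial>delay_variations \<tau> \<mu> i j p)" for i j p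
  proof (rule integral_abs_bound_integral)
    show "integrable (delay_variations \<tau> \<mu> i j p) (\<lambda>s. \<psi> s $ j)"
      using assms(1,2) by (rule integrable_delay_variations_entry)
    show "integrable (delay_variations \<tau> \<mu> i j p) g"
      using assms by (auto intro!: integrable_delay_variations)
    show "\<bar>\<psi> s $ j\<bar> \<le> g s" if "s \<in> space (delay_variations \<tau> \<mu> i j p)" for s
      using assms(4)[of s] component_le_norm_cart[of "\<psi> s" j] that by simp
  qed
  have "norm (delay_functional \<tau> \<mu> \<psi>) \<le> (\<Sum>i\<in>UNIV. \<bar>delay_functional \<tau> \<mu> \<psi> $ i\<bar>)"
    by (rule norm_le_l1_cart)
  also have "\<dots> \<le> delay_majorant \<tau> \<mu> g"
    unfolding delay_majorant_def delay_functional_eq vec_lambda_beta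
  proof (intro sum_mono order_trans[OF sum_abs])
    fix i j
    have "\<bar>a - b\<bar> \<le> A + B" if "\<bar>a\<bar> \<le> A" "\<bar>b\<bar> \<le> B" for a b A B :: real
      using that by linarith
    from this[OF *[where i=i and j=j and p=True] *[where i=i and j=j and p=False]]
    show "\<bar>(\<integral>s. \<psi> s $ j \<partial>delay_variations \<tau> \<mu> i j True) - (\<integral>s. \<psi> s $ j \<partial>delay_variations \<tau> \<mu> i j False)\<bar>
      \<le> (\<Sum>p\<in>UNIV. \<integral>s. g s \<partial>delay_variations \<tau> \<mu> i j p)"
      by (simp add: UNIV_bool add.commute)
  qed
  finally show ?thesis .
qed

lemma delay_majorant_cmult: "delay_majorant \<tau> \<mu> (\<lambda>s. c * g s) = c * delay_majorant \<tau> \<mu> g"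
  by (simp add: delay_majorant_def sum_distrib_left)

lemma delay_majorant_nonneg: "(\<And>s. s \<in> {-\<tau>..0} \<Longrightarrow> g s \<ge> 0) \<Longrightarrow> delay_majorant \<tau> \<mu> g \<ge> 0"
  unfolding delay_majorant_def by (intro sum_nonneg integral_nonneg_AE AE_I2) auto

text \<open>
  The contraction property behind the whole theory. The weights \<open>exp (l * s)\<close> decrease to 0 at every
  \<open>s < 0\<close>, and the absence of an atom of \<open>\<mu>\<close> at 0 makes this almost everywhere, so dominated
  convergence applies. An atom at 0 would contribute its full size for every \<open>l\<close>.
\<close>

lemma delay_majorant_exp_tendsto_0:
  fixes \<mu> :: "real set \<Rightarrow> real^'d^'d"
  assumes "matrix_measure \<tau> \<mu>" "\<mu> {0} = 0" "\<tau> \<ge> 0"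
  shows "((\<lambda>l. delay_majorant \<tau> \<mu> (\<lambda>s. exp (l * s))) \<longlongrightarrow> 0) at_top"
proof -
  have "((\<lambda>l. \<integral>s. exp (l * s) \<partial>delay_variations \<tau> \<mu> i j p) \<longlongrightarrow> 0) at_top" for i j p
  proof -
    let ?P = "delay_variations \<tau> \<mu> i j p"
    interpret finite_measure ?P
      by (rule finite_measure_delay_variations) fact
    have sets0: "{0} \<in> sets (delay_borel \<tau>)"
      using assms(3) by (subst sets_restrict_space_iff) auto
    have "emeasure ?P {0} = 0"
      unfolding delay_variations_def
      using assms(1,2) sets0 by (intro emeasure_jordan_pos_singleton vector_measure_entry) auto
    then have "{0} \<in> null_sets ?P"
      using sets0 by auto
    then have "AE s in ?P. s \<noteq> 0"
      by (rule AE_I') auto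
    have "((\<lambda>l. \<integral>s. exp (l * s) \<partial>?P) \<longlongrightarrow> (\<integral>s. 0 \<partial>?P)) at_top"
    proof (rule integral_dominated_convergence_at_top[where w="\<lambda>_. 1"])
      show "AE s in ?P. ((\<lambda>l. exp (l * s)) \<longlongrightarrow> 0) at_top"
        using \<open>AE s in ?P. s \<noteq> 0\<close> AE_space
      proof eventually_elim
        case (elim s)
        then have "s < 0" by auto
        then show ?case
          by (auto intro!: filterlim_compose[OF exp_at_bot] filterlim_tendsto_neg_mult_at_bot
                simp: mult.commute[of _ s] filterlim_ident)
      qed
      show "\<forall>\<^sub>F l in at_top. AE s in ?P. norm (exp (l * s)) \<le> 1"
        using eventually_ge_at_top[of 0]
        by eventually_elim (auto intro!: AE_I2 simp: mult_nonneg_nonpos)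
      show "(\<lambda>s. exp (l * s)) \<in> borel_measurable ?P" for l
        using admissible_continuous_on[of \<tau> "\<lambda>s. exp (l * s)"]
        by (simp add: admissible_def continuous_intros measurable_cong_sets[OF sets_delay_variations refl])
    qed auto
    then show ?thesis by simp
  qed
  then show ?thesis
    unfolding delay_majorant_def by (intro tendsto_null_sum)
qed

lemma borel_measurable_vecI:
  fixes f :: "'s \<Rightarrow> 'b::euclidean_space ^ 'n"
  assumes "\<And>i. (\<lambda>x. f x $ i) \<in> borel_measurable N"
  shows "f \<in> borel_measurable N"
proof -
  have "(\<lambda>x. f x \<bullet> b) \<in> borel_measurable N" if b: "b \<in> Basis" for b
  proof -
    obtain i u where "b = axis i u" using b unfolding Basis_vec_def by blast
    then show ?thesis using assms[of i] by (simp add: inner_axis borel_measurable_inner)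
  qed
  then show ?thesis by (simp add: borel_measurable_euclidean_space[of f])
qed

section \<open>Delay functionals along a function\<close>

text \<open>
  Functions on the whole line whose segments are admissible at all times, with a common bound up to any
  given time. Total functions keep domains out of shifts and sums.
\<close>

definition history :: "(real \<Rightarrow> 'b::real_normed_vector) \<Rightarrow> bool" where
  "history y \<longleftrightarrow> y \<in> borel_measurable borel \<and> (\<forall>T. \<exists>K. \<forall>t\<le>T. norm (y t) \<le> K)"

lemma
  assumes "history y"
  shows history_measurable: "y \<in> borel_measurable borel"
    and history_bounded: "\<exists>K\<ge>0. \<forall>t\<le>T. norm (y t) \<le> K"
proof -
  show "y \<in> borel_measurable borel" using assms by (simp add: history_def)
  obtain K where "\<forall>t\<le>T. norm (y t) \<le> K" using assms unfolding history_def by blast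
  then show "\<exists>K\<ge>0. \<forall>t\<le>T. norm (y t) \<le> K"
    by (intro exI[of _ "max 0 K"]) (auto simp: le_max_iff_disj)
qed

lemma history_linear:
  assumes "history y" "bounded_linear (g :: 'b::{real_normed_vector,second_countable_topology} \<Rightarrow> 'c::real_normed_vector)"
  shows "history (\<lambda>t. g (y t))"
  unfolding history_def
proof safe
  have [measurable]: "y \<in> borel_measurable borel" using assms(1) by (rule history_measurable)
  have [measurable]: "g \<in> borel_measurable borel"
    using assms(2) by (intro borel_measurable_continuous_onI) (simp add: linear_continuous_on)
  show "(\<lambda>t. g (y t)) \<in> borel_measurable borel" by measurable
  fix T
  obtain K where K: "\<And>t. t \<le> T \<Longrightarrow> norm (y t) \<le> K"
    using history_bounded[OF assms(1)] by blast
  obtain C where C: "C > 0" "\<And>x. norm (g x) \<le> norm x * C"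
    using bounded_linear.pos_bounded[OF assms(2)] by blast
  have "norm (g (y t)) \<le> K * C" if "t \<le> T" for t
    using C(2)[of "y t"] K[OF that] C(1) by (smt (verit) mult_right_mono)
  then show "\<exists>K. \<forall>t\<le>T. norm (g (y t)) \<le> K" by blast
qed

lemma history_add:
  fixes y :: "real \<Rightarrow> 'b::{real_normed_vector, second_countable_topology}"
  assumes "history y" "history z"
  shows "history (\<lambda>t. y t + z t)"
  unfolding history_def
proof safe
  show "(\<lambda>t. y t + z t) \<in> borel_measurable borel"
    using assms by (intro borel_measurable_add) (simp_all add: history_def)
  fix T
  obtain K K' where "\<forall>t\<le>T. norm (y t) \<le> K" "\<forall>t\<le>T. norm (z t) \<le> K'"
    using assms unfolding history_def by meson
  then show "\<exists>K. \<forall>t\<le>T. norm (y t + z t) \<le> K"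
    by (intro exI[of _ "K + K'"]) (auto intro: norm_triangle_mono)
qed

lemma history_diff:
  fixes y :: "real \<Rightarrow> 'b::{real_normed_vector, second_countable_topology}"
  assumes "history y" "history z"
  shows "history (\<lambda>t. y t - z t)"
  using history_add[OF assms(1) history_linear[OF assms(2), of uminus]]
  by (simp add: bounded_linear_minus)

lemma history_shift:
  fixes y :: "real \<Rightarrow> 'b::real_normed_vector"
  assumes "history y"
  shows "history (\<lambda>t. y (t - q))"
  unfolding history_def
proof safe
  have [measurable]: "y \<in> borel_measurable borel" using assms by (rule history_measurable)
  show "(\<lambda>t. y (t - q)) \<in> borel_measurable borel" by measurable
  fix T
  obtain K where "\<forall>t\<le>T - q. norm (y t) \<le> K" using assms unfolding history_def by blast
  then show "\<exists>K. \<forall>t\<le>T. norm (y (t - q)) \<le> K" by (intro exI[of _ K]) auto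
qed

lemma continuous_on_atLeastI:
  fixes f :: "real \<Rightarrow> 'b::topological_space"
  assumes "\<And>T. continuous_on {a..T} f"
  shows "continuous_on {a..} f"
  unfolding continuous_on_eq_continuous_within
proof
  fix t assume "t \<in> {a..}"
  moreover have "at t within {a..} = at t within {a..t + 1}"
    by (rule at_within_nhd[of t "{..<t + 1}"]) auto
  ultimately show "continuous (at t within {a..}) f"
    using assms[of "t + 1"] by (simp add: continuous_on_eq_continuous_within)
qed

lemma history_continuous_on_after:
  fixes y :: "real \<Rightarrow> 'b::real_normed_vector"
  assumes "continuous_on {a..} y" "\<And>t. t < a \<Longrightarrow> y t = 0"
  shows "history y"
  unfolding history_def
proof safe
  have "y = (\<lambda>t. indicator {a..} t *\<^sub>R y t)"
    using assms(2) by (auto simp: fun_eq_iff indicator_def not_le)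
  then show "y \<in> borel_measurable borel"
    using borel_measurable_continuous_on_indicator[OF _ assms(1)] by auto
  fix T
  have "compact (y ` {a..T})"
    by (intro compact_continuous_image continuous_on_subset[OF assms(1)]) auto
  then obtain K where "\<And>t. t \<in> {a..T} \<Longrightarrow> norm (y t) \<le> K"
    using compact_imp_bounded bounded_iff by (metis imageI)
  then show "\<exists>K. \<forall>t\<le>T. norm (y t) \<le> K"
    using assms(2) by (intro exI[of _ "max 0 K"]) (metis atLeastAtMost_iff max.coboundedI1 max.coboundedI2 norm_zero not_le order_refl)
qed

lemma admissible_segment: "history y \<Longrightarrow> admissible \<tau> (segment y t)"
  unfolding admissible_def
proof safe
  assume y: "history y"
  have [measurable]: "y \<in> borel_measurable borel" using y by (rule history_measurable)
  have "(\<lambda>s. y (t + s)) \<in> borel_measurable borel" by measurable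
  then show "segment y t \<in> borel_measurable (delay_borel \<tau>)"
    unfolding segment_def by (rule measurable_restrict_space1)
  obtain K where "\<forall>t'\<le>t. norm (y t') \<le> K" using history_bounded[OF y] by blast
  then show "\<exists>K. \<forall>s\<in>{-\<tau>..0}. norm (segment y t s) \<le> K"
    by (intro exI[of _ K]) (auto simp: segment_def)
qed

lemma admissible_const: "admissible \<tau> (\<lambda>_. c)"
  by (auto simp: admissible_def)

context
  fixes \<tau> :: real and \<kappa> :: "real set \<Rightarrow> real^'d^'d"
  assumes \<kappa>: "matrix_measure \<tau> \<kappa>"
begin

lemma norm_delay_functional_le:
  assumes "history y" "\<And>s. s \<in> {-\<tau>..0} \<Longrightarrow> norm (y (t + s)) \<le> K"
  shows "norm (delay_functional \<tau> \<kappa> (segment y t)) \<le> K * delay_majorant \<tau> \<kappa> (\<lambda>_. 1)"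
proof -
  have "norm (delay_functional \<tau> \<kappa> (segment y t)) \<le> delay_majorant \<tau> \<kappa> (\<lambda>_. K)"
    using assms by (intro norm_delay_functional_le_majorant[OF \<kappa>] admissible_segment admissible_const) (auto simp: segment_def)
  then show ?thesis using delay_majorant_cmult[of \<tau> \<kappa> K "\<lambda>_. 1"] by simp
qed

lemma delay_functional_segment_measurable:
  assumes y: "history y"
  shows "(\<lambda>t. delay_functional \<tau> \<kappa> (segment y t)) \<in> borel_measurable borel"
proof (rule borel_measurable_vecI)
  have [measurable]: "y \<in> borel_measurable borel" using y by (rule history_measurable)
  have "(\<lambda>t. \<integral>s. y (t + s) $ j \<partial>delay_variations \<tau> \<kappa> i j p) \<in> borel_measurable borel" for i j p
  proof -
    interpret finite_measure "delay_variations \<tau> \<kappa> i j p"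
      by (rule finite_measure_delay_variations[OF \<kappa>])
    have "(\<lambda>s. s) \<in> borel_measurable (delay_borel \<tau>)"
      by (rule measurable_restrict_space1) simp
    then have [measurable]: "(\<lambda>s. s) \<in> borel_measurable (delay_variations \<tau> \<kappa> i j p)"
      by (simp add: measurable_cong_sets[OF sets_delay_variations refl])
    have [measurable]: "(\<lambda>x::real^'d. x $ j) \<in> borel_measurable borel"
      by (intro borel_measurable_continuous_onI) (simp add: continuous_intros)
    have [measurable]: "snd \<in> borel_measurable (borel \<Otimes>\<^sub>M delay_variations \<tau> \<kappa> i j p)"
      using measurable_compose[OF measurable_snd \<open>(\<lambda>s. s) \<in> borel_measurable (delay_variations \<tau> \<kappa> i j p)\<close>] by simp
    have "(\<lambda>x. y (fst x + snd x) $ j) \<in> borel_measurable (borel \<Otimes>\<^sub>M delay_variations \<tau> \<kappa> i j p)"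
      by measurable
    then show ?thesis
      by (intro borel_measurable_lebesgue_integral) (simp add: case_prod_beta')
  qed
  then show "(\<lambda>t. delay_functional \<tau> \<kappa> (segment y t) $ i) \<in> borel_measurable borel" for i
    unfolding delay_functional_eq segment_def by simp
qed

lemma history_delay_functional:
  assumes y: "history y"
  shows "history (\<lambda>t. delay_functional \<tau> \<kappa> (segment y t))"
  unfolding history_def
proof safe
  show "(\<lambda>t. delay_functional \<tau> \<kappa> (segment y t)) \<in> borel_measurable borel"
    by (rule delay_functional_segment_measurable[OF y])
  fix T
  obtain K where K: "\<And>t. t \<le> T \<Longrightarrow> norm (y t) \<le> K" using history_bounded[OF y] by blast
  show "\<exists>K. \<forall>t\<le>T. norm (delay_functional \<tau> \<kappa> (segment y t)) \<le> K"
    using K by (intro exI[of _ "K * delay_majorant \<tau> \<kappa> (\<lambda>_. 1)"] allI impI norm_delay_functional_le y) auto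
qed

end

lemma history_set_integrable:
  fixes h :: "real \<Rightarrow> 'b::{banach, second_countable_topology}"
  assumes "history h"
  shows "set_integrable lborel {a..b} h"
proof -
  obtain K where K: "\<And>t. t \<le> b \<Longrightarrow> norm (h t) \<le> K" using history_bounded[OF assms] by blast
  have [measurable]: "h \<in> borel_measurable borel" using assms by (rule history_measurable)
  show ?thesis
    unfolding set_integrable_def
  proof (rule Bochner_Integration.integrable_bound[where f="\<lambda>t. indicator {a..b} t * K"])
    show "integrable lborel (\<lambda>t. indicator {a..b} t * K)"
      by (auto intro!: integrable_real_mult_indicator simp: emeasure_lborel_Icc_eq)
    show "AE t in lborel. norm (indicator {a..b} t *\<^sub>R h t) \<le> norm (indicator {a..b} t * K)"
      using K by (intro AE_I2) (auto simp: indicator_def intro: order_trans[OF _ abs_ge_self])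
  qed simp
qed

lemma norm_set_integral_le:
  fixes h :: "real \<Rightarrow> 'b::{banach, second_countable_topology}"
  assumes "history h" "set_integrable lborel {a..b} g" "\<And>t. t \<in> {a..b} \<Longrightarrow> norm (h t) \<le> g t"
  shows "norm (LINT t:{a..b}|lborel. h t) \<le> (LINT t:{a..b}|lborel. g t)"
proof -
  have "norm (LINT t:{a..b}|lborel. h t) \<le> (\<integral>t. norm (indicator {a..b} t *\<^sub>R h t) \<partial>lborel)"
    unfolding set_lebesgue_integral_def by (rule integral_norm_bound)
  also have "\<dots> \<le> (LINT t:{a..b}|lborel. g t)"
    unfolding set_lebesgue_integral_def
    using assms(2,3) integrable_norm[OF history_set_integrable[OF assms(1), of a b, unfolded set_integrable_def]]
    by (intro integral_mono) (auto simp: set_integrable_def indicator_def)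
  finally show ?thesis .
qed

lemma set_integral_translate_causal:
  fixes G :: "real \<Rightarrow> 'b::{banach, second_countable_topology}"
  assumes "q \<ge> 0" "\<And>u. u < 0 \<Longrightarrow> G u = 0"
  shows "(LINT u:{0..t}|lborel. G (u - q)) = (LINT u:{0..t - q}|lborel. G u)"
proof -
  have "(LINT u:{0..t - q}|lborel. G u) = (\<integral>u. indicator {0..t - q} (- q + 1 * u) *\<^sub>R G (- q + 1 * u) \<partial>lborel)"
    unfolding set_lebesgue_integral_def
    by (subst lborel_integral_real_affine[where c=1 and t="-q"]) simp_all
  also have "\<dots> = (LINT u:{0..t}|lborel. G (u - q))"
    unfolding set_lebesgue_integral_def
  proof (rule Bochner_Integration.integral_cong[OF refl])
    fix u
    show "indicator {0..t - q} (- q + 1 * u) *\<^sub>R G (- q + 1 * u) = indicator {0..t} u *\<^sub>R G (u - q)"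
      using assms by (cases "u < q") (auto simp: indicator_def)
  qed
  finally show ?thesis by simp
qed

lemma scaled_tolerance_less:
  fixes e K :: real
  assumes "e > 0" "K \<ge> 0"
  shows "e / (2 * (K + 1)) * K < e"
proof -
  have "e * K < e * (2 * (K + 1))" using assms by (intro mult_strict_left_mono) auto
  then show ?thesis using assms(2) by (simp add: pos_divide_less_eq)
qed

section \<open>The neutral equation with a forcing term\<close>

text \<open>
  The integrated neutral equation with zero past and an additive forcing term \<open>f\<close>. The forcing may
  jump, and so may \<open>y\<close>, which is therefore only required to be measurable and locally bounded. The
  columns of the resolvent (constant forcing), the difference of a stochastic and a deterministic solution
  (Brownian forcing) and the approximations of the latter are all of this kind.
\<close>

definition forced_solution ::
  "real \<Rightarrow> (real set \<Rightarrow> real^'d^'d) \<Rightarrow> (real set \<Rightarrow> real^'d^'d) \<Rightarrow> (real \<Rightarrow> real^'d) \<Rightarrow> (real \<Rightarrow> real^'d) \<Rightarrow> bool" where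
  "forced_solution \<tau> \<mu> \<nu> f y \<longleftrightarrow> history y \<and> (\<forall>t<0. y t = 0) \<and>
     (\<forall>t\<ge>0. y t = delay_functional \<tau> \<mu> (segment y t) +
        (LINT u:{0..t}|lborel. delay_functional \<tau> \<nu> (segment y u)) + f t)"

locale neutral_kernel =
  fixes \<tau> :: real and \<mu> \<nu> :: "real set \<Rightarrow> real^'d^'d"
  assumes tau_nonneg: "\<tau> \<ge> 0"
    and mu: "matrix_measure \<tau> \<mu>" and nu: "matrix_measure \<tau> \<nu>"
    and mu_0: "\<mu> {0} = 0"
begin

abbreviation D where "D y t \<equiv> delay_functional \<tau> \<mu> (segment y t)"
abbreviation L where "L y t \<equiv> delay_functional \<tau> \<nu> (segment y t)"
abbreviation forced where "forced \<equiv> forced_solution \<tau> \<mu> \<nu>"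

lemma forcedD:
  assumes "forced f y"
  shows "history y" "t < 0 \<Longrightarrow> y t = 0"
    "t \<ge> 0 \<Longrightarrow> y t = D y t + (LINT u:{0..t}|lborel. L y u) + f t"
  using assms by (simp_all add: forced_solution_def)

lemma segment_add: "segment (\<lambda>t. y t + z t) t = (\<lambda>s. segment y t s + segment z t s)"
  and segment_diff: "segment (\<lambda>t. y t - z t) t = (\<lambda>s. segment y t s - segment z t s)"
  for y z :: "real \<Rightarrow> 'b::ab_group_add"
  by (simp_all add: segment_def)

lemma forced_add:
  assumes "forced f y" "forced g z"
  shows "forced (\<lambda>t. f t + g t) (\<lambda>t. y t + z t)"
  unfolding forced_solution_def
proof (intro conjI allI impI)
  note h = forcedD(1)[OF assms(1)] forcedD(1)[OF assms(2)]
  note adm = admissible_segment[OF h(1), of \<tau>] admissible_segment[OF h(2), of \<tau>]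
  show "history (\<lambda>t. y t + z t)" by (intro history_add h)
  show "y t + z t = 0" if "t < 0" for t using assms that by (simp add: forcedD(2))
  fix t :: real assume "t \<ge> 0"
  have "(LINT u:{0..t}|lborel. L y u + L z u) = (LINT u:{0..t}|lborel. L y u) + (LINT u:{0..t}|lborel. L z u)"
    by (intro set_integral_add history_set_integrable history_delay_functional nu h)
  then show "y t + z t = D (\<lambda>t. y t + z t) t + (LINT u:{0..t}|lborel. L (\<lambda>t. y t + z t) u) + (f t + g t)"
    using forcedD(3)[OF assms(1) \<open>t \<ge> 0\<close>] forcedD(3)[OF assms(2) \<open>t \<ge> 0\<close>]
    unfolding segment_add delay_functional_add[OF mu adm] delay_functional_add[OF nu adm]
    by simp
qed

lemma forced_diff:
  assumes "forced f y" "forced g z"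
  shows "forced (\<lambda>t. f t - g t) (\<lambda>t. y t - z t)"
  unfolding forced_solution_def
proof (intro conjI allI impI)
  note h = forcedD(1)[OF assms(1)] forcedD(1)[OF assms(2)]
  note adm = admissible_segment[OF h(1), of \<tau>] admissible_segment[OF h(2), of \<tau>]
  show "history (\<lambda>t. y t - z t)" by (intro history_diff h)
  show "y t - z t = 0" if "t < 0" for t using assms that by (simp add: forcedD(2))
  fix t :: real assume "t \<ge> 0"
  have "(LINT u:{0..t}|lborel. L y u - L z u) = (LINT u:{0..t}|lborel. L y u) - (LINT u:{0..t}|lborel. L z u)"
    by (intro set_integral_diff history_set_integrable history_delay_functional nu h)
  then show "y t - z t = D (\<lambda>t. y t - z t) t + (LINT u:{0..t}|lborel. L (\<lambda>t. y t - z t) u) + (f t - g t)"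
    using forcedD(3)[OF assms(1) \<open>t \<ge> 0\<close>] forcedD(3)[OF assms(2) \<open>t \<ge> 0\<close>]
    unfolding segment_diff delay_functional_diff[OF mu adm] delay_functional_diff[OF nu adm]
    by simp
qed

lemma forced_0: "forced (\<lambda>_. 0) (\<lambda>_. 0)"
  by (auto simp: forced_solution_def history_def segment_def delay_functional_0)

lemma forced_sum:
  fixes n :: nat
  assumes "\<And>i. i < n \<Longrightarrow> forced (f i) (y i)"
  shows "forced (\<lambda>t. \<Sum>i<n. f i t) (\<lambda>t. \<Sum>i<n. y i t)"
  using assms by (induction n) (simp_all add: forced_0 forced_add)

lemma D_causal:
  assumes "\<And>s. s < 0 \<Longrightarrow> y s = 0" "t < 0"
  shows "delay_functional \<tau> \<kappa> (segment y t) = 0"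
  using delay_functional_cong[of \<tau> "segment y t" "\<lambda>_. 0" \<kappa>] assms
  by (simp add: delay_functional_0 segment_def)

lemma forced_shift:
  assumes "forced f y" "q \<ge> 0"
  shows "forced (\<lambda>t. if q \<le> t then f (t - q) else 0) (\<lambda>t. y (t - q))"
  unfolding forced_solution_def
proof (intro conjI allI impI)
  note h = forcedD(1)[OF assms(1)]
  show "history (\<lambda>t. y (t - q))" by (intro history_shift h)
  have 0: "y t = 0" if "t < 0" for t using that by (rule forcedD(2)[OF assms(1)])
  show "y (t - q) = 0" if "t < 0" for t using that assms(2) by (simp add: 0)
  have seg: "segment (\<lambda>t. y (t - q)) u = segment y (u - q)" for u
    by (simp add: segment_def fun_eq_iff algebra_simps)
  have int: "(LINT u:{0..t}|lborel. L y (u - q)) = (LINT u:{0..t - q}|lborel. L y u)" for t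
    using assms(2) 0 by (intro set_integral_translate_causal D_causal)
  fix t :: real assume "t \<ge> 0"
  show "y (t - q) = D (\<lambda>t. y (t - q)) t + (LINT u:{0..t}|lborel. L (\<lambda>t. y (t - q)) u) +
      (if q \<le> t then f (t - q) else 0)"
  proof (cases "q \<le> t")
    case True
    then show ?thesis
      using forcedD(3)[OF assms(1), of "t - q"] by (simp add: seg int)
  next
    case False
    then have "(LINT u:{0..t - q}|lborel. L y u) = 0" by (simp add: set_lebesgue_integral_def)
    with False show ?thesis
      using 0 by (simp add: seg int D_causal)
  qed
qed

text \<open>
  The segment at time 0 is concentrated on the null set \<open>{0}\<close>. It is dominated by every weight
  \<open>exp (l * s)\<close>, so its functional is at most the majorant of that weight, which tends to 0.
\<close>

lemma D_supported_at_0: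
  assumes y: "history y" and 0: "\<And>s. s < 0 \<Longrightarrow> y s = 0"
  shows "D y 0 = 0"
proof -
  have "norm (D y 0) \<le> norm (y 0) * delay_majorant \<tau> \<mu> (\<lambda>s. exp (l * s))" for l
    unfolding delay_majorant_cmult[symmetric]
  proof (rule norm_delay_functional_le_majorant[OF mu admissible_segment[OF y]])
    show "admissible \<tau> (\<lambda>s. norm (y 0) * exp (l * s))"
      by (intro admissible_continuous_on continuous_intros)
    show "norm (segment y 0 s) \<le> norm (y 0) * exp (l * s)" if "s \<in> {-\<tau>..0}" for s
      using that 0[of s] by (cases "s = 0") (auto simp: segment_def)
  qed
  moreover have "((\<lambda>l. norm (y 0) * delay_majorant \<tau> \<mu> (\<lambda>s. exp (l * s))) \<longlongrightarrow> norm (y 0) * 0) at_top"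
    by (intro tendsto_mult_left delay_majorant_exp_tendsto_0 mu mu_0 tau_nonneg)
  ultimately have "norm (D y 0) \<le> 0"
    by (intro tendsto_lowerbound[of _ _ at_top]) auto
  then show ?thesis by simp
qed

lemma forced_initial:
  assumes "forced f y"
  shows "y 0 = f 0"
proof -
  have "D y 0 = 0" using assms by (intro D_supported_at_0 forcedD)
  moreover have [measurable]: "L y \<in> borel_measurable borel"
    by (rule delay_functional_segment_measurable[OF nu forcedD(1)[OF assms]])
  have "(LINT u:{0..0}|lborel. L y u) = 0"
    unfolding set_lebesgue_integral_def
    by (subst integral_cong_AE[where g="\<lambda>_. 0"]) (use AE_lborel_singleton[of 0] in auto)
  ultimately show ?thesis using forcedD(3)[OF assms, of 0] by simp
qed

text \<open>
  In the weighted norm \<open>sup \<bar>y t\<bar> exp (- l t)\<close> the neutral term then has norm at most 1/4, and so has the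
  integrated term, because \<open>\<integral>\<close> gains a factor \<open>1 / l\<close>.
\<close>

lemma contraction_weight:
  obtains l where "l > 0" "delay_majorant \<tau> \<mu> (\<lambda>s. exp (l * s)) \<le> 1 / 4"
    "delay_majorant \<tau> \<nu> (\<lambda>_. 1) \<le> l / 4"
proof -
  have "\<forall>\<^sub>F l in at_top. delay_majorant \<tau> \<mu> (\<lambda>s. exp (l * s)) < 1 / 4"
    by (rule order_tendstoD[OF delay_majorant_exp_tendsto_0[OF mu mu_0 tau_nonneg]]) simp
  moreover have "\<forall>\<^sub>F l in at_top. l > 0 \<and> l \<ge> 4 * delay_majorant \<tau> \<nu> (\<lambda>_. 1)"
    by (intro eventually_conj eventually_gt_at_top eventually_ge_at_top)
  ultimately have "\<forall>\<^sub>F l in at_top. l > 0 \<and> delay_majorant \<tau> \<mu> (\<lambda>s. exp (l * s)) \<le> 1 / 4 \<and>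
    delay_majorant \<tau> \<nu> (\<lambda>_. 1) \<le> l / 4"
    by eventually_elim auto
  then have "\<exists>l. l > 0 \<and> delay_majorant \<tau> \<mu> (\<lambda>s. exp (l * s)) \<le> 1 / 4 \<and>
    delay_majorant \<tau> \<nu> (\<lambda>_. 1) \<le> l / 4"
    by (rule eventually_happens'[rotated]) simp
  with that show ?thesis by blast
qed

text \<open>
  One application of the equation to an exponential bound: the two delay terms contribute \<open>S / 4\<close> each.
\<close>

lemma weighted_bound_step:
  assumes l: "l > 0" "delay_majorant \<tau> \<mu> (\<lambda>s. exp (l * s)) \<le> 1 / 4"
    "delay_majorant \<tau> \<nu> (\<lambda>_. 1) \<le> l / 4"
  assumes y: "forced f y" and S: "S \<ge> 0" "\<And>t. t \<in> {0..T} \<Longrightarrow> norm (y t) \<le> S * exp (l * t)"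
    and F: "\<And>t. t \<in> {0..T} \<Longrightarrow> norm (f t) \<le> F" and t: "t \<in> {0..T}"
  shows "norm (y t) \<le> (S / 2 + F) * exp (l * t)"
proof -
  note h = forcedD(1)[OF y]
  have S': "norm (y u) \<le> S * exp (l * u)" if "u \<le> T" for u
    using S that forcedD(2)[OF y, of u] by (cases "u < 0") auto
  have "norm (D y t) \<le> delay_majorant \<tau> \<mu> (\<lambda>s. (S * exp (l * t)) * exp (l * s))"
  proof (rule norm_delay_functional_le_majorant[OF mu admissible_segment[OF h]])
    show "admissible \<tau> (\<lambda>s. S * exp (l * t) * exp (l * s))"
      by (intro admissible_continuous_on continuous_intros)
    show "norm (segment y t s) \<le> S * exp (l * t) * exp (l * s)" if "s \<in> {-\<tau>..0}" for s
      using S'[of "t + s"] that t by (simp add: segment_def exp_add[symmetric] algebra_simps)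
  qed
  also have "\<dots> \<le> (S * exp (l * t)) * (1 / 4)"
    using S(1) l(2) by (simp only: delay_majorant_cmult) (intro mult_left_mono, auto)
  finally have 1: "norm (D y t) \<le> S * exp (l * t) / 4" by simp
  have "norm (LINT u:{0..t}|lborel. L y u) \<le> (LINT u:{0..t}|lborel. S * exp (l * u) * (l / 4))"
  proof (rule norm_set_integral_le)
    show "history (L y)" by (rule history_delay_functional[OF nu h])
    show "set_integrable lborel {0..t} (\<lambda>u. S * exp (l * u) * (l / 4))"
      by (intro borel_integrable_atLeastAtMost' continuous_intros)
    show "norm (L y u) \<le> S * exp (l * u) * (l / 4)" if "u \<in> {0..t}" for u
    proof -
      have "norm (y (u + s)) \<le> S * exp (l * u)" if "s \<in> {-\<tau>..0}" for s
      proof -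
        have "norm (y (u + s)) \<le> S * exp (l * (u + s))"
          using S'[of "u + s"] that \<open>u \<in> {0..t}\<close> t by auto
        also have "\<dots> \<le> S * exp (l * u)"
          using S(1) l(1) that by (intro mult_left_mono) auto
        finally show ?thesis .
      qed
      then have "norm (L y u) \<le> S * exp (l * u) * delay_majorant \<tau> \<nu> (\<lambda>_. 1)"
        by (rule norm_delay_functional_le[OF nu h])
      also have "\<dots> \<le> S * exp (l * u) * (l / 4)"
        using S(1) l(3) by (intro mult_left_mono) auto
      finally show ?thesis .
    qed
  qed
  also have "\<dots> = S / 4 * exp (l * t) - S / 4 * exp (l * 0)"
    unfolding set_lebesgue_integral_def real_scaleR_def
    using t by (subst mult.commute, intro integral_FTC_Icc_real[where F="\<lambda>u. S / 4 * exp (l * u)"])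
      (auto intro!: derivative_eq_intros continuous_intros)
  also have "\<dots> \<le> S / 4 * exp (l * t)" using S(1) by simp
  finally have 2: "norm (LINT u:{0..t}|lborel. L y u) \<le> S / 4 * exp (l * t)" .
  \<comment> \<open>The bound on \<open>f\<close> is weakened by the factor \<open>exp (l * t) \<ge> 1\<close> to fit the weighted norm.\<close>
  have "F \<ge> 0" using F[OF t] norm_ge_zero[of "f t"] by linarith
  then have "F * 1 \<le> F * exp (l * t)" using l(1) t by (intro mult_left_mono) auto
  then have 3: "norm (f t) \<le> F * exp (l * t)" using F[OF t] by linarith
  have "norm (y t) \<le> norm (D y t) + norm (LINT u:{0..t}|lborel. L y u) + norm (f t)"
    using forcedD(3)[OF y, of t] t by (metis atLeastAtMost_iff norm_triangle_mono norm_triangle_ineq order_refl)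
  also have "\<dots> \<le> (S / 2 + F) * exp (l * t)"
    using 1 2 3 by (simp add: algebra_simps)
  finally show ?thesis .
qed

text \<open>
  Stability with respect to the forcing. The least constant \<open>S\<close> in \<open>\<bar>y t\<bar> \<le> S exp (l t)\<close> satisfies
  \<open>S \<le> S / 2 + F\<close>, hence \<open>S \<le> 2 F\<close>. The constant depends on the horizon only, which makes
  uniform approximation of the forcing carry over to the solutions.
\<close>

lemma forced_bound:
  obtains C where "C \<ge> 0"
    "\<And>f y F. forced f y \<Longrightarrow> (\<And>t. t \<in> {0..T} \<Longrightarrow> norm (f t) \<le> F) \<Longrightarrow> F \<ge> 0 \<Longrightarrow> (\<And>t. t \<le> T \<Longrightarrow> norm (y t) \<le> C * F)"
proof -
  obtain l where l: "l > 0" "delay_majorant \<tau> \<mu> (\<lambda>s. exp (l * s)) \<le> 1 / 4"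
    "delay_majorant \<tau> \<nu> (\<lambda>_. 1) \<le> l / 4" by (rule contraction_weight)
  have "norm (y t) \<le> 2 * exp (l * T) * F"
    if y: "forced f y" and F: "\<And>t. t \<in> {0..T} \<Longrightarrow> norm (f t) \<le> F" and "F \<ge> 0" and "t \<le> T" for f y F t
  proof (cases "t < 0")
    case True
    then show ?thesis using forcedD(2)[OF y] \<open>F \<ge> 0\<close> by simp
  next
    case False
    then have t: "t \<in> {0..T}" using \<open>t \<le> T\<close> by simp
    \<comment> \<open>The supremum is finite since \<open>y\<close> is bounded on \<open>[0, T]\<close>; otherwise \<open>S \<le> S / 2 + F\<close> would say nothing.\<close>
    define S where "S = (SUP t\<in>{0..T}. norm (y t) * exp (- (l * t)))"
    obtain K where K: "K \<ge> 0" "\<And>t. t \<le> T \<Longrightarrow> norm (y t) \<le> K"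
      using history_bounded[OF forcedD(1)[OF y]] by blast
    have "bdd_above ((\<lambda>t. norm (y t) * exp (- (l * t))) ` {0..T})"
    proof (rule bdd_aboveI2)
      fix t assume "t \<in> {0..T}"
      then have "norm (y t) * exp (- (l * t)) \<le> K * 1"
        using K l(1) by (intro mult_mono) auto
      then show "norm (y t) * exp (- (l * t)) \<le> K" by simp
    qed
    then have up: "norm (y t) * exp (- (l * t)) \<le> S" if "t \<in> {0..T}" for t
      unfolding S_def using that by (intro cSUP_upper)
    then have "S \<ge> 0" using t by (meson mult_nonneg_nonneg exp_ge_zero norm_ge_zero order_trans)
    have up': "norm (y t) \<le> S * exp (l * t)" if "t \<in> {0..T}" for t
      using up[OF that] by (simp add: exp_minus field_simps)
    have "S \<le> S / 2 + F"
      unfolding S_def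
    proof (rule cSUP_least)
      fix t assume "t \<in> {0..T}"
      from weighted_bound_step[OF l y \<open>S \<ge> 0\<close> up' F this]
      show "norm (y t) * exp (- (l * t)) \<le> (SUP t\<in>{0..T}. norm (y t) * exp (- (l * t))) / 2 + F"
        unfolding S_def by (simp add: exp_minus field_simps)
    qed (use t in auto)
    then have "S \<le> 2 * F" by simp
    have "norm (y t) \<le> S * exp (l * t)" by (rule up'[OF t])
    also have "\<dots> \<le> (2 * F) * exp (l * T)"
      using \<open>S \<le> 2 * F\<close> t l(1) \<open>F \<ge> 0\<close> by (intro mult_mono) auto
    finally show ?thesis by (simp add: mult_ac)
  qed
  then show ?thesis by (intro that[of "2 * exp (l * T)"]) auto
qed

lemma forced_unique:
  assumes "forced f y" "forced f z"
  shows "y = z"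
proof
  fix t
  show "y t = z t"
  proof (rule forced_bound[of t])
    fix C :: real
    assume "\<And>f y F u. forced f y \<Longrightarrow> (\<And>u. u \<in> {0..t} \<Longrightarrow> norm (f u) \<le> F) \<Longrightarrow> F \<ge> 0 \<Longrightarrow> u \<le> t \<Longrightarrow> norm (y u) \<le> C * F"
    from this[OF forced_diff[OF assms], of 0 t] show "y t = z t" by simp
  qed
qed

lemma uniform_limit_delay_functional:
  assumes \<kappa>: "matrix_measure \<tau> \<kappa>" and "\<And>n. history (y n)" "history Y"
    and lim: "uniform_limit {..T} y Y sequentially"
  shows "uniform_limit {..T} (\<lambda>n t. delay_functional \<tau> \<kappa> (segment (y n) t)) (\<lambda>t. delay_functional \<tau> \<kappa> (segment Y t)) sequentially"
proof (rule uniform_limitI)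
  fix e :: real assume "e > 0"
  let ?K = "delay_majorant \<tau> \<kappa> (\<lambda>_. 1)"
  have K: "?K \<ge> 0" by (rule delay_majorant_nonneg) simp
  define e' where "e' = e / (2 * (?K + 1))"
  have "e' > 0" using \<open>e > 0\<close> K by (simp add: e'_def)
  have "e' * ?K < e"
    unfolding e'_def by (rule scaled_tolerance_less) fact+
  from uniform_limitD[OF lim \<open>e' > 0\<close>]
  show "\<forall>\<^sub>F n in sequentially. \<forall>t\<in>{..T}. dist (delay_functional \<tau> \<kappa> (segment (y n) t)) (delay_functional \<tau> \<kappa> (segment Y t)) < e"
  proof eventually_elim
    case (elim n)
    show ?case
    proof
      fix t assume "t \<in> {..T}"
      have "norm (delay_functional \<tau> \<kappa> (segment (\<lambda>t. y n t - Y t) t)) \<le> e' * ?K"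
        using elim \<open>t \<in> {..T}\<close>
        by (intro norm_delay_functional_le[OF \<kappa>] history_diff assms) (auto simp: dist_norm intro: less_imp_le)
      then show "dist (delay_functional \<tau> \<kappa> (segment (y n) t)) (delay_functional \<tau> \<kappa> (segment Y t)) < e"
        using \<open>e' * ?K < e\<close>
        by (simp add: segment_diff delay_functional_diff[OF \<kappa> admissible_segment admissible_segment] assms dist_norm)
    qed
  qed
qed

text \<open>
  Both delay terms of the equation are continuous for locally uniform convergence of the solutions.
\<close>

lemma forced_limit:
  assumes y: "\<And>n. forced (f n) (y n)"
    and lim: "\<And>T. uniform_limit {..T} y Y sequentially"
    and f: "\<And>t. t \<ge> 0 \<Longrightarrow> (\<lambda>n. f n t) \<longlonglongrightarrow> g t"
  shows "forced g Y"
proof -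
  note h = forcedD(1)[OF y]
  have ptw: "(\<lambda>n. y n t) \<longlonglongrightarrow> Y t" for t
    using tendsto_uniform_limitI[OF lim[of t], of t] by simp
  have Y: "history Y"
    unfolding history_def
  proof safe
    show "Y \<in> borel_measurable borel"
      by (rule borel_measurable_LIMSEQ_metric[OF history_measurable[OF h] ptw])
    fix T
    obtain n where n: "\<And>t. t \<le> T \<Longrightarrow> dist (y n t) (Y t) < 1"
      using uniform_limitD[OF lim[of T], of 1] by (auto simp: eventually_sequentially)
    obtain K where K: "\<And>t. t \<le> T \<Longrightarrow> norm (y n t) \<le> K" using history_bounded[OF h] by blast
    have "norm (Y t) \<le> K + 1" if "t \<le> T" for t
      using n[OF that] K[OF that] norm_triangle_sub[of "Y t" "y n t"] by (simp add: dist_norm norm_minus_commute)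
    then show "\<exists>K. \<forall>t\<le>T. norm (Y t) \<le> K" by blast
  qed
  show ?thesis
    unfolding forced_solution_def
  proof (intro conjI allI impI)
    show "history Y" by fact
    show "Y t = 0" if "t < 0" for t
      using LIMSEQ_unique[OF ptw[of t]] that forcedD(2)[OF y] by auto
    fix t :: real assume t: "t \<ge> 0"
    have Dlim: "(\<lambda>n. D (y n) t) \<longlonglongrightarrow> D Y t"
      using tendsto_uniform_limitI[OF uniform_limit_delay_functional[OF mu h Y lim[of t]], of t] by simp
    have "(\<lambda>n. LINT u:{0..t}|lborel. L (y n) u) \<longlonglongrightarrow> (LINT u:{0..t}|lborel. L Y u)"
    proof (rule metric_LIMSEQ_I)
      fix e :: real assume "e > 0"
      define e' where "e' = e / (2 * (t + 1))"
      have "e' > 0" using \<open>e > 0\<close> t by (simp add: e'_def)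
      have "e' * t < e" unfolding e'_def by (rule scaled_tolerance_less) fact+
      obtain N where N: "\<And>n u. n \<ge> N \<Longrightarrow> u \<le> t \<Longrightarrow> dist (L (y n) u) (L Y u) < e'"
        using uniform_limitD[OF uniform_limit_delay_functional[OF nu h Y lim[of t]] \<open>e' > 0\<close>]
        by (auto simp: eventually_sequentially)
      have "dist (LINT u:{0..t}|lborel. L (y n) u) (LINT u:{0..t}|lborel. L Y u) < e" if "n \<ge> N" for n
      proof -
        note hL = history_delay_functional[OF nu h[of n]] history_delay_functional[OF nu Y]
        have "dist (LINT u:{0..t}|lborel. L (y n) u) (LINT u:{0..t}|lborel. L Y u) =
          norm (LINT u:{0..t}|lborel. L (y n) u - L Y u)"
          by (subst set_integral_diff) (simp_all add: dist_norm history_set_integrable hL)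
        also have "\<dots> \<le> (LINT u:{0..t}|lborel. e')"
          using N[OF that] by (intro norm_set_integral_le history_diff hL borel_integrable_atLeastAtMost')
            (auto simp: dist_norm intro: less_imp_le)
        also have "\<dots> = e' * t" using t by (simp add: set_lebesgue_integral_def mult.commute)
        finally show ?thesis using \<open>e' * t < e\<close> by simp
      qed
      then show "\<exists>N. \<forall>n\<ge>N. dist (LINT u:{0..t}|lborel. L (y n) u) (LINT u:{0..t}|lborel. L Y u) < e" by blast
    qed
    then have "(\<lambda>n. D (y n) t + (LINT u:{0..t}|lborel. L (y n) u) + f n t) \<longlonglongrightarrow>
        D Y t + (LINT u:{0..t}|lborel. L Y u) + g t"
      by (intro tendsto_add Dlim f t)
    then have "(\<lambda>n. y n t) \<longlonglongrightarrow> D Y t + (LINT u:{0..t}|lborel. L Y u) + g t"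
      using forcedD(3)[OF y t] by simp
    then show "Y t = D Y t + (LINT u:{0..t}|lborel. L Y u) + g t"
      using LIMSEQ_unique[OF ptw[of t]] by blast
  qed
qed

end

section \<open>Superposition of resolvents\<close>

lemma bounded_linear_matrix_vector_left: "bounded_linear (\<lambda>A::real^'n^'m. A *v w)"
proof -
  have "linear (\<lambda>A::real^'n^'m. A *v w)"
    by (intro linearI) (simp_all add: matrix_vector_mult_add_rdistrib scaleR_matrix_vector_assoc)
  then show ?thesis by (simp add: linear_conv_bounded_linear)
qed

lemma history_vecI:
  fixes y :: "real \<Rightarrow> 'b::euclidean_space ^ 'n"
  assumes "\<And>i. history (\<lambda>t. y t $ i)"
  shows "history y"
  unfolding history_def
proof safe
  show "y \<in> borel_measurable borel"
    using assms by (intro borel_measurable_vecI) (simp add: history_def)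
  fix T
  have "\<forall>i. \<exists>K. \<forall>t\<le>T. norm (y t $ i) \<le> K" using assms by (simp add: history_def)
  then obtain K where K: "\<And>i t. t \<le> T \<Longrightarrow> norm (y t $ i) \<le> K i" by metis
  have "norm (y t) \<le> (\<Sum>i\<in>UNIV. K i)" if "t \<le> T" for t
  proof -
    have "norm (y t) \<le> (\<Sum>i\<in>UNIV. norm (y t $ i))"
      unfolding norm_vec_def by (rule L2_set_le_sum) simp
    also have "\<dots> \<le> (\<Sum>i\<in>UNIV. K i)" using K that by (intro sum_mono)
    finally show ?thesis .
  qed
  then show "\<exists>K. \<forall>t\<le>T. norm (y t) \<le> K" by blast
qed

lemma history_matrixI:
  fixes A :: "real \<Rightarrow> real^'n^'m"
  assumes "\<And>w. history (\<lambda>t. A t *v w)"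
  shows "history A"
proof (intro history_vecI)
  fix i k
  have "(A t *v axis k 1) $ i = A t $ i $ k" for t
    by (simp add: matrix_vector_mul_component inner_axis)
  then show "history (\<lambda>t. A t $ i $ k)"
    using history_linear[OF assms[of "axis k 1"] bounded_linear_vec_nth[of i]] by simp
qed

locale neutral_resolvent = neutral_kernel \<tau> \<mu> \<nu> for \<tau> and \<mu> \<nu> :: "real set \<Rightarrow> real^'d^'d" +
  fixes \<rho> :: "real \<Rightarrow> real^'d^'d"
  assumes rho: "resolvent \<tau> \<mu> \<nu> \<rho>"
begin

text \<open>
  The resolvent is prescribed on \<open>[-\<tau>, \<infinity>)\<close> only; \<open>R\<close> agrees with it there and is 0 on all of the past.
\<close>

definition R :: "real \<Rightarrow> real^'d^'d" where "R u = (if u < 0 then 0 else \<rho> u)"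

lemma R_neg: "u < 0 \<Longrightarrow> R u = 0" and R_0: "R 0 = mat 1"
  using rho by (simp_all add: R_def resolvent_def)

lemma continuous_on_R: "continuous_on {0..} R"
proof -
  have "continuous_on {0..} \<rho>" using rho by (simp add: resolvent_def)
  then show ?thesis by (rule continuous_on_eq) (simp add: R_def)
qed

lemma history_R: "history R"
  by (rule history_continuous_on_after[OF continuous_on_R R_neg])

lemma history_R_vec: "history (\<lambda>t. R t *v w)"
  by (rule history_linear[OF history_R bounded_linear_matrix_vector_left])

text \<open>
  The only discontinuity of \<open>R\<close> is the unit jump at 0.
\<close>

lemma continuous_on_R_minus_jump: "continuous_on UNIV (\<lambda>u. R u - (if u < 0 then 0 else mat 1))"
proof -
  have "continuous_on ({..0} \<union> {0..}) (\<lambda>u. R u - (if u < 0 then 0 else mat 1))"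
  proof (intro continuous_on_closed_Un)
    show "continuous_on {..0} (\<lambda>u. R u - (if u < 0 then 0 else mat 1))"
      by (rule continuous_on_eq[OF continuous_on_const[of _ 0]]) (auto simp: R_neg R_0 order_le_less)
    show "continuous_on {0..} (\<lambda>u. R u - (if u < 0 then 0 else mat 1))"
      by (rule continuous_on_eq[OF continuous_on_diff[OF continuous_on_R continuous_on_const[of _ "mat 1"]]]) auto
  qed auto
  moreover have "{..0} \<union> {0..} = (UNIV :: real set)" by auto
  ultimately show ?thesis by simp
qed

text \<open>
  Multiplying the resolvent equation by a vector \<open>w\<close>. The initial value of the neutral term vanishes
  because \<open>\<mu>\<close> does not see the jump at 0, so the forcing is exactly \<open>w\<close>.
\<close>

lemma forced_resolvent: "forced (\<lambda>_. w) (\<lambda>t. R t *v w)"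
  unfolding forced_solution_def
proof (intro conjI allI impI)
  show "history (\<lambda>t. R t *v w)" by (rule history_R_vec)
  show "R t *v w = 0" if "t < 0" for t using that by (simp add: R_neg)
  have seg: "delay_functional_mat \<tau> \<kappa> (segment \<rho> t) = delay_functional_mat \<tau> \<kappa> (segment R t)" if "t \<ge> 0" for t \<kappa>
    using rho that by (intro delay_functional_mat_cong) (auto simp: segment_def R_def resolvent_def)
  have vec: "delay_functional_mat \<tau> \<kappa> (segment R t) *v w = delay_functional \<tau> \<kappa> (segment (\<lambda>t. R t *v w) t)"
    if "matrix_measure \<tau> \<kappa>" for \<kappa> t w
    using delay_functional_matrix_vector[OF that admissible_segment[OF history_R], of t w] by (simp add: segment_def)
  have "history (\<lambda>t. delay_functional_mat \<tau> \<nu> (segment R t))"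
    by (intro history_matrixI) (simp add: vec nu history_delay_functional history_R_vec)
  then have int: "integrable lborel (\<lambda>u. indicator {0..t} u *\<^sub>R delay_functional_mat \<tau> \<nu> (segment R u))" for t
    using history_set_integrable unfolding set_integrable_def by blast
  fix t :: real assume t: "t \<ge> 0"
  have "(LINT u:{0..t}|lborel. delay_functional_mat \<tau> \<nu> (segment \<rho> u)) = (LINT u:{0..t}|lborel. delay_functional_mat \<tau> \<nu> (segment R u))"
    unfolding set_lebesgue_integral_def
    by (intro Bochner_Integration.integral_cong refl) (auto simp: indicator_def seg)
  moreover have "\<rho> t = R t" using t by (simp add: R_def)
  moreover have "\<rho> 0 = mat 1" using rho by (simp add: resolvent_def)
  moreover have "\<rho> t - delay_functional_mat \<tau> \<mu> (segment \<rho> t) =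
        \<rho> 0 - delay_functional_mat \<tau> \<mu> (segment \<rho> 0) +
        (LINT u:{0..t}|lborel. delay_functional_mat \<tau> \<nu> (segment \<rho> u))"
    using rho t unfolding resolvent_def by blast
  ultimately have "R t = delay_functional_mat \<tau> \<mu> (segment R t) + mat 1 - delay_functional_mat \<tau> \<mu> (segment R 0) +
        (LINT u:{0..t}|lborel. delay_functional_mat \<tau> \<nu> (segment R u))"
    using t by (simp add: seg algebra_simps)
  then have "R t *v w = delay_functional_mat \<tau> \<mu> (segment R t) *v w + mat 1 *v w - delay_functional_mat \<tau> \<mu> (segment R 0) *v w +
        (LINT u:{0..t}|lborel. delay_functional_mat \<tau> \<nu> (segment R u)) *v w"
    by (simp only: matrix_vector_mult_add_rdistrib matrix_vector_mult_diff_rdistrib)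
  moreover have "(LINT u:{0..t}|lborel. delay_functional_mat \<tau> \<nu> (segment R u)) *v w = (LINT u:{0..t}|lborel. L (\<lambda>t. R t *v w) u)"
    unfolding set_lebesgue_integral_def
    using integral_bounded_linear[OF bounded_linear_matrix_vector_left[of w] int[of t]]
    by (simp add: scaleR_matrix_vector_assoc[symmetric] vec[OF nu])
  moreover have "D (\<lambda>t. R t *v w) 0 = 0"
    by (intro D_supported_at_0 history_R_vec) (simp add: R_neg)
  ultimately show "R t *v w = D (\<lambda>t. R t *v w) t + (LINT u:{0..t}|lborel. L (\<lambda>t. R t *v w) u) + w"
    by (simp add: vec[OF mu])
qed

text \<open>
  A Riemann-Stieltjes sum for \<open>\<integral> R (t - s) dW s\<close> over the grid of step \<open>h\<close> with \<open>N\<close> cells. Evaluating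
  \<open>R\<close> at the right end point of each cell switches an increment on only once it lies in the past, since
  \<open>R\<close> vanishes before 0. One formula therefore serves all times \<open>t\<close>, and the sum is adapted.
\<close>

definition grid_convolution :: "real \<Rightarrow> nat \<Rightarrow> (real \<Rightarrow> real^'d) \<Rightarrow> real \<Rightarrow> real^'d" where
  "grid_convolution h N W t = (\<Sum>i<N. R (t - h * real (Suc i)) *v (W (h * real (Suc i)) - W (h * real i)))"

text \<open>
  The forcing that belongs to \<^const>\<open>grid_convolution\<close>: up to time \<open>h N\<close> it is the interpolation of
  \<open>W - W 0\<close> that keeps the value at the last grid point passed.
\<close>

definition grid_step :: "real \<Rightarrow> nat \<Rightarrow> (real \<Rightarrow> real^'d) \<Rightarrow> real \<Rightarrow> real^'d" where
  "grid_step h N W t = (\<Sum>i<N. if h * real (Suc i) \<le> t then W (h * real (Suc i)) - W (h * real i) else 0)"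

text \<open>
  Superposition: each summand is a shifted resolvent, which solves the equation with a shifted step as
  forcing.
\<close>

lemma forced_grid_convolution:
  "h \<ge> 0 \<Longrightarrow> forced (grid_step h N W) (grid_convolution h N W)"
  unfolding grid_step_def[abs_def] grid_convolution_def[abs_def]
  by (intro forced_sum forced_shift[OF forced_resolvent]) simp

text \<open>
  The increments in the past of \<open>t\<close> telescope.
\<close>

lemma grid_step_eq:
  assumes "h > 0" "0 \<le> t" "t \<le> h * real N"
  shows "grid_step h N W t = W (h * real (nat \<lfloor>t / h\<rfloor>)) - W 0"
proof -
  let ?n = "nat \<lfloor>t / h\<rfloor>"
  have "t / h \<ge> 0" using assms by simp
  have "h * real (Suc i) \<le> t \<longleftrightarrow> i < ?n" for i
  proof -
    have "h * real (Suc i) \<le> t \<longleftrightarrow> real_of_int (int (Suc i)) \<le> t / h"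
      using assms(1) by (simp add: pos_le_divide_eq mult.commute)
    also have "\<dots> \<longleftrightarrow> int (Suc i) \<le> \<lfloor>t / h\<rfloor>" by (rule le_floor_iff[symmetric])
    also have "\<dots> \<longleftrightarrow> i < ?n" by linarith
    finally show ?thesis .
  qed
  moreover have "?n \<le> N"
  proof -
    have "t / h \<le> real N" using assms by (simp add: pos_divide_le_eq mult.commute)
    then have "\<lfloor>t / h\<rfloor> \<le> \<lfloor>real N\<rfloor>" by (rule floor_mono)
    then show ?thesis by simp
  qed
  ultimately have "grid_step h N W t = (\<Sum>i<?n. W (h * real (Suc i)) - W (h * real i))"
    unfolding grid_step_def by (intro sum.mono_neutral_cong_right) auto
  also have "\<dots> = W (h * real ?n) - W 0"
    by (simp only: sum_lessThan_telescope[of "\<lambda>i. W (h * real i)"]) simp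
  finally show ?thesis .
qed

lemma grid_step_uniform:
  assumes W: "continuous_on {0..} W" and "e > 0" and h: "\<And>k. h k > 0" "h \<longlonglongrightarrow> 0"
    and N: "\<forall>\<^sub>F k in sequentially. T \<le> h k * real (N k)"
  shows "\<forall>\<^sub>F k in sequentially. \<forall>t\<in>{0..T}. norm (grid_step (h k) (N k) W t - (W t - W 0)) < e"
proof -
  have "uniformly_continuous_on {0..T} W"
    by (intro compact_uniformly_continuous continuous_on_subset[OF W]) auto
  then obtain d where "d > 0" and d: "\<And>s t. s \<in> {0..T} \<Longrightarrow> t \<in> {0..T} \<Longrightarrow> dist s t < d \<Longrightarrow> dist (W s) (W t) < e"
    using \<open>e > 0\<close> unfolding uniformly_continuous_on_def by metis
  have "\<forall>\<^sub>F k in sequentially. h k < d" by (rule order_tendstoD[OF h(2)]) fact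
  with N show ?thesis
  proof eventually_elim
    case (elim k)
    show ?case
    proof
      fix t assume t: "t \<in> {0..T}"
      define s where "s = h k * real (nat \<lfloor>t / h k\<rfloor>)"
      have "t / h k \<ge> 0" using t h(1)[of k] by simp
      then have n: "real (nat \<lfloor>t / h k\<rfloor>) \<le> t / h k" "t / h k < real (nat \<lfloor>t / h k\<rfloor>) + 1"
        by linarith+
      have "s \<le> t" "t < s + h k"
        using n h(1)[of k] by (simp_all add: s_def field_simps)
      moreover have "s \<ge> 0" using h(1)[of k] by (simp add: s_def)
      ultimately have "dist (W s) (W t) < e"
        using t elim by (intro d) (auto simp: dist_real_def)
      then show "norm (grid_step (h k) (N k) W t - (W t - W 0)) < e"
        using t elim by (simp add: grid_step_eq[OF h(1)] s_def dist_norm)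
    qed
  qed
qed

text \<open>
  The step interpolation of \<open>W\<close> converges uniformly, so by stability the solutions driven by it converge
  to the solution driven by \<open>W\<close>. In this sense the pathwise solution is \<open>\<integral> R (t - s) dW s\<close>.
\<close>

lemma uniform_limit_grid_convolution:
  assumes W: "continuous_on {0..} W" and h: "\<And>k. h k > 0" "h \<longlonglongrightarrow> 0"
    and N: "\<forall>\<^sub>F k in sequentially. T \<le> h k * real (N k)"
    and Y: "forced (\<lambda>t. W t - W 0) Y"
  shows "uniform_limit {..T} (\<lambda>k. grid_convolution (h k) (N k) W) Y sequentially"
proof (rule forced_bound[of T])
  fix C :: real assume "C \<ge> 0" and
    C: "\<And>f y F t. forced f y \<Longrightarrow> (\<And>u. u \<in> {0..T} \<Longrightarrow> norm (f u) \<le> F) \<Longrightarrow> F \<ge> 0 \<Longrightarrow> t \<le> T \<Longrightarrow> norm (y t) \<le> C * F"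
  show ?thesis
  proof (rule uniform_limitI)
    fix e :: real assume "e > 0"
    define e' where "e' = e / (2 * (C + 1))"
    have e': "e' > 0" "e' * C < e"
      using \<open>e > 0\<close> \<open>C \<ge> 0\<close> unfolding e'_def by (simp, intro scaled_tolerance_less)
    from grid_step_uniform[OF W e'(1) h N]
    show "\<forall>\<^sub>F k in sequentially. \<forall>t\<in>{..T}. dist (grid_convolution (h k) (N k) W t) (Y t) < e"
    proof eventually_elim
      case (elim k)
      have "norm (grid_convolution (h k) (N k) W t - Y t) \<le> C * e'" if "t \<le> T" for t
        using elim e'(1) that h(1)[of k]
        by (intro C[OF forced_diff[OF forced_grid_convolution Y]]) (auto intro: less_imp_le)
      then show ?case using e'(2) by (auto simp: dist_norm mult.commute intro: order_le_less_trans)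
    qed
  qed
qed

text \<open>
  The same estimate between two grids, which yields existence of the limit.
\<close>

lemma uniformly_Cauchy_grid_convolution:
  assumes W: "continuous_on {0..} W" and h: "\<And>k. h k > 0" "h \<longlonglongrightarrow> 0"
    and N: "\<forall>\<^sub>F k in sequentially. T \<le> h k * real (N k)"
  shows "uniformly_Cauchy_on {..T} (\<lambda>k. grid_convolution (h k) (N k) W)"
proof (rule forced_bound[of T])
  fix C :: real assume "C \<ge> 0" and
    C: "\<And>f y F t. forced f y \<Longrightarrow> (\<And>u. u \<in> {0..T} \<Longrightarrow> norm (f u) \<le> F) \<Longrightarrow> F \<ge> 0 \<Longrightarrow> t \<le> T \<Longrightarrow> norm (y t) \<le> C * F"
  show ?thesis
  proof (rule uniformly_Cauchy_onI)
    fix e :: real assume "e > 0"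
    define e' where "e' = e / (2 * (C + 1))"
    have e': "e' > 0" "e' * C < e"
      using \<open>e > 0\<close> \<open>C \<ge> 0\<close> unfolding e'_def by (simp, intro scaled_tolerance_less)
    obtain M where M: "\<And>k t. k \<ge> M \<Longrightarrow> t \<in> {0..T} \<Longrightarrow> norm (grid_step (h k) (N k) W t - (W t - W 0)) < e' / 2"
      using grid_step_uniform[OF W half_gt_zero[OF e'(1)] h N] unfolding eventually_sequentially by meson
    have "dist (grid_convolution (h m) (N m) W t) (grid_convolution (h n) (N n) W t) < e"
      if "m \<ge> M" "n \<ge> M" "t \<le> T" for m n t
    proof -
      have "norm (grid_step (h m) (N m) W u - grid_step (h n) (N n) W u) \<le> e'" if "u \<in> {0..T}" for u
        using norm_diff_triangle_less[OF M[OF \<open>m \<ge> M\<close> that] M[OF \<open>n \<ge> M\<close> that, unfolded norm_minus_commute[of _ "W u - W 0"]]]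
        by simp
      then have "norm (grid_convolution (h m) (N m) W t - grid_convolution (h n) (N n) W t) \<le> C * e'"
        using e'(1) h(1) that less_imp_le
        by (intro C[OF forced_diff[OF forced_grid_convolution forced_grid_convolution]]) auto
      then show ?thesis using e'(2) by (simp add: dist_norm mult.commute)
    qed
    then show "\<exists>M. \<forall>x\<in>{..T}. \<forall>m\<ge>M. \<forall>n\<ge>M. dist (grid_convolution (h m) (N m) W x) (grid_convolution (h n) (N n) W x) < e"
      by auto
  qed
qed

lemma continuous_on_grid_convolution_minus_step:
  assumes "h \<ge> 0"
  shows "continuous_on A (\<lambda>t. grid_convolution h N W t - grid_step h N W t)"
proof -
  have *: "grid_convolution h N W t - grid_step h N W t =
    (\<Sum>i<N. (R (t - h * real (Suc i)) - (if t - h * real (Suc i) < 0 then 0 else mat 1)) *v (W (h * real (Suc i)) - W (h * real i)))" for t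
    unfolding grid_convolution_def grid_step_def sum_subtractf[symmetric]
    by (intro sum.cong) (auto simp: matrix_vector_mult_diff_rdistrib)
  have "continuous_on A (\<lambda>t. R (t - q) - (if t - q < 0 then 0 else mat 1))" for q
    by (rule continuous_on_compose2[OF continuous_on_R_minus_jump]) (auto intro!: continuous_intros)
  then show ?thesis
    unfolding * by (intro continuous_on_sum bounded_linear.continuous_on[OF bounded_linear_matrix_vector_left])
qed

text \<open>
  The approximations jump with their forcing, but the difference is continuous, and it converges
  uniformly to \<open>Y - (W - W 0)\<close>.
\<close>

lemma continuous_on_forced_solution:
  assumes W: "continuous_on {0..} W" and Y: "forced (\<lambda>t. W t - W 0) Y"
  shows "continuous_on {0..} Y"
proof -
  define h :: "nat \<Rightarrow> real" where "h k = 1 / 2 ^ k" for k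
  \<comment> \<open>With step \<open>1 / 2 ^ k\<close> these grids reach up to \<open>2 ^ k\<close>, hence eventually beyond every \<open>T\<close>.\<close>
  define N :: "nat \<Rightarrow> nat" where "N k = 4 ^ k" for k
  have "continuous_on {0..T} Y" for T
  proof -
    have h: "h k > 0" "h \<longlonglongrightarrow> 0" for k
      unfolding h_def by (simp, real_asymp)
    have N: "\<forall>\<^sub>F k in sequentially. T \<le> h k * real (N k)"
      unfolding h_def N_def by real_asymp
    have 1: "uniform_limit {0..T} (\<lambda>k. grid_convolution (h k) (N k) W) Y sequentially"
      by (rule uniform_limit_on_subset[OF uniform_limit_grid_convolution[OF W h N Y]]) auto
    have 2: "uniform_limit {0..T} (\<lambda>k. grid_step (h k) (N k) W) (\<lambda>t. W t - W 0) sequentially"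
      using grid_step_uniform[OF W _ h N] by (intro uniform_limitI) (simp add: dist_norm)
    have "continuous_on {0..T} (\<lambda>t. Y t - (W t - W 0))"
    proof (rule uniform_limit_theorem[OF _ uniform_limit_minus[OF 1 2]])
      show "\<forall>\<^sub>F k in sequentially. continuous_on {0..T} (\<lambda>t. grid_convolution (h k) (N k) W t - grid_step (h k) (N k) W t)"
        using h(1) by (intro always_eventually allI continuous_on_grid_convolution_minus_step less_imp_le)
    qed simp
    moreover have "continuous_on {0..T} (\<lambda>t. W t - W 0)"
      by (intro continuous_on_diff continuous_on_const continuous_on_subset[OF W]) auto
    ultimately have "continuous_on {0..T} (\<lambda>t. (Y t - (W t - W 0)) + (W t - W 0))"
      by (rule continuous_on_add)
    then show ?thesis by (simp only: diff_add_cancel)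
  qed
  then show ?thesis by (rule continuous_on_atLeastI)
qed

lemma forced_solution_grid_limit:
  assumes W: "continuous_on {0..} W" and h: "\<And>k. h k > 0" "h \<longlonglongrightarrow> 0"
    and N: "\<And>T. \<forall>\<^sub>F k in sequentially. T \<le> h k * real (N k)"
  shows "forced (\<lambda>t. W t - W 0) (\<lambda>t. lim (\<lambda>k. grid_convolution (h k) (N k) W t))"
proof (rule forced_limit)
  show "forced (grid_step (h k) (N k) W) (grid_convolution (h k) (N k) W)" for k
    using h(1) by (intro forced_grid_convolution less_imp_le)
  show "uniform_limit {..T} (\<lambda>k. grid_convolution (h k) (N k) W) (\<lambda>t. lim (\<lambda>k. grid_convolution (h k) (N k) W t)) sequentially" for T
    using Cauchy_uniformly_convergent[OF uniformly_Cauchy_grid_convolution[OF W h N]]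
    unfolding uniformly_convergent_uniform_limit_iff .
  fix t :: real assume "t \<ge> 0"
  show "(\<lambda>k. grid_step (h k) (N k) W t) \<longlonglongrightarrow> W t - W 0"
  proof (rule tendstoI)
    fix e :: real assume "e > 0"
    from grid_step_uniform[OF W this h N[of t]]
    show "\<forall>\<^sub>F k in sequentially. dist (grid_step (h k) (N k) W t) (W t - W 0) < e"
      by eventually_elim (use \<open>t \<ge> 0\<close> in \<open>auto simp: dist_norm\<close>)
  qed
qed

end

section \<open>Partitions and simple processes\<close>

lemma tendsto_ennreal_zeroI:
  fixes f :: "'i \<Rightarrow> ennreal"
  assumes "\<And>e. e > 0 \<Longrightarrow> \<forall>\<^sub>F k in G. f k \<le> ennreal e"
  shows "(f \<longlongrightarrow> 0) G"
proof (rule order_tendstoI)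
  fix a :: ennreal assume "0 < a"
  then obtain b where b: "0 < b" "b < a" using dense by blast
  then obtain e where e: "b = ennreal e" "e \<ge> 0" by (cases b) auto
  with b have "e > 0" by (cases "e = 0") auto
  from assms[OF this] show "\<forall>\<^sub>F k in G. f k < a"
    by eventually_elim (use b e in auto)
qed simp

lemma partition_mono:
  fixes p :: "nat \<Rightarrow> real"
  assumes "\<And>i. i < n \<Longrightarrow> p i < p (Suc i)" "i \<le> j" "j \<le> n"
  shows "p i \<le> p j"
  using assms(2,3)
proof (induction j rule: dec_induct)
  case (step j)
  then show ?case using assms(1)[of j] by simp
qed simp

lemma partition_cell_unique:
  fixes p :: "nat \<Rightarrow> real"
  assumes p: "\<And>i. i < n \<Longrightarrow> p i < p (Suc i)" and i: "i < n" "s \<in> {p i<..p (Suc i)}"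
    and j: "j < n" "s \<in> {p j<..p (Suc j)}"
  shows "i = j"
proof (rule ccontr)
  assume "i \<noteq> j"
  then have "Suc i \<le> j \<or> Suc j \<le> i" by auto
  then show False
    using partition_mono[of n p "Suc i" j] partition_mono[of n p "Suc j" i] p i j by auto
qed

lemma sum_partition_cell:
  fixes p :: "nat \<Rightarrow> real" and f :: "nat \<Rightarrow> 'b::comm_monoid_add"
  assumes p: "\<And>i. i < n \<Longrightarrow> p i < p (Suc i)" and i: "i < n" "s \<in> {p i<..p (Suc i)}"
  shows "(\<Sum>j<n. if s \<in> {p j<..p (Suc j)} then f j else 0) = f i"
proof -
  have "(if s \<in> {p j<..p (Suc j)} then f j else 0) = (if j = i then f j else 0)" if "j < n" for j
    using partition_cell_unique[OF p i that] i by (cases "j = i") auto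
  then have "(\<Sum>j<n. if s \<in> {p j<..p (Suc j)} then f j else 0) = (\<Sum>j<n. if j = i then f j else 0)"
    by (intro sum.cong) simp_all
  also have "\<dots> = f i" using i by simp
  finally show ?thesis .
qed

lemma simple_process_cell:
  assumes "\<And>i. i < n \<Longrightarrow> p i < p (Suc i)" "i < n" "s \<in> {p i<..p (Suc i)}"
  shows "simple_process n p \<xi> s \<omega> = \<xi> i \<omega>"
proof -
  have "simple_process n p \<xi> s \<omega> = (\<Sum>j<n. if s \<in> {p j<..p (Suc j)} then \<xi> j \<omega> else 0)"
    unfolding simple_process_def by (intro sum.cong) (auto simp: indicator_def)
  also have "\<dots> = \<xi> i \<omega>" by (rule sum_partition_cell[OF assms])
  finally show ?thesis .
qed

lemma partition_cell_exists:
  fixes p :: "nat \<Rightarrow> real"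
  assumes "p 0 < s" "s \<le> p n"
  obtains i where "i < n" "s \<in> {p i<..p (Suc i)}"
proof -
  have "\<exists>i<n. s \<in> {p i<..p (Suc i)}"
    using assms
  proof (induction n)
    case (Suc n)
    then show ?case by (cases "s \<le> p n") (auto intro: less_SucI)
  qed simp
  then show ?thesis using that by blast
qed

section \<open>The Ito isometry for simple processes\<close>

lemma power2_norm_matrix: "(norm (A :: real^'m^'d))\<^sup>2 = (\<Sum>a\<in>UNIV. \<Sum>k\<in>UNIV. (A $ a $ k)\<^sup>2)"
  unfolding power2_norm_eq_inner by (simp add: inner_vec_def power2_eq_square)

lemma matrix_entry_measurable:
  assumes "\<xi> \<in> borel_measurable N"
  shows "(\<lambda>\<omega>. (\<xi> \<omega> :: real^'n^'k) $ a $ k) \<in> borel_measurable N"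
proof -
  have [measurable]: "(\<lambda>x::real^'n^'k. x $ a $ k) \<in> borel_measurable borel"
    by (intro borel_measurable_continuous_onI continuous_intros)
  show ?thesis using assms by measurable
qed

lemma vector_entry_measurable:
  assumes "\<xi> \<in> borel_measurable N"
  shows "(\<lambda>\<omega>. (\<xi> \<omega> :: real^'n) $ a) \<in> borel_measurable N"
proof -
  have [measurable]: "(\<lambda>x::real^'n. x $ a) \<in> borel_measurable borel"
    by (intro borel_measurable_continuous_onI continuous_intros)
  show ?thesis using assms by measurable
qed

lemma matrix_vector_measurable:
  fixes \<xi> :: "'a \<Rightarrow> real^'m^'d" and v :: "'a \<Rightarrow> real^'m"
  assumes "\<xi> \<in> borel_measurable N" "v \<in> borel_measurable N"
  shows "(\<lambda>\<omega>. \<xi> \<omega> *v v \<omega>) \<in> borel_measurable N"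
  unfolding matrix_vector_mult_def
  by (intro borel_measurable_vecI)
     (simp add: borel_measurable_sum borel_measurable_times matrix_entry_measurable[OF assms(1)] vector_entry_measurable[OF assms(2)])

locale filtered_brownian = prob_space M for M :: "'a measure" +
  fixes F :: "real \<Rightarrow> 'a measure" and B :: "real \<Rightarrow> 'a \<Rightarrow> real^'m"
  assumes usual: "usual_conditions M F" and bm: "brownian_motion M F B"
begin

lemma subalgebra_F: "t \<ge> 0 \<Longrightarrow> subalgebra M (F t)"
  using usual by (simp add: usual_conditions_def)

lemma space_F: "t \<ge> 0 \<Longrightarrow> space (F t) = space M"
  using subalgebra_F by (simp add: subalgebra_def)

lemma measurable_F_imp: "t \<ge> 0 \<Longrightarrow> f \<in> measurable (F t) N \<Longrightarrow> f \<in> measurable M N"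
  using measurable_from_subalg[OF subalgebra_F] .

lemma measurable_F_mono:
  assumes "0 \<le> s" "s \<le> t" "f \<in> measurable (F s) N"
  shows "f \<in> measurable (F t) N"
proof -
  have "sets (F s) \<subseteq> sets (F t)" using usual assms(1,2) unfolding usual_conditions_def by blast
  then have "subalgebra (F t) (F s)" using assms by (simp add: subalgebra_def space_F)
  then show ?thesis using assms(3) by (rule measurable_from_subalg)
qed

lemma B_measurable_F:
  assumes "0 \<le> s" "s \<le> t"
  shows "B s \<in> borel_measurable (F t)"
proof (rule measurable_F_mono[OF assms])
  show "B s \<in> borel_measurable (F s)"
    using bm assms(1) unfolding brownian_motion_def adapted_def by blast
qed

lemma B_measurable: "0 \<le> s \<Longrightarrow> B s \<in> borel_measurable M"
  using B_measurable_F[of s s] measurable_F_imp by auto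

lemma increment_moments:
  assumes "0 \<le> s" "s < t"
  defines "X \<equiv> (\<lambda>k \<omega>. (B t \<omega> - B s \<omega>) $ k)"
  shows "integrable M (X k)" "integrable M (\<lambda>\<omega>. (X k \<omega>)\<^sup>2)"
    "expectation (X k) = 0" "expectation (\<lambda>\<omega>. (X k \<omega>)\<^sup>2) = t - s"
    "k \<noteq> l \<Longrightarrow> integrable M (\<lambda>\<omega>. X k \<omega> * X l \<omega>)"
    "k \<noteq> l \<Longrightarrow> expectation (\<lambda>\<omega>. X k \<omega> * X l \<omega>) = 0"
proof -
  have D: "distributed M lborel (X k) (normal_density 0 (sqrt (t - s)))" for k
    using bm assms by (simp add: brownian_motion_def)
  have \<sigma>: "sqrt (t - s) > 0" using assms by simp
  show int: "integrable M (X k)" for k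
    using distributed_integrable[OF D, of "\<lambda>x. x" k] integrable_normal_moment[OF \<sigma>, of 0 1] by simp
  show "integrable M (\<lambda>\<omega>. (X k \<omega>)\<^sup>2)"
    using distributed_integrable[OF D, of "\<lambda>x. x\<^sup>2" k] integrable_normal_moment[OF \<sigma>, of 0 2] by simp
  show mean: "expectation (X k) = 0" for k
    by (rule normal_distributed_expectation[OF \<sigma> D])
  show "expectation (\<lambda>\<omega>. (X k \<omega>)\<^sup>2) = t - s"
    using normal_distributed_variance[OF \<sigma> D, of k] assms(1,2) unfolding mean by simp
  assume "k \<noteq> l"
  have "indep_vars (\<lambda>_. borel) X UNIV"
    using bm assms by (simp add: brownian_motion_def)
  then have indep: "indep_vars (\<lambda>_. borel) X {k, l}"
    by (rule indep_vars_subset) auto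
  show "integrable M (\<lambda>\<omega>. X k \<omega> * X l \<omega>)"
    using indep_vars_integrable[OF _ indep int] \<open>k \<noteq> l\<close> by simp
  show "expectation (\<lambda>\<omega>. X k \<omega> * X l \<omega>) = 0"
    using indep_vars_lebesgue_integral[OF _ indep int] \<open>k \<noteq> l\<close> mean by simp
qed

lemma indep_set_mono:
  assumes "indep_set X Y" "X' \<subseteq> X" "Y' \<subseteq> Y"
  shows "indep_set X' Y'"
  using assms unfolding indep_sets2_eq by (meson subset_eq)

text \<open>
  Independence of the increment from the past is given as a statement about sigma-algebras; it passes to
  functions of the increment and to random variables measurable at time \<open>s\<close>.
\<close>

lemma past_increment_indep:
  fixes Z :: "'a \<Rightarrow> real" and g :: "real^'m \<Rightarrow> real"
  assumes "0 \<le> s" "s < t" and Z: "Z \<in> borel_measurable (F s)" and g[measurable]: "g \<in> borel_measurable borel"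
  shows "indep_var borel Z borel (\<lambda>\<omega>. g (B t \<omega> - B s \<omega>))"
  unfolding indep_var_eq
proof (intro conjI)
  have [measurable]: "B t \<in> borel_measurable M" "B s \<in> borel_measurable M"
    using assms by (auto intro!: B_measurable)
  show "random_variable borel Z" using Z assms by (auto intro: measurable_F_imp)
  show "random_variable borel (\<lambda>\<omega>. g (B t \<omega> - B s \<omega>))" by measurable
  let ?I = "{(\<lambda>\<omega>. B t \<omega> - B s \<omega>) -` A \<inter> space M | A. A \<in> sets borel}"
  have ind: "indep_set (sets (F s)) ?I"
    using bm assms by (simp add: brownian_motion_def)
  have 1: "sigma_sets (space M) {Z -` A \<inter> space M |A. A \<in> sets borel} \<subseteq> sets (F s)"
  proof -
    have "{Z -` A \<inter> space M |A. A \<in> sets borel} \<subseteq> sets (F s)"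
      using measurable_sets[OF Z] space_F[of s] assms by auto
    then show ?thesis
      using sets.sigma_sets_subset[of _ "F s"] space_F[of s] assms by simp
  qed
  have 2: "sigma_sets (space M) {(\<lambda>\<omega>. g (B t \<omega> - B s \<omega>)) -` A \<inter> space M |A. A \<in> sets borel} \<subseteq> ?I"
  proof -
    have I: "?I = sets (vimage_algebra (space M) (\<lambda>\<omega>. B t \<omega> - B s \<omega>) borel)"
      by (subst sets_vimage_algebra2) auto
    have "{(\<lambda>\<omega>. g (B t \<omega> - B s \<omega>)) -` A \<inter> space M |A. A \<in> sets borel} \<subseteq> ?I"
    proof safe
      fix A :: "real set" assume "A \<in> sets borel"
      then have "g -` A \<in> sets borel" using measurable_sets[OF g] by auto
      then show "\<exists>A'. (\<lambda>\<omega>. g (B t \<omega> - B s \<omega>)) -` A \<inter> space M = (\<lambda>\<omega>. B t \<omega> - B s \<omega>) -` A' \<inter> space M \<and> A' \<in> sets borel"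
        by (intro exI[of _ "g -` A"]) auto
    qed
    then show ?thesis
      unfolding I using sets.sigma_sets_subset[of _ "vimage_algebra (space M) (\<lambda>\<omega>. B t \<omega> - B s \<omega>) borel"] by simp
  qed
  show "indep_set (sigma_sets (space M) {Z -` A \<inter> space M |A. A \<in> sets borel})
     (sigma_sets (space M) {(\<lambda>\<omega>. g (B t \<omega> - B s \<omega>)) -` A \<inter> space M |A. A \<in> sets borel})"
    by (rule indep_set_mono[OF ind 1 2])
qed

lemma past_times_increment:
  fixes Z :: "'a \<Rightarrow> real"
  assumes "0 \<le> s" "s < t" and Z: "Z \<in> borel_measurable (F s)" "integrable M Z"
  shows "integrable M (\<lambda>\<omega>. Z \<omega> * (B t \<omega> - B s \<omega>) $ k)" "expectation (\<lambda>\<omega>. Z \<omega> * (B t \<omega> - B s \<omega>) $ k) = 0"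
proof -
  have "(\<lambda>x::real^'m. x $ k) \<in> borel_measurable borel"
    by (intro borel_measurable_continuous_onI continuous_intros)
  from past_increment_indep[OF assms(1,2) Z(1) this]
  show "integrable M (\<lambda>\<omega>. Z \<omega> * (B t \<omega> - B s \<omega>) $ k)" "expectation (\<lambda>\<omega>. Z \<omega> * (B t \<omega> - B s \<omega>) $ k) = 0"
    using indep_var_integrable[OF _ Z(2) increment_moments(1)[OF assms(1,2)]]
      indep_var_lebesgue_integral[OF _ Z(2) increment_moments(1)[OF assms(1,2)]]
      increment_moments(3)[OF assms(1,2)]
    by (simp_all del: vector_minus_component)
qed

lemma past_times_increment_product:
  fixes Z :: "'a \<Rightarrow> real"
  assumes "0 \<le> s" "s < t" and Z: "Z \<in> borel_measurable (F s)" "integrable M Z"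
  shows "integrable M (\<lambda>\<omega>. Z \<omega> * ((B t \<omega> - B s \<omega>) $ k * (B t \<omega> - B s \<omega>) $ l))"
    "expectation (\<lambda>\<omega>. Z \<omega> * ((B t \<omega> - B s \<omega>) $ k * (B t \<omega> - B s \<omega>) $ l)) =
      (if k = l then expectation Z * (t - s) else 0)"
proof -
  have "(\<lambda>x::real^'m. x $ k * x $ l) \<in> borel_measurable borel"
    by (intro borel_measurable_continuous_onI continuous_intros)
  note ind = past_increment_indep[OF assms(1,2) Z(1) this]
  have int: "integrable M (\<lambda>\<omega>. (B t \<omega> - B s \<omega>) $ k * (B t \<omega> - B s \<omega>) $ l)"
    and ex: "expectation (\<lambda>\<omega>. (B t \<omega> - B s \<omega>) $ k * (B t \<omega> - B s \<omega>) $ l) = (if k = l then t - s else 0)"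
    using increment_moments(2,4-6)[OF assms(1,2), of k] by (cases "k = l"; simp add: power2_eq_square)+
  show "integrable M (\<lambda>\<omega>. Z \<omega> * ((B t \<omega> - B s \<omega>) $ k * (B t \<omega> - B s \<omega>) $ l))"
    by (rule indep_var_integrable[OF ind Z(2) int])
  show "expectation (\<lambda>\<omega>. Z \<omega> * ((B t \<omega> - B s \<omega>) $ k * (B t \<omega> - B s \<omega>) $ l)) =
      (if k = l then expectation Z * (t - s) else 0)"
    using indep_var_lebesgue_integral[OF ind Z(2) int] by (simp add: ex del: vector_minus_component)
qed

lemma bounded_integrable:
  fixes Z :: "'a \<Rightarrow> real"
  assumes "Z \<in> borel_measurable M" "\<And>\<omega>. \<omega> \<in> space M \<Longrightarrow> \<bar>Z \<omega>\<bar> \<le> C"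
  shows "integrable M Z"
  using assms by (intro integrable_const_bound[where B=C] AE_I2) auto

text \<open>
  Expanding the square of \<open>S + \<xi> (B t - B s)\<close>: the cross terms are a quantity known at time \<open>s\<close> times a
  centred independent increment, and among the products of two components of the increment only the
  squares survive, each contributing \<open>t - s\<close>. This leaves the squared Frobenius norm of \<open>\<xi>\<close>.
\<close>

lemma simple_ito_isometry_step:
  fixes S :: "'a \<Rightarrow> real^'d" and \<xi> :: "'a \<Rightarrow> real^'m^'d"
  assumes st: "0 \<le> s" "s < t"
    and S: "S \<in> borel_measurable (F s)" "integrable M (\<lambda>\<omega>. (norm (S \<omega>))\<^sup>2)"
    and \<xi>: "\<xi> \<in> borel_measurable (F s)" "\<And>\<omega>. \<omega> \<in> space M \<Longrightarrow> norm (\<xi> \<omega>) \<le> C"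
  defines "v \<equiv> (\<lambda>\<omega>. \<xi> \<omega> *v (B t \<omega> - B s \<omega>))"
  shows "integrable M (\<lambda>\<omega>. (norm (S \<omega> + v \<omega>))\<^sup>2)"
    "expectation (\<lambda>\<omega>. (norm (S \<omega> + v \<omega>))\<^sup>2) =
      expectation (\<lambda>\<omega>. (norm (S \<omega>))\<^sup>2) + (t - s) * expectation (\<lambda>\<omega>. (norm (\<xi> \<omega>))\<^sup>2)"
proof -
  have SM: "S \<in> borel_measurable M" and \<xi>M: "\<xi> \<in> borel_measurable M"
    using S(1) \<xi>(1) st by (auto intro: measurable_F_imp)
  note [measurable] = SM \<xi>M
  have entry: "\<bar>\<xi> \<omega> $ a $ k\<bar> \<le> C" if "\<omega> \<in> space M" for \<omega> a k
    using \<xi>(2)[OF that] component_le_norm_cart[of "\<xi> \<omega> $ a" k] Finite_Cartesian_Product.norm_nth_le[of "\<xi> \<omega>" a] by linarith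
  have S2: "integrable M (\<lambda>\<omega>. (S \<omega> $ a)\<^sup>2)" for a
  proof (rule Bochner_Integration.integrable_bound[OF S(2)])
    show "(\<lambda>\<omega>. (S \<omega> $ a)\<^sup>2) \<in> borel_measurable M"
      using vector_entry_measurable[OF SM] by measurable
    show "AE \<omega> in M. norm ((S \<omega> $ a)\<^sup>2) \<le> norm ((norm (S \<omega>))\<^sup>2)"
      using component_le_norm_cart[of "S _" a] by (intro AE_I2) (simp add: abs_le_square_iff[symmetric])
  qed
  have S1: "integrable M (\<lambda>\<omega>. S \<omega> $ a)" for a
    by (rule square_integrable_imp_integrable[OF vector_entry_measurable[OF SM] S2])
  let ?Z1 = "\<lambda>a k \<omega>. S \<omega> $ a * \<xi> \<omega> $ a $ k"
  have Z1: "?Z1 a k \<in> borel_measurable (F s)" "integrable M (?Z1 a k)" for a k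
  proof -
    show "?Z1 a k \<in> borel_measurable (F s)"
      by (intro borel_measurable_times vector_entry_measurable matrix_entry_measurable S(1) \<xi>(1))
    show "integrable M (?Z1 a k)"
    proof (rule Bochner_Integration.integrable_bound[where f="\<lambda>\<omega>. C * \<bar>S \<omega> $ a\<bar>"])
      show "integrable M (\<lambda>\<omega>. C * \<bar>S \<omega> $ a\<bar>)" using S1 by auto
      show "?Z1 a k \<in> borel_measurable M"
        by (intro borel_measurable_times vector_entry_measurable matrix_entry_measurable SM \<xi>M)
      show "AE \<omega> in M. norm (S \<omega> $ a * \<xi> \<omega> $ a $ k) \<le> norm (C * \<bar>S \<omega> $ a\<bar>)"
        using entry by (intro AE_I2) (auto simp: abs_mult mult.commute[of C] intro!: mult_left_mono order_trans[OF entry])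
    qed
  qed
  let ?Z2 = "\<lambda>a k l \<omega>. \<xi> \<omega> $ a $ k * \<xi> \<omega> $ a $ l"
  have Z2: "?Z2 a k l \<in> borel_measurable (F s)" "integrable M (?Z2 a k l)" for a k l
  proof -
    show "?Z2 a k l \<in> borel_measurable (F s)"
      by (intro borel_measurable_times matrix_entry_measurable \<xi>(1))
    show "integrable M (?Z2 a k l)"
    proof (rule bounded_integrable)
      show "?Z2 a k l \<in> borel_measurable M"
        by (intro borel_measurable_times matrix_entry_measurable \<xi>M)
      show "\<bar>?Z2 a k l \<omega>\<bar> \<le> C * C" if "\<omega> \<in> space M" for \<omega>
        using entry[OF that] order_trans[OF abs_ge_zero entry[OF that]]
        by (simp only: abs_mult) (intro mult_mono, auto)
    qed
  qed
  let ?d = "\<lambda>\<omega> k. (B t \<omega> - B s \<omega>) $ k"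
  have cross: "S \<omega> \<bullet> v \<omega> = (\<Sum>a\<in>UNIV. \<Sum>k\<in>UNIV. ?Z1 a k \<omega> * ?d \<omega> k)" for \<omega>
    by (simp add: v_def inner_vec_def matrix_vector_mult_def sum_distrib_left mult.assoc)
  have diag: "v \<omega> \<bullet> v \<omega> = (\<Sum>a\<in>UNIV. \<Sum>k\<in>UNIV. \<Sum>l\<in>UNIV. ?Z2 a k l \<omega> * (?d \<omega> k * ?d \<omega> l))" for \<omega>
    by (simp add: v_def inner_vec_def matrix_vector_mult_def sum_product mult_ac)
  have split: "(norm (S \<omega> + v \<omega>))\<^sup>2 = (norm (S \<omega>))\<^sup>2 + 2 * (S \<omega> \<bullet> v \<omega>) + v \<omega> \<bullet> v \<omega>" for \<omega>
    by (simp add: power2_norm_eq_inner inner_add_left inner_add_right inner_commute)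
  have ic: "integrable M (\<lambda>\<omega>. S \<omega> \<bullet> v \<omega>)"
    unfolding cross using past_times_increment(1)[OF st Z1] by (intro Bochner_Integration.integrable_sum)
  have id: "integrable M (\<lambda>\<omega>. v \<omega> \<bullet> v \<omega>)"
    unfolding diag using past_times_increment_product(1)[OF st Z2] by (intro Bochner_Integration.integrable_sum)
  show "integrable M (\<lambda>\<omega>. (norm (S \<omega> + v \<omega>))\<^sup>2)"
    unfolding split using ic id S(2) by (intro Bochner_Integration.integrable_add) auto
  have ec: "expectation (\<lambda>\<omega>. S \<omega> \<bullet> v \<omega>) = 0"
    unfolding cross using past_times_increment[OF st Z1] by (simp add: Bochner_Integration.integral_sum)
  have "expectation (\<lambda>\<omega>. v \<omega> \<bullet> v \<omega>) = (\<Sum>a\<in>UNIV. \<Sum>k\<in>UNIV. \<Sum>l\<in>UNIV. expectation (\<lambda>\<omega>. ?Z2 a k l \<omega> * (?d \<omega> k * ?d \<omega> l)))"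
    unfolding diag using past_times_increment_product(1)[OF st Z2]
    by (simp only: Bochner_Integration.integral_sum Bochner_Integration.integrable_sum)
  also have "\<dots> = (\<Sum>a\<in>UNIV. \<Sum>k\<in>UNIV. expectation (?Z2 a k k) * (t - s))"
    by (simp add: past_times_increment_product(2)[OF st Z2] del: vector_minus_component)
  also have "\<dots> = (t - s) * expectation (\<lambda>\<omega>. (norm (\<xi> \<omega>))\<^sup>2)"
  proof -
    have "expectation (\<lambda>\<omega>. (norm (\<xi> \<omega>))\<^sup>2) = (\<Sum>a\<in>UNIV. \<Sum>k\<in>UNIV. expectation (?Z2 a k k))"
      unfolding power2_norm_matrix unfolding power2_eq_square using Z2(2) by simp
    then show ?thesis by (simp add: sum_distrib_left mult.commute)
  qed
  finally have ed: "expectation (\<lambda>\<omega>. v \<omega> \<bullet> v \<omega>) = (t - s) * expectation (\<lambda>\<omega>. (norm (\<xi> \<omega>))\<^sup>2)" .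
  show "expectation (\<lambda>\<omega>. (norm (S \<omega> + v \<omega>))\<^sup>2) =
      expectation (\<lambda>\<omega>. (norm (S \<omega>))\<^sup>2) + (t - s) * expectation (\<lambda>\<omega>. (norm (\<xi> \<omega>))\<^sup>2)"
    unfolding split using ic id S(2) by (simp add: ec ed)
qed

lemma simple_ito_isometry:
  fixes \<xi> :: "nat \<Rightarrow> 'a \<Rightarrow> real^'m^'d"
  assumes "simple_process_data M F t n p \<xi>"
  shows "simple_ito_integral B n p \<xi> \<in> borel_measurable (F t)"
    "integrable M (\<lambda>\<omega>. (norm (simple_ito_integral B n p \<xi> \<omega>))\<^sup>2)"
    "expectation (\<lambda>\<omega>. (norm (simple_ito_integral B n p \<xi> \<omega>))\<^sup>2) =
      (\<Sum>i<n. (p (Suc i) - p i) * expectation (\<lambda>\<omega>. (norm (\<xi> i \<omega>))\<^sup>2))"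
proof -
  have "simple_ito_integral B n p \<xi> \<in> borel_measurable (F t) \<and>
    integrable M (\<lambda>\<omega>. (norm (simple_ito_integral B n p \<xi> \<omega>))\<^sup>2) \<and>
    expectation (\<lambda>\<omega>. (norm (simple_ito_integral B n p \<xi> \<omega>))\<^sup>2) =
      (\<Sum>i<n. (p (Suc i) - p i) * expectation (\<lambda>\<omega>. (norm (\<xi> i \<omega>))\<^sup>2))"
    using assms
  proof (induction n arbitrary: t)
    case 0
    then show ?case by (simp add: simple_ito_integral_def)
  next
    case (Suc n)
    let ?S = "simple_ito_integral B n p \<xi>"
    have data: "simple_process_data M F (p n) n p \<xi>"
      using Suc.prems by (simp add: simple_process_data_def)
    note IH = Suc.IH[OF data]
    have lt: "p n < p (Suc n)" and t: "t = p (Suc n)" and \<xi>: "\<xi> n \<in> borel_measurable (F (p n))"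
      using Suc.prems by (auto simp: simple_process_data_def)
    have nonneg: "0 \<le> p n"
      using partition_mono[of "Suc n" p 0 n] Suc.prems by (auto simp: simple_process_data_def)
    obtain C where C: "\<And>\<omega>. \<omega> \<in> space M \<Longrightarrow> norm (\<xi> n \<omega>) \<le> C"
      using Suc.prems unfolding simple_process_data_def by blast
    have Sn: "simple_ito_integral B (Suc n) p \<xi> = (\<lambda>\<omega>. ?S \<omega> + \<xi> n \<omega> *v (B (p (Suc n)) \<omega> - B (p n) \<omega>))"
      by (auto simp: simple_ito_integral_def)
    have "(\<lambda>\<omega>. ?S \<omega> + \<xi> n \<omega> *v (B (p (Suc n)) \<omega> - B (p n) \<omega>)) \<in> borel_measurable (F t)"
      using IH \<xi> lt nonneg t
      by (intro borel_measurable_add matrix_vector_measurable borel_measurable_diff B_measurable_F)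
         (auto intro: measurable_F_mono[of "p n"])
    then show ?case
      using simple_ito_isometry_step[OF nonneg lt _ _ \<xi> C, of ?S] IH by (simp add: Sn)
  qed
  then show "simple_ito_integral B n p \<xi> \<in> borel_measurable (F t)"
    "integrable M (\<lambda>\<omega>. (norm (simple_ito_integral B n p \<xi> \<omega>))\<^sup>2)"
    "expectation (\<lambda>\<omega>. (norm (simple_ito_integral B n p \<xi> \<omega>))\<^sup>2) =
      (\<Sum>i<n. (p (Suc i) - p i) * expectation (\<lambda>\<omega>. (norm (\<xi> i \<omega>))\<^sup>2))" by auto
qed

end

section \<open>Ito integrals of deterministic integrands\<close>

lemma has_ito_integralI:
  assumes "(\<lambda>(s, \<omega>). G s \<omega>) \<in> borel_measurable (restrict_space lborel {0..t} \<Otimes>\<^sub>M M)"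
    and "\<And>s. s \<in> {0..t} \<Longrightarrow> G s \<in> borel_measurable (F s)" and "Y \<in> borel_measurable M"
    and "\<And>k. simple_process_data M F t (n k) (p k) (\<xi> k)"
    and "(\<lambda>k. \<integral>\<^sup>+\<omega>. (\<integral>\<^sup>+s\<in>{0..t}.
      ennreal ((norm (simple_process (n k) (p k) (\<xi> k) s \<omega> - G s \<omega>))\<^sup>2) \<partial>lborel) \<partial>M) \<longlonglongrightarrow> 0"
    and "(\<lambda>k. \<integral>\<^sup>+\<omega>. ennreal ((norm (simple_ito_integral B (n k) (p k) (\<xi> k) \<omega> - Y \<omega>))\<^sup>2) \<partial>M) \<longlonglongrightarrow> 0"
  shows "has_ito_integral M F B t G Y"
  unfolding has_ito_integral_def
  by (intro conjI ballI exI[of _ n] exI[of _ p] exI[of _ \<xi>] allI assms)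

lemma matrix_vector_telescope:
  fixes A :: "real^'m^'d" and W :: "nat \<Rightarrow> real^'m"
  shows "(\<Sum>j\<in>{m..<m + r}. A *v (W (Suc j) - W j)) = A *v (W (m + r) - W m)"
  by (induction r) (simp_all add: algebra_simps matrix_vector_mult_diff_distrib)

text \<open>
  Every cell of the coarse grid is divided into \<open>q\<close> cells, and the increments over these telescope. Two
  nested grids can thus be compared within a single simple integral.
\<close>

lemma simple_ito_integral_refine:
  fixes c :: "nat \<Rightarrow> real^'m^'d"
  assumes "q > 0"
  shows "simple_ito_integral B n (\<lambda>i. h * real i) (\<lambda>i _. c i) \<omega> =
    simple_ito_integral B (n * q) (\<lambda>j. h / real q * real j) (\<lambda>j _. c (j div q)) \<omega>"
proof -
  let ?W = "\<lambda>j. B (h / real q * real j) \<omega>"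
  have "simple_ito_integral B (n * q) (\<lambda>j. h / real q * real j) (\<lambda>j _. c (j div q)) \<omega> =
      (\<Sum>i<n. \<Sum>j\<in>{i * q..<i * q + q}. c (j div q) *v (?W (Suc j) - ?W j))"
    unfolding simple_ito_integral_def by (rule sum.nat_group[symmetric])
  also have "\<dots> = (\<Sum>i<n. c i *v (B (h * real (Suc i)) \<omega> - B (h * real i) \<omega>))"
  proof (rule sum.cong[OF refl])
    fix i
    have "j div q = i" if "j \<in> {i * q..<i * q + q}" for j
      using that assms by (intro div_nat_eqI) (auto simp: mult.commute)
    then have "(\<Sum>j\<in>{i * q..<i * q + q}. c (j div q) *v (?W (Suc j) - ?W j)) = (\<Sum>j\<in>{i * q..<i * q + q}. c i *v (?W (Suc j) - ?W j))"
      by (intro sum.cong) simp_all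
    also have "\<dots> = c i *v (?W (i * q + q) - ?W (i * q))" by (rule matrix_vector_telescope)
    also have "\<dots> = c i *v (B (h * real (Suc i)) \<omega> - B (h * real i) \<omega>)"
    proof -
      have "h / real q * real (i * q + q) = h * real (Suc i)" "h / real q * real (i * q) = h * real i"
        using assms by (simp_all add: field_simps)
      then show ?thesis by (simp only:)
    qed
    finally show "(\<Sum>j\<in>{i * q..<i * q + q}. c (j div q) *v (?W (Suc j) - ?W j)) = c i *v (B (h * real (Suc i)) \<omega> - B (h * real i) \<omega>)" .
  qed
  finally show ?thesis by (simp add: simple_ito_integral_def)
qed

lemma simple_ito_integral_diff:
  fixes \<xi> :: "nat \<Rightarrow> 'a \<Rightarrow> real^'m^'d"
  shows "simple_ito_integral B n p \<xi> \<omega> - simple_ito_integral B n p \<xi>' \<omega> =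
    simple_ito_integral B n p (\<lambda>i \<omega>. \<xi> i \<omega> - \<xi>' i \<omega>) \<omega>"
  by (simp add: simple_ito_integral_def sum_subtractf matrix_vector_mult_diff_rdistrib)

lemma simple_ito_integral_const:
  fixes \<Sigma> :: "real^'m^'d"
  shows "simple_ito_integral B n p (\<lambda>_ _. \<Sigma>) \<omega> = \<Sigma> *v (B (p n) \<omega> - B (p 0) \<omega>)"
  by (induction n) (simp_all add: simple_ito_integral_def algebra_simps matrix_vector_mult_diff_distrib)

context filtered_brownian
begin

text \<open>
  The form that is compared with the extended-real integrals in the definition of the Ito integral.
\<close>

lemma nn_simple_ito_isometry:
  fixes \<xi> :: "nat \<Rightarrow> 'a \<Rightarrow> real^'m^'d"
  assumes data: "simple_process_data M F t n p \<xi>"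
  shows "(\<integral>\<^sup>+\<omega>. ennreal ((norm (simple_ito_integral B n p \<xi> \<omega>))\<^sup>2) \<partial>M) =
    (\<integral>\<^sup>+\<omega>. ennreal (\<Sum>i<n. (p (Suc i) - p i) * (norm (\<xi> i \<omega>))\<^sup>2) \<partial>M)"
proof -
  have p: "p i < p (Suc i)" if "i < n" for i using data that by (simp add: simple_process_data_def)
  have int: "integrable M (\<lambda>\<omega>. (norm (\<xi> i \<omega>))\<^sup>2)" if i: "i < n" for i
  proof -
    have "0 \<le> p i"
      using partition_mono[of n p 0 i] data that by (auto simp: simple_process_data_def)
    then have [measurable]: "\<xi> i \<in> borel_measurable M"
      using data that by (auto simp: simple_process_data_def intro: measurable_F_imp)
    obtain C where C: "\<And>\<omega>. \<omega> \<in> space M \<Longrightarrow> norm (\<xi> i \<omega>) \<le> C"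
      using data i unfolding simple_process_data_def by blast
    show ?thesis
    proof (rule bounded_integrable)
      show "\<bar>(norm (\<xi> i \<omega>))\<^sup>2\<bar> \<le> C\<^sup>2" if "\<omega> \<in> space M" for \<omega>
        using C[OF that] by (simp add: power_mono)
    qed measurable
  qed
  have "(\<integral>\<^sup>+\<omega>. ennreal ((norm (simple_ito_integral B n p \<xi> \<omega>))\<^sup>2) \<partial>M) =
      ennreal (\<Sum>i<n. (p (Suc i) - p i) * expectation (\<lambda>\<omega>. (norm (\<xi> i \<omega>))\<^sup>2))"
    using simple_ito_isometry[OF data] by (subst nn_integral_eq_integral) auto
  also have "(\<Sum>i<n. (p (Suc i) - p i) * expectation (\<lambda>\<omega>. (norm (\<xi> i \<omega>))\<^sup>2)) =
      expectation (\<lambda>\<omega>. \<Sum>i<n. (p (Suc i) - p i) * (norm (\<xi> i \<omega>))\<^sup>2)"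
    using int by (subst Bochner_Integration.integral_sum) auto
  also have "ennreal \<dots> = (\<integral>\<^sup>+\<omega>. ennreal (\<Sum>i<n. (p (Suc i) - p i) * (norm (\<xi> i \<omega>))\<^sup>2) \<partial>M)"
    using int less_imp_le[OF p]
    by (intro nn_integral_eq_integral[symmetric] Bochner_Integration.integrable_sum AE_I2 sum_nonneg mult_nonneg_nonneg) auto
  finally show ?thesis .
qed

lemma nn_simple_ito_deterministic_le:
  fixes c :: "nat \<Rightarrow> real^'m^'d"
  assumes data: "simple_process_data M F t n p (\<lambda>i _. c i)" and c: "\<And>i. i < n \<Longrightarrow> norm (c i) \<le> e"
  shows "(\<integral>\<^sup>+\<omega>. ennreal ((norm (simple_ito_integral B n p (\<lambda>i _. c i) \<omega>))\<^sup>2) \<partial>M) \<le> ennreal (e\<^sup>2 * t)"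
proof -
  have p: "p i \<le> p (Suc i)" if "i < n" for i using data that by (auto simp: simple_process_data_def intro: less_imp_le)
  have "(\<Sum>i<n. (p (Suc i) - p i) * (norm (c i))\<^sup>2) \<le> (\<Sum>i<n. (p (Suc i) - p i) * e\<^sup>2)"
    using p c by (intro sum_mono mult_left_mono power_mono) auto
  also have "\<dots> = e\<^sup>2 * t"
  proof -
    have "(\<Sum>i<n. p (Suc i) - p i) = t"
      using data by (simp add: sum_lessThan_telescope simple_process_data_def)
    then show ?thesis by (simp only: sum_distrib_right[symmetric]) simp
  qed
  finally show ?thesis
    unfolding nn_simple_ito_isometry[OF data] by (simp add: emeasure_space_1 ennreal_leI)
qed

text \<open>
  For a continuous deterministic integrand the dyadic Riemann sums are integrals of simple processes that
  converge to the integrand uniformly on \<open>(0, t]\<close>. By the isometry they are Cauchy in mean square, and Fatou's lemma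
  turns this into mean-square convergence to their almost sure limit. An Ito integral is thus recognised
  from pathwise convergence.
\<close>

lemma has_ito_integral_deterministicI:
  fixes g :: "real \<Rightarrow> real^'m^'d"
  assumes t: "t \<ge> 0" and g: "continuous_on {0..t} g" and Y: "Y \<in> borel_measurable M"
    and lim: "AE \<omega> in M. (\<lambda>k. \<Sum>i<2 ^ k. g (t / 2 ^ k * real (Suc i)) *v
        (B (t / 2 ^ k * real (Suc i)) \<omega> - B (t / 2 ^ k * real i) \<omega>)) \<longlonglongrightarrow> Y \<omega>"
  shows "has_ito_integral M F B t (\<lambda>s _. g s) Y"
proof -
  have meas1: "(\<lambda>(s, \<omega>). g s) \<in> borel_measurable (restrict_space lborel {0..t} \<Otimes>\<^sub>M M)"
  proof -
    have "g \<in> borel_measurable (restrict_space borel {0..t})"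
      by (rule borel_measurable_continuous_on_restrict[OF g])
    then have "g \<in> borel_measurable (restrict_space lborel {0..t})"
      by (simp add: measurable_cong_sets[OF sets_restrict_space_cong[OF sets_lborel] refl])
    from measurable_compose[OF measurable_fst this] show ?thesis by (simp add: case_prod_beta')
  qed
  show ?thesis
  proof (cases "t = 0")
    \<comment> \<open>The only partition of \<open>[0, 0]\<close> has no cells, so the dyadic grids are not available here.\<close>
    case True
    have "AE \<omega> in M. Y \<omega> = 0"
      using lim by eventually_elim (use True in \<open>auto dest: LIMSEQ_unique\<close>)
    then have Y0: "(\<integral>\<^sup>+\<omega>. ennreal ((norm (simple_ito_integral B 0 (\<lambda>_. 0) (\<lambda>_ _. 0 :: real^'m^'d) \<omega> - Y \<omega>))\<^sup>2) \<partial>M) = (\<integral>\<^sup>+\<omega>. 0 \<partial>M)"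
      by (intro nn_integral_cong_AE) (auto simp: simple_ito_integral_def)
    have g0: "(\<integral>\<^sup>+s\<in>{0..t}. ennreal ((norm (simple_process 0 (\<lambda>_. 0) (\<lambda>_ _. 0 :: real^'m^'d) s \<omega> - g s))\<^sup>2) \<partial>lborel) = 0" for \<omega> :: 'a
      using True by (intro nn_integral_null_set) (simp add: finite_imp_null_set_lborel)
    show ?thesis
    proof (rule has_ito_integralI[where n="\<lambda>_. 0" and p="\<lambda>_ _. 0" and \<xi>="\<lambda>_ _ _. 0"])
      show "simple_process_data M F t 0 (\<lambda>_. 0) (\<lambda>_ _. 0 :: real^'m^'d)"
        using True by (simp add: simple_process_data_def)
      show "(\<lambda>k::nat. \<integral>\<^sup>+\<omega>. (\<integral>\<^sup>+s\<in>{0..t}. ennreal ((norm (simple_process 0 (\<lambda>_. 0) (\<lambda>_ _. 0 :: real^'m^'d) s \<omega> - g s))\<^sup>2) \<partial>lborel) \<partial>M) \<longlonglongrightarrow> 0"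
        unfolding g0 by simp
      show "(\<lambda>k::nat. \<integral>\<^sup>+\<omega>. ennreal ((norm (simple_ito_integral B 0 (\<lambda>_. 0) (\<lambda>_ _. 0 :: real^'m^'d) \<omega> - Y \<omega>))\<^sup>2) \<partial>M) \<longlonglongrightarrow> 0"
        unfolding Y0 by simp
    qed (rule meas1 borel_measurable_const Y)+
  next
    case False
    with t have t: "t > 0" by simp
    define n :: "nat \<Rightarrow> nat" where "n k = 2 ^ k" for k
    define p :: "nat \<Rightarrow> nat \<Rightarrow> real" where "p k i = t / 2 ^ k * real i" for k i
    define c where "c k i = g (p k (Suc i))" for k i
    have p0: "p k 0 = 0" and pn: "p k (n k) = t" and pS: "p k i < p k (Suc i)" for k i
      using t by (simp_all add: p_def n_def divide_strict_right_mono)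
    have data: "simple_process_data M F t (n k) (p k) (\<lambda>i _. d i)" for k and d :: "nat \<Rightarrow> real^'m^'d"
      using p0 pn pS by (auto simp: simple_process_data_def)
    have p_in: "p k i \<in> {0..t}" if "i \<le> n k" for k i
      using partition_mono[of "n k" "p k" 0 i] partition_mono[of "n k" "p k" i "n k"] pS p0 pn that by auto
    have uc: "\<exists>K. \<forall>k\<ge>K. \<forall>i<n k. \<forall>s\<in>{p k i<..p k (Suc i)}. norm (c k i - g s) \<le> e" if "e > 0" for e
    proof -
      have "uniformly_continuous_on {0..t} g"
        by (intro compact_uniformly_continuous g) auto
      then obtain d where "d > 0" and d: "\<And>s s'. s \<in> {0..t} \<Longrightarrow> s' \<in> {0..t} \<Longrightarrow> dist s s' < d \<Longrightarrow> dist (g s) (g s') < e"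
        using \<open>e > 0\<close> unfolding uniformly_continuous_on_def by metis
      have "(\<lambda>k. t / 2 ^ k) \<longlonglongrightarrow> 0" by real_asymp
      then have "\<forall>\<^sub>F k in sequentially. t / 2 ^ k < d" by (rule order_tendstoD) fact
      then obtain K where K: "\<And>k. k \<ge> K \<Longrightarrow> t / 2 ^ k < d" by (auto simp: eventually_sequentially)
      have "norm (c k i - g s) \<le> e" if "k \<ge> K" "i < n k" "s \<in> {p k i<..p k (Suc i)}" for k i s
      proof -
        have "p k (Suc i) - p k i = t / 2 ^ k" by (simp add: p_def add_divide_distrib algebra_simps)
        then have "dist (p k (Suc i)) s < d" using that(3) K[OF that(1)] by (auto simp: dist_real_def)
        then have "dist (g (p k (Suc i))) (g s) < e"
          using p_in[of i k] p_in[of "Suc i" k] that by (intro d) auto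
        then show ?thesis by (simp add: c_def dist_norm)
      qed
      then show ?thesis by blast
    qed
    have conv1: "(\<lambda>k. \<integral>\<^sup>+\<omega>. (\<integral>\<^sup>+s\<in>{0..t}.
             ennreal ((norm (simple_process (n k) (p k) (\<lambda>i _. c k i) s \<omega> - g s))\<^sup>2) \<partial>lborel) \<partial>M) \<longlonglongrightarrow> 0"
    proof (rule tendsto_ennreal_zeroI)
      fix e :: real assume "e > 0"
      define e' where "e' = sqrt (e / t)"
      have e': "e' > 0" "e'\<^sup>2 * t = e" using \<open>e > 0\<close> t by (simp_all add: e'_def)
      obtain K where K: "\<And>k i s. k \<ge> K \<Longrightarrow> i < n k \<Longrightarrow> s \<in> {p k i<..p k (Suc i)} \<Longrightarrow> norm (c k i - g s) \<le> e'"
        using uc[OF e'(1)] by blast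
      have "(\<integral>\<^sup>+\<omega>. (\<integral>\<^sup>+s\<in>{0..t}. ennreal ((norm (simple_process (n k) (p k) (\<lambda>i _. c k i) s \<omega> - g s))\<^sup>2) \<partial>lborel) \<partial>M) \<le> ennreal e"
        if "k \<ge> K" for k
      proof -
        have "(\<integral>\<^sup>+s\<in>{0..t}. ennreal ((norm (simple_process (n k) (p k) (\<lambda>i _. c k i) s \<omega> - g s))\<^sup>2) \<partial>lborel) \<le> ennreal e" for \<omega> :: 'a
        proof -
          have "(\<integral>\<^sup>+s\<in>{0..t}. ennreal ((norm (simple_process (n k) (p k) (\<lambda>i _. c k i) s \<omega> - g s))\<^sup>2) \<partial>lborel)
            \<le> (\<integral>\<^sup>+s. ennreal (e'\<^sup>2) * indicator {0..t} s \<partial>lborel)"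
          proof (rule nn_integral_mono_AE)
            \<comment> \<open>The cells are open on the left, so the point \<open>s = 0\<close> lies in none of them.\<close>
            show "AE s in lborel. ennreal ((norm (simple_process (n k) (p k) (\<lambda>i _. c k i) s \<omega> - g s))\<^sup>2) * indicator {0..t} s
              \<le> ennreal (e'\<^sup>2) * indicator {0..t} s"
              using AE_lborel_singleton[of 0]
            proof eventually_elim
              case (elim s)
              show ?case
              proof (cases "s \<in> {0..t}")
                case True
                then obtain i where i: "i < n k" "s \<in> {p k i<..p k (Suc i)}"
                  using elim by (elim partition_cell_exists[of "p k" s "n k", rotated 2]) (auto simp: p0 pn)
                have "simple_process (n k) (p k) (\<lambda>i _. c k i) s \<omega> = c k i"
                  by (rule simple_process_cell[OF pS i])
                then have "norm (simple_process (n k) (p k) (\<lambda>i _. c k i) s \<omega> - g s) \<le> e'"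
                  using K[OF that i] by simp
                then show ?thesis using True by (simp add: ennreal_leI power_mono)
              qed simp
            qed
          qed
          also have "\<dots> = ennreal e"
            using t e' by (simp add: nn_integral_cmult_indicator ennreal_mult''[symmetric])
          finally show ?thesis .
        qed
        then have "(\<integral>\<^sup>+\<omega>. (\<integral>\<^sup>+s\<in>{0..t}. ennreal ((norm (simple_process (n k) (p k) (\<lambda>i _. c k i) s \<omega> - g s))\<^sup>2) \<partial>lborel) \<partial>M)
          \<le> (\<integral>\<^sup>+\<omega>. ennreal e \<partial>M)" by (intro nn_integral_mono)
        then show ?thesis by (simp add: emeasure_space_1)
      qed
      then show "\<forall>\<^sub>F k in sequentially. (\<integral>\<^sup>+\<omega>. (\<integral>\<^sup>+s\<in>{0..t}. ennreal ((norm (simple_process (n k) (p k) (\<lambda>i _. c k i) s \<omega> - g s))\<^sup>2) \<partial>lborel) \<partial>M) \<le> ennreal e"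
        by (auto simp: eventually_sequentially)
    qed
    let ?I = "\<lambda>k \<omega>. simple_ito_integral B (n k) (p k) (\<lambda>i _. c k i) \<omega>"
    have I_meas: "?I k \<in> borel_measurable M" for k
      by (rule measurable_F_imp[OF less_imp_le[OF t] simple_ito_isometry(1)[OF data]])
    have lim': "AE \<omega> in M. (\<lambda>k. ?I k \<omega>) \<longlonglongrightarrow> Y \<omega>"
      using lim by (simp add: simple_ito_integral_def c_def p_def n_def)
    have conv2: "(\<lambda>k. \<integral>\<^sup>+\<omega>. ennreal ((norm (?I k \<omega> - Y \<omega>))\<^sup>2) \<partial>M) \<longlonglongrightarrow> 0"
    proof (rule tendsto_ennreal_zeroI)
      fix e :: real assume "e > 0"
      define e' where "e' = sqrt (e / t)"
      have e': "e' > 0" "e'\<^sup>2 * t = e" using \<open>e > 0\<close> t by (simp_all add: e'_def)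
      obtain K where K: "\<And>k i s. k \<ge> K \<Longrightarrow> i < n k \<Longrightarrow> s \<in> {p k i<..p k (Suc i)} \<Longrightarrow> norm (c k i - g s) \<le> e'"
        using uc[OF e'(1)] by blast
      have cauchy: "(\<integral>\<^sup>+\<omega>. ennreal ((norm (?I k \<omega> - ?I l \<omega>))\<^sup>2) \<partial>M) \<le> ennreal e" if "k \<ge> K" "l \<ge> k" for k l
      proof -
        \<comment> \<open>Each cell of level \<open>k\<close> contains \<open>q\<close> cells of level \<open>l\<close>, and the fine cell \<open>j\<close> lies in the coarse cell \<open>j div q\<close>.\<close>
        define q :: nat where "q = 2 ^ (l - k)"
        have q: "q > 0" "n k * q = n l" "t / 2 ^ k / real q = t / 2 ^ l"
          using that(2) by (simp_all add: q_def n_def power_add[symmetric] divide_divide_eq_left)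
        have coarse: "?I k \<omega> = simple_ito_integral B (n l) (p l) (\<lambda>j _. c k (j div q)) \<omega>" for \<omega>
          using simple_ito_integral_refine[OF q(1), of B "n k" "t / 2 ^ k" "c k" \<omega>]
          unfolding q(2,3) p_def[abs_def] .
        have close: "norm (c k (j div q) - c l j) \<le> e'" if "j < n l" for j
        proof -
          have 1: "j div q < n k" using that q by (metis div_less_iff_less_mult)
          have "q * (j div q) \<le> j" by simp
          then have "q * (j div q) < Suc j" by linarith
          have "j < q * Suc (j div q)" using q(1) by (simp add: dividend_less_times_div)
          then have "Suc j \<le> q * Suc (j div q)" by simp
          have eq: "p k i = p l (q * i)" for i
            using q by (simp add: p_def q(3)[symmetric])
          have "p l (Suc j) \<in> {p k (j div q)<..p k (Suc (j div q))}"
          proof -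
            have "strict_mono (p l)" using pS by (simp add: strict_mono_Suc_iff)
            then show ?thesis
              unfolding eq using \<open>q * (j div q) < Suc j\<close> \<open>Suc j \<le> q * Suc (j div q)\<close>
              by (simp only: greaterThanAtMost_iff strict_mono_less strict_mono_less_eq)
          qed
          from K[OF \<open>k \<ge> K\<close> 1 this] show ?thesis by (simp add: c_def[of l])
        qed
        have "(\<integral>\<^sup>+\<omega>. ennreal ((norm (?I k \<omega> - ?I l \<omega>))\<^sup>2) \<partial>M) =
          (\<integral>\<^sup>+\<omega>. ennreal ((norm (simple_ito_integral B (n l) (p l) (\<lambda>j _. c k (j div q) - c l j) \<omega>))\<^sup>2) \<partial>M)"
          by (simp add: coarse simple_ito_integral_diff)
        also have "\<dots> \<le> ennreal (e'\<^sup>2 * t)"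
          by (rule nn_simple_ito_deterministic_le[OF data close])
        finally show ?thesis by (simp add: e')
      qed
      have "(\<integral>\<^sup>+\<omega>. ennreal ((norm (?I k \<omega> - Y \<omega>))\<^sup>2) \<partial>M) \<le> ennreal e" if "k \<ge> K" for k
      proof -
        have "(\<integral>\<^sup>+\<omega>. ennreal ((norm (?I k \<omega> - Y \<omega>))\<^sup>2) \<partial>M) =
          (\<integral>\<^sup>+\<omega>. liminf (\<lambda>l. ennreal ((norm (?I k \<omega> - ?I l \<omega>))\<^sup>2)) \<partial>M)"
        proof (rule nn_integral_cong_AE)
          show "AE \<omega> in M. ennreal ((norm (?I k \<omega> - Y \<omega>))\<^sup>2) = liminf (\<lambda>l. ennreal ((norm (?I k \<omega> - ?I l \<omega>))\<^sup>2))"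
            using lim'
          proof eventually_elim
            case (elim \<omega>)
            have "(\<lambda>l. ennreal ((norm (?I k \<omega> - ?I l \<omega>))\<^sup>2)) \<longlonglongrightarrow> ennreal ((norm (?I k \<omega> - Y \<omega>))\<^sup>2)"
              by (intro tendsto_intros elim)
            then show ?case by (rule lim_imp_Liminf[OF sequentially_bot, symmetric])
          qed
        qed
        also have "\<dots> \<le> liminf (\<lambda>l. \<integral>\<^sup>+\<omega>. ennreal ((norm (?I k \<omega> - ?I l \<omega>))\<^sup>2) \<partial>M)"
          using I_meas by (intro nn_integral_liminf) measurable
        also have "\<dots> \<le> limsup (\<lambda>l. \<integral>\<^sup>+\<omega>. ennreal ((norm (?I k \<omega> - ?I l \<omega>))\<^sup>2) \<partial>M)"
          by (intro Liminf_le_Limsup) simp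
        also have "\<dots> \<le> ennreal e"
          using cauchy[OF that] by (intro Limsup_bounded) (auto simp: eventually_sequentially)
        finally show ?thesis .
      qed
      then show "\<forall>\<^sub>F k in sequentially. (\<integral>\<^sup>+\<omega>. ennreal ((norm (?I k \<omega> - Y \<omega>))\<^sup>2) \<partial>M) \<le> ennreal e"
        by (auto simp: eventually_sequentially)
    qed
    show ?thesis
      by (rule has_ito_integralI[OF meas1 borel_measurable_const Y data conv1 conv2])
  qed
qed

lemma has_ito_integral_constI:
  fixes \<Sigma> :: "real^'m^'d"
  assumes "t \<ge> 0"
  shows "has_ito_integral M F B t (\<lambda>_ _. \<Sigma>) (\<lambda>\<omega>. \<Sigma> *v (B t \<omega> - B 0 \<omega>))"
proof (rule has_ito_integral_deterministicI[OF assms])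
  show "(\<lambda>\<omega>. \<Sigma> *v (B t \<omega> - B 0 \<omega>)) \<in> borel_measurable M"
    using assms by (intro matrix_vector_measurable borel_measurable_diff B_measurable) auto
  have "(\<Sum>i<2 ^ k. \<Sigma> *v (B (t / 2 ^ k * real (Suc i)) \<omega> - B (t / 2 ^ k * real i) \<omega>)) = \<Sigma> *v (B t \<omega> - B 0 \<omega>)" for k :: nat and \<omega>
    using simple_ito_integral_const[of B "2 ^ k" "\<lambda>i. t / 2 ^ k * real i" \<Sigma> \<omega>]
    unfolding simple_ito_integral_def by simp
  then show "AE \<omega> in M. (\<lambda>k. \<Sum>i<2 ^ k. \<Sigma> *v (B (t / 2 ^ k * real (Suc i)) \<omega> - B (t / 2 ^ k * real i) \<omega>)) \<longlonglongrightarrow> \<Sigma> *v (B t \<omega> - B 0 \<omega>)"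
    by simp
qed simp

text \<open>
  The time integral of a simple process, computed cell by cell. Subtracting a constant from a simple
  process does not change its partition.
\<close>

lemma simple_process_energy_le:
  fixes \<xi> :: "nat \<Rightarrow> 'a \<Rightarrow> real^'m^'d"
  assumes data: "simple_process_data M F t n p \<xi>"
  shows "ennreal (\<Sum>i<n. (p (Suc i) - p i) * (norm (\<xi> i \<omega> - \<Sigma>))\<^sup>2) \<le>
    (\<integral>\<^sup>+s\<in>{0..t}. ennreal ((norm (simple_process n p \<xi> s \<omega> - \<Sigma>))\<^sup>2) \<partial>lborel)"
proof -
  have p: "p i < p (Suc i)" if "i < n" for i using data that by (simp add: simple_process_data_def)
  let ?a = "\<lambda>i. ennreal ((norm (\<xi> i \<omega> - \<Sigma>))\<^sup>2)"
  have "ennreal (\<Sum>i<n. (p (Suc i) - p i) * (norm (\<xi> i \<omega> - \<Sigma>))\<^sup>2) = (\<Sum>i<n. ennreal (p (Suc i) - p i) * ?a i)"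
    using less_imp_le[OF p] by (subst sum_ennreal[symmetric]) (auto intro!: sum.cong ennreal_mult mult_nonneg_nonneg)
  also have "\<dots> = (\<Sum>i<n. \<integral>\<^sup>+s. ?a i * indicator {p i<..p (Suc i)} s \<partial>lborel)"
    using less_imp_le[OF p] by (intro sum.cong) (simp_all add: nn_integral_cmult_indicator, simp add: mult.commute)
  also have "\<dots> = (\<integral>\<^sup>+s. (\<Sum>i<n. ?a i * indicator {p i<..p (Suc i)} s) \<partial>lborel)"
    by (rule nn_integral_sum[symmetric]) simp
  also have "\<dots> \<le> (\<integral>\<^sup>+s\<in>{0..t}. ennreal ((norm (simple_process n p \<xi> s \<omega> - \<Sigma>))\<^sup>2) \<partial>lborel)"
  proof (rule nn_integral_mono)
    fix s
    show "(\<Sum>i<n. ?a i * indicator {p i<..p (Suc i)} s) \<le> ennreal ((norm (simple_process n p \<xi> s \<omega> - \<Sigma>))\<^sup>2) * indicator {0..t} s"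
    proof (cases "\<exists>i<n. s \<in> {p i<..p (Suc i)}")
      case True
      then obtain i where i: "i < n" "s \<in> {p i<..p (Suc i)}" by blast
      have "(\<Sum>j<n. ?a j * indicator {p j<..p (Suc j)} s) = (\<Sum>j<n. if s \<in> {p j<..p (Suc j)} then ?a j else 0)"
        by (intro sum.cong) (auto simp: indicator_def)
      also have "\<dots> = ?a i" by (rule sum_partition_cell[OF p i])
      also have "\<dots> = ennreal ((norm (simple_process n p \<xi> s \<omega> - \<Sigma>))\<^sup>2)"
        by (simp add: simple_process_cell[OF p i])
      moreover have "s \<in> {0..t}"
        using partition_mono[of n p 0 i] partition_mono[of n p "Suc i" n] p i data
        by (auto simp: simple_process_data_def)
      ultimately show ?thesis by simp
    next
      case False
      then show ?thesis by (subst sum.neutral) (auto simp: indicator_def)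
    qed
  qed
  finally show ?thesis .
qed

text \<open>
  The integrals of arbitrary approximating simple processes converge to \<open>Y\<close>. Subtracting \<open>\<Sigma>\<close> from their
  coefficients gives simple processes whose energy tends to 0, and by the isometry their integrals
  converge to \<open>\<Sigma> (B t - B 0)\<close> as well.
\<close>

lemma has_ito_integral_const_unique:
  fixes \<Sigma> :: "real^'m^'d"
  assumes "t \<ge> 0" and ito: "has_ito_integral M F B t (\<lambda>_ _. \<Sigma>) Y"
  shows "AE \<omega> in M. Y \<omega> = \<Sigma> *v (B t \<omega> - B 0 \<omega>)"
proof -
  let ?Z = "\<lambda>\<omega>. \<Sigma> *v (B t \<omega> - B 0 \<omega>)"
  obtain n p \<xi> where data: "\<And>k. simple_process_data M F t (n k) (p k) (\<xi> k)"
    and lim1: "(\<lambda>k. \<integral>\<^sup>+\<omega>. (\<integral>\<^sup>+s\<in>{0..t}. ennreal ((norm (simple_process (n k) (p k) (\<xi> k) s \<omega> - \<Sigma>))\<^sup>2) \<partial>lborel) \<partial>M) \<longlonglongrightarrow> 0"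
    and lim2: "(\<lambda>k. \<integral>\<^sup>+\<omega>. ennreal ((norm (simple_ito_integral B (n k) (p k) (\<xi> k) \<omega> - Y \<omega>))\<^sup>2) \<partial>M) \<longlonglongrightarrow> 0"
    using ito unfolding has_ito_integral_def by blast
  have Y: "Y \<in> borel_measurable M" using ito by (simp add: has_ito_integral_def)
  have Z: "?Z \<in> borel_measurable M"
    using assms(1) by (intro matrix_vector_measurable borel_measurable_diff B_measurable) auto
  let ?Q = "\<lambda>k \<omega>. simple_ito_integral B (n k) (p k) (\<xi> k) \<omega>"
  have Q: "?Q k \<in> borel_measurable M" for k
    by (rule measurable_F_imp[OF assms(1) simple_ito_isometry(1)[OF data]])
  note [measurable] = Y Z Q
  have QZ: "(\<integral>\<^sup>+\<omega>. ennreal ((norm (?Q k \<omega> - ?Z \<omega>))\<^sup>2) \<partial>M) \<le>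
     (\<integral>\<^sup>+\<omega>. (\<integral>\<^sup>+s\<in>{0..t}. ennreal ((norm (simple_process (n k) (p k) (\<xi> k) s \<omega> - \<Sigma>))\<^sup>2) \<partial>lborel) \<partial>M)" for k
  proof -
    have data': "simple_process_data M F t (n k) (p k) (\<lambda>i \<omega>. \<xi> k i \<omega> - \<Sigma>)"
      unfolding simple_process_data_def
    proof (intro conjI allI impI)
      fix i assume i: "i < n k"
      then show "(\<lambda>\<omega>. \<xi> k i \<omega> - \<Sigma>) \<in> borel_measurable (F (p k i))"
        using data[of k] by (auto simp: simple_process_data_def)
      obtain C where "\<And>\<omega>. \<omega> \<in> space M \<Longrightarrow> norm (\<xi> k i \<omega>) \<le> C"
        using data[of k] i unfolding simple_process_data_def by blast
      then show "\<exists>C. \<forall>\<omega>\<in>space M. norm (\<xi> k i \<omega> - \<Sigma>) \<le> C"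
        by (intro exI[of _ "C + norm \<Sigma>"] ballI order_trans[OF norm_triangle_ineq4]) simp
    qed (use data[of k] in \<open>auto simp: simple_process_data_def\<close>)
    have "?Q k \<omega> - ?Z \<omega> = simple_ito_integral B (n k) (p k) (\<lambda>i \<omega>. \<xi> k i \<omega> - \<Sigma>) \<omega>" for \<omega>
      using simple_ito_integral_const[of B "n k" "p k" \<Sigma> \<omega>] simple_ito_integral_diff[of B "n k" "p k" "\<xi> k" \<omega> "\<lambda>_ _. \<Sigma>"] data[of k]
      by (simp add: simple_process_data_def)
    then have "(\<integral>\<^sup>+\<omega>. ennreal ((norm (?Q k \<omega> - ?Z \<omega>))\<^sup>2) \<partial>M) =
      (\<integral>\<^sup>+\<omega>. ennreal (\<Sum>i<n k. (p k (Suc i) - p k i) * (norm (\<xi> k i \<omega> - \<Sigma>))\<^sup>2) \<partial>M)"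
      by (simp add: nn_simple_ito_isometry[OF data'])
    also have "\<dots> \<le> (\<integral>\<^sup>+\<omega>. (\<integral>\<^sup>+s\<in>{0..t}. ennreal ((norm (simple_process (n k) (p k) (\<xi> k) s \<omega> - \<Sigma>))\<^sup>2) \<partial>lborel) \<partial>M)"
      by (intro nn_integral_mono simple_process_energy_le data)
    finally show ?thesis .
  qed
  have lim3: "(\<lambda>k. \<integral>\<^sup>+\<omega>. ennreal ((norm (?Q k \<omega> - ?Z \<omega>))\<^sup>2) \<partial>M) \<longlonglongrightarrow> 0"
    by (rule tendsto_sandwich[OF _ _ tendsto_const lim1]) (auto simp: QZ)
  have "(\<integral>\<^sup>+\<omega>. ennreal ((norm (Y \<omega> - ?Z \<omega>))\<^sup>2) \<partial>M) \<le>
     2 * (\<integral>\<^sup>+\<omega>. ennreal ((norm (?Q k \<omega> - Y \<omega>))\<^sup>2) \<partial>M) + 2 * (\<integral>\<^sup>+\<omega>. ennreal ((norm (?Q k \<omega> - ?Z \<omega>))\<^sup>2) \<partial>M)" for k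
  proof -
    have "ennreal ((norm (Y \<omega> - ?Z \<omega>))\<^sup>2) \<le> 2 * ennreal ((norm (?Q k \<omega> - Y \<omega>))\<^sup>2) + 2 * ennreal ((norm (?Q k \<omega> - ?Z \<omega>))\<^sup>2)" for \<omega>
    proof -
      have "norm (Y \<omega> - ?Z \<omega>) \<le> norm (?Q k \<omega> - Y \<omega>) + norm (?Q k \<omega> - ?Z \<omega>)"
        using norm_triangle_ineq4[of "?Q k \<omega> - ?Z \<omega>" "?Q k \<omega> - Y \<omega>"] by simp
      then have "(norm (Y \<omega> - ?Z \<omega>))\<^sup>2 \<le> (norm (?Q k \<omega> - Y \<omega>) + norm (?Q k \<omega> - ?Z \<omega>))\<^sup>2"
        by (intro power_mono) auto
      also have "\<dots> \<le> 2 * (norm (?Q k \<omega> - Y \<omega>))\<^sup>2 + 2 * (norm (?Q k \<omega> - ?Z \<omega>))\<^sup>2"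
        using sum_squares_bound[of "norm (?Q k \<omega> - Y \<omega>)" "norm (?Q k \<omega> - ?Z \<omega>)"] by (simp add: power2_sum)
      finally have "ennreal ((norm (Y \<omega> - ?Z \<omega>))\<^sup>2) \<le> ennreal (2 * (norm (?Q k \<omega> - Y \<omega>))\<^sup>2 + 2 * (norm (?Q k \<omega> - ?Z \<omega>))\<^sup>2)"
        by (rule ennreal_leI)
      then show ?thesis by (simp add: ennreal_plus ennreal_mult)
    qed
    then have "(\<integral>\<^sup>+\<omega>. ennreal ((norm (Y \<omega> - ?Z \<omega>))\<^sup>2) \<partial>M) \<le>
      (\<integral>\<^sup>+\<omega>. 2 * ennreal ((norm (?Q k \<omega> - Y \<omega>))\<^sup>2) + 2 * ennreal ((norm (?Q k \<omega> - ?Z \<omega>))\<^sup>2) \<partial>M)"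
      by (intro nn_integral_mono)
    then show ?thesis by (simp add: nn_integral_add nn_integral_cmult)
  qed
  moreover have "(\<lambda>k. 2 * (\<integral>\<^sup>+\<omega>. ennreal ((norm (?Q k \<omega> - Y \<omega>))\<^sup>2) \<partial>M) + 2 * (\<integral>\<^sup>+\<omega>. ennreal ((norm (?Q k \<omega> - ?Z \<omega>))\<^sup>2) \<partial>M)) \<longlonglongrightarrow> 2 * 0 + 2 * 0"
    by (intro tendsto_add tendsto_mult_ennreal tendsto_const lim2 lim3) auto
  ultimately have "(\<integral>\<^sup>+\<omega>. ennreal ((norm (Y \<omega> - ?Z \<omega>))\<^sup>2) \<partial>M) \<le> 2 * 0 + 2 * 0"
    by (intro LIMSEQ_le_const) auto
  then have "(\<integral>\<^sup>+\<omega>. ennreal ((norm (Y \<omega> - ?Z \<omega>))\<^sup>2) \<partial>M) = 0" by simp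
  then have "AE \<omega> in M. ennreal ((norm (Y \<omega> - ?Z \<omega>))\<^sup>2) = 0"
    by (subst (asm) nn_integral_0_iff_AE) auto
  then show ?thesis by eventually_elim simp
qed

end

section \<open>Paths with a prescribed initial function\<close>

context neutral_kernel
begin

text \<open>
  The common form of the integrated deterministic equation (\<open>f = 0\<close>) and of the stochastic equation along
  one path (\<open>f\<close> the Brownian forcing), where \<open>c\<close> is the initial value of the neutral expression.
\<close>

definition neutral_path :: "real^'d \<Rightarrow> (real \<Rightarrow> real^'d) \<Rightarrow> (real \<Rightarrow> real^'d) \<Rightarrow> bool" where
  "neutral_path c f X \<longleftrightarrow> continuous_on {-\<tau>..} X \<and>
     (\<forall>t\<ge>0. X t - D X t = c + (LINT u:{0..t}|lborel. L X u) + f t)"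

text \<open>
  Paths are arbitrary before \<open>-\<tau>\<close>. Cutting them off there gives a function with the regularity of
  \<^const>\<open>history\<close> and does not change any segment at a time \<open>t \<ge> 0\<close>.
\<close>

definition truncate :: "(real \<Rightarrow> real^'d) \<Rightarrow> real \<Rightarrow> real^'d" where
  "truncate X t = (if t < -\<tau> then 0 else X t)"

lemma history_truncate:
  assumes "continuous_on {-\<tau>..} X"
  shows "history (truncate X)"
proof (rule history_continuous_on_after)
  show "continuous_on {-\<tau>..} (truncate X)"
    using assms by (rule continuous_on_eq) (simp add: truncate_def)
qed (simp add: truncate_def)

lemma delay_functional_truncate:
  assumes "t \<ge> 0"
  shows "delay_functional \<tau> \<kappa> (segment (truncate X) t) = delay_functional \<tau> \<kappa> (segment X t)"
  using assms by (intro delay_functional_cong) (auto simp: truncate_def segment_def)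

lemma set_integral_truncate: "(LINT u:{0..t}|lborel. L (truncate X) u) = (LINT u:{0..t}|lborel. L X u)"
  unfolding set_lebesgue_integral_def
  by (intro Bochner_Integration.integral_cong refl) (auto simp: indicator_def delay_functional_truncate)

lemma set_integrable_L:
  assumes "continuous_on {-\<tau>..} X"
  shows "set_integrable lborel {0..t} (L X)"
proof -
  have "set_integrable lborel {0..t} (L (truncate X))"
    by (intro history_set_integrable history_delay_functional nu history_truncate assms)
  then show ?thesis
    unfolding set_integrable_def
    by (rule Bochner_Integration.integrable_cong[THEN iffD1, OF refl, rotated]) (auto simp: indicator_def delay_functional_truncate)
qed

lemma neutral_path_truncate:
  assumes "neutral_path c f X" "t \<ge> 0"
  shows "truncate X t = D (truncate X) t + (LINT u:{0..t}|lborel. L (truncate X) u) + (c + f t)"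
proof -
  have "X t - D X t = c + (LINT u:{0..t}|lborel. L X u) + f t"
    using assms unfolding neutral_path_def by blast
  moreover have "truncate X t = X t" using assms(2) tau_nonneg by (simp add: truncate_def)
  ultimately show ?thesis
    using assms(2) by (simp add: delay_functional_truncate set_integral_truncate algebra_simps)
qed

text \<open>
  Linearity: the common initial function and the constant \<open>c\<close> cancel.
\<close>

lemma forced_neutral_path_diff:
  assumes X: "neutral_path c f X" and x: "neutral_path c g x" and eq: "\<And>t. t \<in> {-\<tau>..0} \<Longrightarrow> X t = x t"
  shows "forced (\<lambda>t. f t - g t) (\<lambda>t. if t < 0 then 0 else X t - x t)"
proof -
  have h: "history (truncate X)" "history (truncate x)"
    using X x by (simp_all add: neutral_path_def history_truncate)
  note adm = admissible_segment[OF h(1), of \<tau>] admissible_segment[OF h(2), of \<tau>]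
  have Y: "(\<lambda>t. if t < 0 then 0 else X t - x t) = (\<lambda>t. truncate X t - truncate x t)"
    using eq tau_nonneg by (auto simp: truncate_def fun_eq_iff)
  show ?thesis
    unfolding Y forced_solution_def
  proof (intro conjI allI impI)
    show "history (\<lambda>t. truncate X t - truncate x t)" by (intro history_diff h)
    show "truncate X t - truncate x t = 0" if "t < 0" for t
      using that eq by (simp add: truncate_def)
    fix t :: real assume "t \<ge> 0"
    have "(LINT u:{0..t}|lborel. L (truncate X) u - L (truncate x) u) =
      (LINT u:{0..t}|lborel. L (truncate X) u) - (LINT u:{0..t}|lborel. L (truncate x) u)"
      by (intro set_integral_diff history_set_integrable history_delay_functional nu h)
    then show "truncate X t - truncate x t = D (\<lambda>t. truncate X t - truncate x t) t +
        (LINT u:{0..t}|lborel. L (\<lambda>t. truncate X t - truncate x t) u) + (f t - g t)"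
      using neutral_path_truncate[OF X \<open>t \<ge> 0\<close>] neutral_path_truncate[OF x \<open>t \<ge> 0\<close>]
      unfolding segment_diff delay_functional_diff[OF mu adm] delay_functional_diff[OF nu adm]
      by simp
  qed
qed

lemma neutral_path_add_forced:
  assumes x: "neutral_path c g x" and Y: "forced f Y" "continuous_on {0..} Y" and f0: "f 0 = 0"
  shows "neutral_path c (\<lambda>t. g t + f t) (\<lambda>t. x t + Y t)"
  unfolding neutral_path_def
proof (intro conjI allI impI)
  have cx: "continuous_on {-\<tau>..} x" using x by (simp add: neutral_path_def)
  have "continuous_on ({-\<tau>..0} \<union> {0..}) Y"
  proof (intro continuous_on_closed_Un Y)
    have "Y t = 0" if "t \<le> 0" for t
      using that forced_initial[OF Y(1)] forcedD(2)[OF Y(1), of t] f0 by (cases "t = 0") auto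
    then show "continuous_on {-\<tau>..0} Y"
      by (intro continuous_on_eq[OF continuous_on_const[of _ 0]]) auto
  qed auto
  moreover have "{-\<tau>..0} \<union> {0..} = {-\<tau>..}" using tau_nonneg by auto
  ultimately show "continuous_on {-\<tau>..} (\<lambda>t. x t + Y t)"
    using cx by (intro continuous_on_add) auto
  have h: "history (truncate x)" "history Y"
    using forcedD(1)[OF Y(1)] cx by (simp_all add: history_truncate)
  note adm = admissible_segment[OF h(1), of \<tau>] admissible_segment[OF h(2), of \<tau>]
  have sum: "delay_functional \<tau> \<kappa> (segment (\<lambda>t. x t + Y t) t) =
      delay_functional \<tau> \<kappa> (segment (truncate x) t) + delay_functional \<tau> \<kappa> (segment Y t)"
    if "matrix_measure \<tau> \<kappa>" "t \<ge> 0" for \<kappa> t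
    unfolding delay_functional_add[OF that(1) adm, symmetric]
    using that(2) by (intro delay_functional_cong) (auto simp: segment_def truncate_def)
  fix t :: real assume t: "t \<ge> 0"
  have "(LINT u:{0..t}|lborel. L (\<lambda>t. x t + Y t) u) = (LINT u:{0..t}|lborel. L (truncate x) u + L Y u)"
    unfolding set_lebesgue_integral_def
    by (intro Bochner_Integration.integral_cong refl) (auto simp: indicator_def sum[OF nu])
  also have "\<dots> = (LINT u:{0..t}|lborel. L (truncate x) u) + (LINT u:{0..t}|lborel. L Y u)"
    by (intro set_integral_add history_set_integrable history_delay_functional nu h)
  finally have int: "(LINT u:{0..t}|lborel. L (\<lambda>t. x t + Y t) u) =
    (LINT u:{0..t}|lborel. L (truncate x) u) + (LINT u:{0..t}|lborel. L Y u)" .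
  have "truncate x t = x t" using t tau_nonneg by (simp add: truncate_def)
  then have xt: "x t = D (truncate x) t + (LINT u:{0..t}|lborel. L (truncate x) u) + (c + g t)"
    using neutral_path_truncate[OF x t] by simp
  show "x t + Y t - D (\<lambda>t. x t + Y t) t = c + (LINT u:{0..t}|lborel. L (\<lambda>t. x t + Y t) u) + (g t + f t)"
    unfolding sum[OF mu t] int by (subst xt, subst forcedD(3)[OF Y(1) t]) (simp add: algebra_simps)
qed

lemma continuous_on_delay_functional:
  assumes \<kappa>: "matrix_measure \<tau> \<kappa>" and X: "continuous_on {-\<tau>..} X"
  shows "continuous_on {0..} (\<lambda>t. delay_functional \<tau> \<kappa> (segment X t))"
proof (rule continuous_on_atLeastI)
  fix T
  show "continuous_on {0..T} (\<lambda>t. delay_functional \<tau> \<kappa> (segment X t))"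
    unfolding continuous_on_iff
  proof (intro ballI allI impI)
    fix t and e :: real assume t: "t \<in> {0..T}" and "e > 0"
    let ?K = "delay_majorant \<tau> \<kappa> (\<lambda>_. 1)"
    have K: "?K \<ge> 0" by (rule delay_majorant_nonneg) simp
    define e' where "e' = e / (2 * (?K + 1))"
    have e': "e' > 0" "e' * ?K < e"
      using \<open>e > 0\<close> K unfolding e'_def by (simp, intro scaled_tolerance_less)
    have "uniformly_continuous_on {-\<tau>..T} X"
      by (intro compact_uniformly_continuous continuous_on_subset[OF X]) auto
    then obtain d where "d > 0" and d: "\<And>s s'. s \<in> {-\<tau>..T} \<Longrightarrow> s' \<in> {-\<tau>..T} \<Longrightarrow> dist s' s < d \<Longrightarrow> dist (X s') (X s) < e'"
      using \<open>e' > 0\<close> unfolding uniformly_continuous_on_def by metis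
    have "dist (delay_functional \<tau> \<kappa> (segment X t')) (delay_functional \<tau> \<kappa> (segment X t)) < e"
      if t': "t' \<in> {0..T}" "dist t' t < d" for t'
    proof -
      have adm: "admissible \<tau> (segment X u)" if "u \<ge> 0" for u
        unfolding segment_def using that
        by (intro admissible_continuous_on continuous_on_compose2[OF X] continuous_intros) auto
      have "norm (delay_functional \<tau> \<kappa> (\<lambda>s. segment X t' s - segment X t s)) \<le> delay_majorant \<tau> \<kappa> (\<lambda>_. e')"
      proof (rule norm_delay_functional_le_majorant[OF \<kappa> admissible_diff[OF adm adm] admissible_const])
        fix s assume "s \<in> {-\<tau>..0}"
        then have "dist (X (t' + s)) (X (t + s)) < e'"
          using t t' by (intro d) (auto simp: dist_real_def)
        then show "norm (segment X t' s - segment X t s) \<le> e'" by (simp add: segment_def dist_norm)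
      qed (use t t' in auto)
      also have "\<dots> < e" using e'(2) delay_majorant_cmult[of \<tau> \<kappa> e' "\<lambda>_. 1"] by simp
      finally show ?thesis
        using t t' by (simp add: delay_functional_diff[OF \<kappa> adm adm] dist_norm)
    qed
    then show "\<exists>d>0. \<forall>x'\<in>{0..T}. dist x' t < d \<longrightarrow> dist (delay_functional \<tau> \<kappa> (segment X x')) (delay_functional \<tau> \<kappa> (segment X t)) < e"
      using \<open>d > 0\<close> by blast
  qed
qed

text \<open>
  This expression recovers the forcing from a path, so the forcing is continuous along every continuous
  path.
\<close>

lemma continuous_on_neutral_defect:
  assumes X: "continuous_on {-\<tau>..} X"
  shows "continuous_on {0..} (\<lambda>t. X t - D X t - (LINT u:{0..t}|lborel. L X u))"
proof (intro continuous_on_diff continuous_on_delay_functional mu X)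
  show "continuous_on {0..} X" using tau_nonneg by (intro continuous_on_subset[OF X]) auto
  show "continuous_on {0..} (\<lambda>t. LINT u:{0..t}|lborel. L X u)"
  proof (rule continuous_on_atLeastI)
    fix T
    have "L X integrable_on {0..T}"
      by (rule set_borel_integral_eq_integral[OF set_integrable_L[OF X]])
    then have "continuous_on {0..T} (\<lambda>t. integral {0..t} (L X))"
      by (rule indefinite_integral_continuous_1)
    then show "continuous_on {0..T} (\<lambda>t. LINT u:{0..t}|lborel. L X u)"
      by (simp add: set_borel_integral_eq_integral(2)[OF set_integrable_L[OF X]])
  qed
qed

lemma neutral_path_neutral_solution:
  assumes x: "neutral_solution \<tau> \<mu> \<nu> \<phi> x"
  shows "neutral_path (\<phi> 0 - delay_functional \<tau> \<mu> \<phi>) (\<lambda>_. 0) x"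
  unfolding neutral_path_def
proof (intro conjI allI impI)
  show cx: "continuous_on {-\<tau>..} x" using x by (simp add: neutral_solution_def)
  fix t :: real assume t: "t \<ge> 0"
  have "D x 0 = delay_functional \<tau> \<mu> \<phi>"
    using x by (intro delay_functional_cong) (simp add: neutral_solution_def segment_def)
  moreover have "x 0 = \<phi> 0" using x tau_nonneg by (simp add: neutral_solution_def)
  moreover have "(L x has_integral (x t - D x t) - (x 0 - D x 0)) {0..t}"
  proof (rule fundamental_theorem_of_calculus[OF t])
    fix u assume "u \<in> {0..t}"
    then have "((\<lambda>t. x t - D x t) has_vector_derivative L x u) (at u within {0..})"
      using x by (simp add: neutral_solution_def)
    then show "((\<lambda>t. x t - D x t) has_vector_derivative L x u) (at u within {0..t})"
      by (rule has_vector_derivative_within_subset) auto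
  qed
  ultimately show "x t - D x t = \<phi> 0 - delay_functional \<tau> \<mu> \<phi> + (LINT u:{0..t}|lborel. L x u) + 0"
    using set_borel_integral_eq_integral(2)[OF set_integrable_L[OF cx]]
    by (simp add: integral_unique)
qed

end

section \<open>The stochastic neutral equation\<close>

locale stochastic_neutral = filtered_brownian M F B + neutral_resolvent \<tau> \<mu> \<nu> \<rho>
  for M :: "'a measure" and F :: "real \<Rightarrow> 'a measure" and B :: "real \<Rightarrow> 'a \<Rightarrow> real^'m"
    and \<tau> :: real and \<mu> \<nu> :: "real set \<Rightarrow> real^'d^'d" and \<rho> :: "real \<Rightarrow> real^'d^'d" +
  fixes \<Sigma> :: "real^'m^'d" and \<phi> x :: "real \<Rightarrow> real^'d"
  assumes x: "neutral_solution \<tau> \<mu> \<nu> \<phi> x"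
begin

definition W :: "'a \<Rightarrow> real \<Rightarrow> real^'d" where "W \<omega> t = \<Sigma> *v B t \<omega>"

abbreviation noise :: "'a \<Rightarrow> real \<Rightarrow> real^'d" where "noise \<omega> t \<equiv> W \<omega> t - W \<omega> 0"

abbreviation c where "c \<equiv> \<phi> 0 - delay_functional \<tau> \<mu> \<phi>"

abbreviation sde where "sde \<equiv> stochastic_neutral_solution M F B \<tau> \<mu> \<nu> \<Sigma> \<phi>"

lemma noise_eq: "noise \<omega> t = \<Sigma> *v (B t \<omega> - B 0 \<omega>)"
  by (simp add: W_def matrix_vector_mult_diff_distrib)

lemma AE_continuous_W: "AE \<omega> in M. continuous_on {0..} (W \<omega>)"
proof -
  have "AE \<omega> in M. continuous_on {0..} (\<lambda>t. B t \<omega>)" using bm by (simp add: brownian_motion_def)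
  then show ?thesis
    unfolding W_def[abs_def]
    by eventually_elim (rule bounded_linear.continuous_on[OF matrix_vector_mul_bounded_linear])
qed

lemma x_initial: "t \<in> {-\<tau>..0} \<Longrightarrow> x t = \<phi> t"
  using x by (simp add: neutral_solution_def)

text \<open>
  For each fixed \<open>t\<close> the integral of the constant \<open>\<Sigma>\<close> is almost surely \<open>\<Sigma> (B t - B 0)\<close>. Only
  countably many exceptional sets can be united, those of rational \<open>t\<close>, and continuity in \<open>t\<close> of both sides of the equation extends
  the identity to all \<open>t\<close>.
\<close>

lemma sde_neutral_path:
  assumes X: "sde X"
  shows "AE \<omega> in M. neutral_path c (noise \<omega>) (\<lambda>t. X t \<omega>)"
proof -
  obtain J where J: "\<And>t. t \<ge> 0 \<Longrightarrow> has_ito_integral M F B t (\<lambda>s \<omega>. \<Sigma>) (J t)"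
    and eq: "AE \<omega> in M. \<forall>t\<ge>0. X t \<omega> - D (\<lambda>r. X r \<omega>) t = c + (LINT s:{0..t}|lborel. L (\<lambda>r. X r \<omega>) s) + J t \<omega>"
    using X unfolding stochastic_neutral_solution_def by blast
  have "countable ({0..} \<inter> \<rat> :: real set)" by (intro countable_Int2 countable_rat)
  then have "AE \<omega> in M. \<forall>t\<in>{0..} \<inter> \<rat>. J t \<omega> = noise \<omega> t"
    unfolding noise_eq
    by (rule AE_ball_countable'[rotated]) (use has_ito_integral_const_unique[OF _ J] in auto)
  moreover have "AE \<omega> in M. continuous_on {-\<tau>..} (\<lambda>t. X t \<omega>)"
    using X by (simp add: stochastic_neutral_solution_def)
  ultimately show ?thesis
    using eq AE_continuous_W
  proof eventually_elim
    case (elim \<omega>)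
    let ?X = "\<lambda>r. X r \<omega>"
    let ?g = "\<lambda>t. (?X t - D ?X t - (LINT u:{0..t}|lborel. L ?X u)) - noise \<omega> t"
    have clos: "closure ({0..} \<inter> \<rat>) = ({0..} :: real set)"
      by (subst closure_convex_Int_superset) (auto simp: Rats_closure_real)
    have cont: "continuous_on (closure ({0..} \<inter> \<rat>)) ?g"
      unfolding clos using elim by (intro continuous_on_diff continuous_on_neutral_defect continuous_on_const) auto
    have "?g t = c" if "t \<in> {0..} \<inter> \<rat>" for t
      using elim(1,3) that by auto
    then have "?g t = c" if "t \<ge> 0" for t
      using continuous_constant_on_closure[OF cont, of c t] that unfolding clos by simp
    then show ?case
      using elim(2) unfolding neutral_path_def by (simp add: algebra_simps)
  qed
qed

lemma sde_forced:
  assumes X: "sde X"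
  shows "AE \<omega> in M. forced (noise \<omega>) (\<lambda>t. if t < 0 then 0 else X t \<omega> - x t)"
proof -
  have "AE \<omega> in M. \<forall>t\<in>{-\<tau>..0}. X t \<omega> = \<phi> t" using X by (simp add: stochastic_neutral_solution_def)
  with sde_neutral_path[OF X] show ?thesis
  proof eventually_elim
    case (elim \<omega>)
    then show ?case
      using forced_neutral_path_diff[OF elim(1) neutral_path_neutral_solution[OF x]] x_initial by simp
  qed
qed

lemma sde_unique:
  assumes "sde X" "sde X'"
  shows "AE \<omega> in M. \<forall>t\<ge>-\<tau>. X t \<omega> = X' t \<omega>"
proof -
  have "AE \<omega> in M. \<forall>t\<in>{-\<tau>..0}. X t \<omega> = \<phi> t" "AE \<omega> in M. \<forall>t\<in>{-\<tau>..0}. X' t \<omega> = \<phi> t"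
    using assms by (simp_all add: stochastic_neutral_solution_def)
  with sde_forced[OF assms(1)] sde_forced[OF assms(2)] show ?thesis
  proof eventually_elim
    case (elim \<omega>)
    show ?case
    proof (intro allI impI)
      fix t assume "t \<ge> -\<tau>"
      show "X t \<omega> = X' t \<omega>"
        using elim(3,4) \<open>t \<ge> -\<tau>\<close> fun_cong[OF forced_unique[OF elim(1,2)], of t]
        by (cases "t < 0") auto
    qed
  qed
qed

lemma grid_convolution_measurable:
  assumes "h > 0" "t \<ge> 0"
  shows "(\<lambda>\<omega>. grid_convolution h N (W \<omega>) t) \<in> borel_measurable (F t)"
  unfolding grid_convolution_def
proof (rule borel_measurable_sum)
  fix i
  show "(\<lambda>\<omega>. R (t - h * real (Suc i)) *v (W \<omega> (h * real (Suc i)) - W \<omega> (h * real i))) \<in> borel_measurable (F t)"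
  proof (cases "h * real (Suc i) \<le> t")
    case True
    moreover have "h * real i \<le> h * real (Suc i)" using assms(1) by simp
    ultimately have "h * real i \<le> t" by linarith
    with True show ?thesis
      using assms(1) unfolding W_def
      by (intro matrix_vector_measurable borel_measurable_diff borel_measurable_const B_measurable_F) auto
  qed (simp add: R_neg)
qed

text \<open>
  The solution is \<open>x\<close> plus the limit of the grid convolutions. Each of these is measurable at time \<open>t\<close>,
  and so is \<^const>\<open>lim\<close> of the sequence, whose value at points of divergence is a constant.
\<close>

lemma sde_exists: "\<exists>X. sde X"
proof
  define h :: "nat \<Rightarrow> real" where "h k = 1 / 2 ^ k" for k
  define N :: "nat \<Rightarrow> nat" where "N k = 4 ^ k" for k
  have h: "h k > 0" "h \<longlonglongrightarrow> 0" for k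
    unfolding h_def by (simp, real_asymp)
  have N: "\<forall>\<^sub>F k in sequentially. T \<le> h k * real (N k)" for T
    unfolding h_def N_def by real_asymp
  define Y where "Y \<omega> t = lim (\<lambda>k. grid_convolution (h k) (N k) (W \<omega>) t)" for \<omega> t
  have Y_le_0: "Y \<omega> t = 0" if "t \<le> 0" for \<omega> t
  proof -
    have "t - h k * real (Suc i) < 0" for k i
      using that mult_pos_pos[OF h(1)[of k], of "real (Suc i)"] by linarith
    then show ?thesis by (simp add: Y_def grid_convolution_def R_neg)
  qed
  have path: "AE \<omega> in M. neutral_path c (noise \<omega>) (\<lambda>t. x t + Y \<omega> t)"
    using AE_continuous_W
  proof eventually_elim
    case (elim \<omega>)
    have "forced (noise \<omega>) (Y \<omega>)"
      unfolding Y_def by (rule forced_solution_grid_limit[OF elim h N])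
    from neutral_path_add_forced[OF neutral_path_neutral_solution[OF x] this continuous_on_forced_solution[OF elim this]]
    show ?case by simp
  qed
  show "sde (\<lambda>t \<omega>. x t + Y \<omega> t)"
    unfolding stochastic_neutral_solution_def
  proof (intro conjI exI[of _ "\<lambda>t \<omega>. noise \<omega> t"] allI impI)
    show "adapted F (\<lambda>t \<omega>. x t + Y \<omega> t)"
      unfolding adapted_def Y_def
      by (intro allI impI borel_measurable_add borel_measurable_const borel_measurable_lim_metric grid_convolution_measurable h)
    show "AE \<omega> in M. continuous_on {-\<tau>..} (\<lambda>t. x t + Y \<omega> t)"
      using path by eventually_elim (simp add: neutral_path_def)
    show "AE \<omega> in M. \<forall>t\<in>{-\<tau>..0}. x t + Y \<omega> t = \<phi> t"
      by (simp add: Y_le_0 x_initial)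
    show "has_ito_integral M F B t (\<lambda>s \<omega>. \<Sigma>) (\<lambda>\<omega>. noise \<omega> t)" if "t \<ge> 0" for t
      unfolding noise_eq using that by (rule has_ito_integral_constI)
    show "AE \<omega> in M. \<forall>t\<ge>0. x t + Y \<omega> t - D (\<lambda>r. x r + Y \<omega> r) t =
        c + (LINT s:{0..t}|lborel. L (\<lambda>r. x r + Y \<omega> r) s) + noise \<omega> t"
      using path unfolding neutral_path_def by eventually_elim (erule conjunct2)
  qed
qed

text \<open>
  The grids with \<open>2 ^ k\<close> cells end exactly at \<open>t\<close>, so at time \<open>t\<close> the grid convolution is a dyadic Riemann
  sum of the Ito integral. The pathwise limit of the former, \<open>X t - x t\<close>, is thus the Ito integral.
\<close>

lemma sde_minus_deterministic_ito:
  assumes X: "sde X" and t: "t \<ge> 0"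
  shows "has_ito_integral M F B t (\<lambda>s \<omega>. \<rho> (t - s) ** \<Sigma>) (\<lambda>\<omega>. X t \<omega> - x t)"
proof (rule has_ito_integral_deterministicI[OF t])
  have "linear (\<lambda>A. A ** \<Sigma>)"
    by (intro linearI) (simp_all add: matrix_matrix_mult_def vec_eq_iff sum.distrib distrib_right sum_distrib_left mult.assoc)
  then have lin: "bounded_linear (\<lambda>A. A ** \<Sigma>)" by (simp add: linear_conv_bounded_linear)
  have "continuous_on {0..} \<rho>" using rho by (simp add: resolvent_def)
  then have "continuous_on {0..t} (\<lambda>s. \<rho> (t - s))"
    by (rule continuous_on_compose2) (auto intro!: continuous_intros)
  then show "continuous_on {0..t} (\<lambda>s. \<rho> (t - s) ** \<Sigma>)"
    by (rule bounded_linear.continuous_on[OF lin])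
  have "X t \<in> borel_measurable (F t)"
    using X t by (simp add: stochastic_neutral_solution_def adapted_def)
  then show "(\<lambda>\<omega>. X t \<omega> - x t) \<in> borel_measurable M"
    using measurable_F_imp[OF t] by (intro borel_measurable_diff) auto
  have sum: "(\<Sum>i<2 ^ k. (\<rho> (t - t / 2 ^ k * real (Suc i)) ** \<Sigma>) *v (B (t / 2 ^ k * real (Suc i)) \<omega> - B (t / 2 ^ k * real i) \<omega>)) =
    grid_convolution (t / 2 ^ k) (2 ^ k) (W \<omega>) t" for k \<omega>
    unfolding grid_convolution_def
  proof (rule sum.cong[OF refl])
    fix i :: nat assume "i \<in> {..<2 ^ k}"
    then have "real (Suc i) \<le> real (2 ^ k)" by (intro of_nat_mono) simp
    then have "t * real (Suc i) \<le> t * 2 ^ k" using t by (intro mult_left_mono) simp_all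
    then have "t - t / 2 ^ k * real (Suc i) \<ge> 0" by (simp add: field_simps)
    then show "(\<rho> (t - t / 2 ^ k * real (Suc i)) ** \<Sigma>) *v (B (t / 2 ^ k * real (Suc i)) \<omega> - B (t / 2 ^ k * real i) \<omega>) =
      R (t - t / 2 ^ k * real (Suc i)) *v (W \<omega> (t / 2 ^ k * real (Suc i)) - W \<omega> (t / 2 ^ k * real i))"
      by (simp add: R_def W_def matrix_vector_mul_assoc[symmetric] matrix_vector_mult_diff_distrib)
  qed
  show "AE \<omega> in M. (\<lambda>k. \<Sum>i<2 ^ k. (\<rho> (t - t / 2 ^ k * real (Suc i)) ** \<Sigma>) *v
      (B (t / 2 ^ k * real (Suc i)) \<omega> - B (t / 2 ^ k * real i) \<omega>)) \<longlonglongrightarrow> X t \<omega> - x t"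
    unfolding sum using sde_forced[OF X] AE_continuous_W
  proof eventually_elim
    case (elim \<omega>)
    let ?Y = "\<lambda>t. if t < 0 then 0 else X t \<omega> - x t"
    show ?case
    proof (cases "t = 0")
      case True
      have "?Y 0 = 0" using forced_initial[OF elim(1)] by simp
      then show ?thesis using True by (simp add: grid_convolution_def)
    next
      case False
      with t have h: "t / 2 ^ k > 0" "(\<lambda>k. t / 2 ^ k) \<longlonglongrightarrow> 0" for k :: nat
        by (simp, real_asymp)
      have "\<forall>\<^sub>F k in sequentially. t \<le> t / 2 ^ k * real (2 ^ k)" by simp
      from tendsto_uniform_limitI[OF uniform_limit_grid_convolution[OF elim(2) h this elim(1)], of t]
      show ?thesis using t by simp
    qed
  qed
qed

end

theorem theorem1:
  fixes M :: "'a measure"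
    and F :: "real \<Rightarrow> 'a measure"
    and B :: "real \<Rightarrow> 'a \<Rightarrow> real^'m"
    and \<tau> :: real
    and \<mu> \<nu> :: "real set \<Rightarrow> real^'d^'d"
    and \<Sigma> :: "real^'m^'d"
    and \<phi> x :: "real \<Rightarrow> real^'d"
    and \<rho> :: "real \<Rightarrow> real^'d^'d"
  assumes "prob_space M" and "complete_measure M"
    and "usual_conditions M F"
    and "brownian_motion M F B"
    and "\<tau> \<ge> 0"
    and "matrix_measure \<tau> \<mu>" and "matrix_measure \<tau> \<nu>"
    and "\<mu> {0} = 0"
    and "continuous_on {-\<tau>..0} \<phi>"
    and "neutral_solution \<tau> \<mu> \<nu> \<phi> x"
    and "resolvent \<tau> \<mu> \<nu> \<rho>"
  shows "(\<exists>X. stochastic_neutral_solution M F B \<tau> \<mu> \<nu> \<Sigma> \<phi> X) \<and>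
    (\<forall>X X'. stochastic_neutral_solution M F B \<tau> \<mu> \<nu> \<Sigma> \<phi> X \<longrightarrow>
       stochastic_neutral_solution M F B \<tau> \<mu> \<nu> \<Sigma> \<phi> X' \<longrightarrow>
       (AE \<omega> in M. \<forall>t\<ge>-\<tau>. X t \<omega> = X' t \<omega>)) \<and>
    (\<forall>X. stochastic_neutral_solution M F B \<tau> \<mu> \<nu> \<Sigma> \<phi> X \<longrightarrow>
       (\<exists>Z. (\<forall>t\<ge>0. has_ito_integral M F B t (\<lambda>s \<omega>. \<rho> (t - s) ** \<Sigma>) (Z t)) \<and>
            (AE \<omega> in M. \<forall>t\<ge>0. X t \<omega> = x t + Z t \<omega>)) \<and>
       (AE \<omega> in M. \<forall>t\<in>{-\<tau>..0}. X t \<omega> = \<phi> t))"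
proof -
  interpret prob_space M by fact
  interpret stochastic_neutral M F B \<tau> \<mu> \<nu> \<rho> \<Sigma> \<phi> x
    by unfold_locales (fact assms)+
  show ?thesis
  proof (intro conjI allI impI)
    show "\<exists>X. sde X" by (rule sde_exists)
    show "AE \<omega> in M. \<forall>t\<ge>-\<tau>. X t \<omega> = X' t \<omega>" if "sde X" "sde X'" for X X'
      using that by (rule sde_unique)
    fix X assume X: "sde X"
    show "\<exists>Z. (\<forall>t\<ge>0. has_ito_integral M F B t (\<lambda>s \<omega>. \<rho> (t - s) ** \<Sigma>) (Z t)) \<and>
            (AE \<omega> in M. \<forall>t\<ge>0. X t \<omega> = x t + Z t \<omega>)"
      using sde_minus_deterministic_ito[OF X] by (intro exI[of _ "\<lambda>t \<omega>. X t \<omega> - x t"]) simp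
    show "AE \<omega> in M. \<forall>t\<in>{-\<tau>..0}. X t \<omega> = \<phi> t"
      using X by (simp add: stochastic_neutral_solution_def)
  qed
qed

end
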